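(* Let $\varepsilon>0$ be fixed. Suppose that $\xi\in\mathcal{D}_{1/2}$, $|\sinh \xi| \ge \varepsilon$, $\pm\Im\xi>0$ and that $\nu\in \mathbb{C}$ is bounded. Then, as $\Re \mu\to+\infty$ with $\Im \mu$ bounded (upper or lower signs taken consistently), $$\begin{aligned}P_\nu ^\mu \left(e^{\pm\pi i}\coth \xi \right) \sim \; & -C\left(\xi,\mu+\tfrac12\right)\frac{\sin(\pi\nu)}{\pi} e^{\mu\xi} \sum_{n = 0}^{\infty} a_n \left(\nu+\tfrac12\right) \Gamma ( \mu-n) \left( \frac{-e^{ - \xi } }{\sinh \xi } \right)^n \\ &+\frac{\sin(\pi\mu)}{\pi}e^{-\mu\xi}\sum_{n = 0}^{\infty} a_n \left(\nu+\tfrac12\right) \Gamma ( \mu-n) \left( \frac{e^{\xi } }{\sinh \xi } \right)^n,\end{aligned}$$ $$\begin{aligned} e^{-\pi i\mu}Q_\nu ^\mu \left(e^{\pm\pi i}\coth \xi \right) \sim \; & -C\left(\xi,\nu+\tfrac12\right)\tfrac{1}{2} e^{\mu\xi} \sum_{n = 0}^{\infty} a_n \left(\nu+\tfrac12\right) \Gamma ( \mu-n) \left( \frac{-e^{ - \xi } }{\sinh \xi } \right)^n \\ & +\tfrac12 e^{-\mu\xi}\sum_{n = 0}^{\infty} a_n \left(\nu+\tfrac12\right) \Gamma ( \mu-n) \left( \frac{e^{\xi } }{\sinh \xi } \right)^n.\end{aligned}$$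
   Context: $\mathcal{D}_{1/2}=\{\xi\in\mathbb{C} : \Re \xi>0,\ |\Im \xi |<\frac{\pi}{2}\}$; $\coth$ maps $\mathcal{D}_{1/2}$ biholomorphically onto $\{z:\Re z>0,\ z\notin(0,1]\}$. For $\pm\Im\xi>0$, the point $e^{\pm\pi i}\coth\xi=-\coth\xi$ lies in $\mathbb{C}\setminus(-\infty,1]$, with $\pm\arg(e^{\pm\pi i}\coth\xi)\in(\frac{\pi}{2},\pi)$, and the functions are evaluated there on their principal sheet. Meaning of $\sim$: an expansion $f\sim A\sum_{n\ge0} s_n + B\sum_{n\ge0} t_n$ with $s_n=a_n(\nu+\frac12)\Gamma(\mu-n)X^n$, $t_n=a_n(\nu+\frac12)\Gamma(\mu-n)Y^n$ means that for all fixed non-negative integers $N,M$ one can write $f=A\left(\sum_{n=0}^{N-1}s_n+\mathcal{O}(|\Gamma(\mu-N)||X|^N)\right)+B\left(\sum_{m=0}^{M-1}t_m+\mathcal{O}(|\Gamma(\mu-M)||Y|^M)\right)$ in the stated limit, with implied constants uniform over the allowed $\xi$, $\nu$ (in a fixed bounded set) and $\Im\mu$ (in a fixed bounded set). Associated Legendre functions, for $z\in\mathbb{C}\setminus(-\infty,1]$ (powers positive-based for $z>1$, continued by analyticity): $P_\nu ^\mu (z) = \left(\frac{z + 1}{z - 1}\right)^{\mu /2}\mathbf{F}\left(\nu+1,-\nu;1-\mu;\frac{1-z}{2}\right)$ and, for $\nu+\mu\notin\mathbb{Z}_{<0}$, $e^{-\pi i\mu }Q_\nu ^\mu (z) = \frac{\pi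 ^{1/2} \Gamma (\nu +\mu + 1)(z^2 - 1)^{\mu /2} }{2^{\nu + 1} z^{\nu +\mu + 1}}\mathbf{F}\left(\tfrac{\nu+\mu+2}{2},\tfrac{\nu+\mu+1}{2};\nu+\tfrac32;\tfrac{1}{z^2}\right)$, where $\mathbf{F}(a,b;c;w)=\sum_{n\ge 0}\frac{(a)_n(b)_n}{\Gamma(c+n)\,n!}w^n$ ($|w|<1$), continued analytically to $\mathbb{C}\setminus[1,+\infty)$. $a_n (\mu ) = \frac{(4\mu ^2 - 1^2 )(4\mu ^2 - 3^2 ) \cdots (4\mu ^2 - (2n - 1)^2 )}{8^n n!}$. $C(\xi ,\mu ) = \sin (\pi \mu )$ if $\xi > 0$, and $C(\xi,\mu)=\pm i\, e^{ \mp \pi i\mu }$ if $0<\pm \Im\xi < \pi$. *)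

theory Defs
  imports "HOL-Complex_Analysis.Complex_Analysis" "HOL-Library.Landau_Symbols"
begin

definition coth :: "complex \<Rightarrow> complex" where
  "coth z = cosh z / sinh z"

definition D_half :: "complex set" where
  "D_half = {\<xi>. Re \<xi> > 0 \<and> \<bar>Im \<xi>\<bar> < pi / 2}"

text \<open>The regularised hypergeometric function: the analytic continuation of its power series from the
  unit disc to the plane cut along \<open>[1, \<infinity>)\<close>. The cut plane is connected, so the chosen function is
  determined there; its values on the cut are unspecified and play no role.\<close>

definition hypergeo_reg :: "complex \<Rightarrow> complex \<Rightarrow> complex \<Rightarrow> complex \<Rightarrow> complex" where
  "hypergeo_reg a b c = (SOME f. f holomorphic_on - (complex_of_real ` {1..}) \<and>
     (\<forall>w\<in>ball 0 1. (\<lambda>n. pochhammer a n * pochhammer b n * rGamma (c + of_nat n) / fact n * w ^ n)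
        sums f w))"

text \<open>For \<open>z\<close> outside \<open>(-\<infinity>, 1]\<close> the quotient \<open>(z + 1) / (z - 1)\<close> avoids \<open>(-\<infinity>, 0]\<close>, so its principal
  power is the analytic continuation from \<open>z > 1\<close>. By contrast \<open>z\<^sup>2 - 1\<close> meets the cut of the principal
  power (on the imaginary axis), and the continuation of \<open>(z\<^sup>2 - 1)\<close> to the power \<open>\<mu>/2\<close> is the product of
  the principal powers of \<open>z - 1\<close> and \<open>z + 1\<close>.\<close>

definition legendre_P :: "complex \<Rightarrow> complex \<Rightarrow> complex \<Rightarrow> complex" where
  "legendre_P \<nu> \<mu> z =
     ((z + 1) / (z - 1)) powr (\<mu> / 2) * hypergeo_reg (\<nu> + 1) (- \<nu>) (1 - \<mu>) ((1 - z) / 2)"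

text \<open>Meaningful only if \<open>\<nu> + \<mu>\<close> is not a negative integer.\<close>

definition legendre_Q :: "complex \<Rightarrow> complex \<Rightarrow> complex \<Rightarrow> complex" where
  "legendre_Q \<nu> \<mu> z = exp (of_real pi * \<i> * \<mu>) *
     (of_real (sqrt pi) * Gamma (\<nu> + \<mu> + 1) * ((z - 1) powr (\<mu> / 2) * (z + 1) powr (\<mu> / 2))
       / (2 powr (\<nu> + 1) * z powr (\<nu> + \<mu> + 1))
       * hypergeo_reg ((\<nu> + \<mu> + 2) / 2) ((\<nu> + \<mu> + 1) / 2) (\<nu> + 3 / 2) (1 / z\<^sup>2))"

definition a_coeff :: "nat \<Rightarrow> complex \<Rightarrow> complex" where
  "a_coeff n \<mu> = (\<Prod>k=1..n. 4 * \<mu>\<^sup>2 - (2 * of_nat k - 1)\<^sup>2) / (8 ^ n * fact n)"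

text \<open>Used only for \<open>\<xi> > 0\<close> and for \<open>0 < \<bar>Im \<xi>\<bar> < \<pi>\<close>.\<close>

definition C_fun :: "complex \<Rightarrow> complex \<Rightarrow> complex" where
  "C_fun \<xi> \<mu> =
     (if Im \<xi> > 0 then \<i> * exp (- of_real pi * \<i> * \<mu>)
      else if Im \<xi> < 0 then - \<i> * exp (of_real pi * \<i> * \<mu>)
      else sin (of_real pi * \<mu>))"

text \<open>The limit \<open>Re \<mu> \<rightarrow> +\<infinity>\<close> for triples \<open>(\<xi>, \<nu>, \<mu>)\<close> in a set \<open>S\<close>. A Landau bound along this filter has a
  constant and a threshold for \<open>Re \<mu>\<close> that are uniform over \<open>S\<close>.\<close>

definition mu_limit :: "(complex \<times> complex \<times> complex) set \<Rightarrow> (complex \<times> complex \<times> complex) filter" where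
  "mu_limit S = inf (filtercomap (\<lambda>(\<xi>, \<nu>, \<mu>). Re \<mu>) at_top) (principal S)"

text \<open>The sign \<open>\<sigma> \<in> {1, -1}\<close> selects the upper or lower half plane for \<open>\<xi>\<close>.\<close>

definition allowed_params ::
  "real \<Rightarrow> real \<Rightarrow> complex set \<Rightarrow> real set \<Rightarrow> (complex \<times> complex \<times> complex) set" where
  "allowed_params \<epsilon> \<sigma> V T =
     {(\<xi>, \<nu>, \<mu>). \<xi> \<in> D_half \<and> norm (sinh \<xi>) \<ge> \<epsilon> \<and> \<sigma> * Im \<xi> > 0 \<and> \<nu> \<in> V \<and> Im \<mu> \<in> T}"

text \<open>\<open>f \<sim> A \<Sum> s\<^sub>n + B \<Sum> t\<^sub>n\<close> with \<open>s\<^sub>n = a\<^sub>n(\<nu> + 1/2) \<Gamma>(\<mu> - n) X\<^sup>n\<close>, \<open>t\<^sub>n = a\<^sub>n(\<nu> + 1/2) \<Gamma>(\<mu> - n) Y\<^sup>n\<close>. The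
  functions \<open>r\<close> and \<open>q\<close> are the two error terms; Landau symbols depend only on norms.\<close>

definition double_expansion ::
  "(complex \<times> complex \<times> complex) filter \<Rightarrow> (complex \<Rightarrow> complex \<Rightarrow> complex \<Rightarrow> complex) \<Rightarrow>
   (complex \<Rightarrow> complex \<Rightarrow> complex \<Rightarrow> complex) \<Rightarrow> (complex \<Rightarrow> complex) \<Rightarrow>
   (complex \<Rightarrow> complex \<Rightarrow> complex \<Rightarrow> complex) \<Rightarrow> (complex \<Rightarrow> complex) \<Rightarrow> bool" where
  "double_expansion F f A X B Y \<longleftrightarrow>
     (\<forall>N M :: nat. \<exists>r q.
        r \<in> O[F](\<lambda>(\<xi>, \<nu>, \<mu>). Gamma (\<mu> - of_nat N) * X \<xi> ^ N) \<and>
        q \<in> O[F](\<lambda>(\<xi>, \<nu>, \<mu>). Gamma (\<mu> - of_nat M) * Y \<xi> ^ M) \<and>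
        (\<forall>\<^sub>F (\<xi>, \<nu>, \<mu>) in F. f \<xi> \<nu> \<mu> =
           A \<xi> \<nu> \<mu> * ((\<Sum>n<N. a_coeff n (\<nu> + 1/2) * Gamma (\<mu> - of_nat n) * X \<xi> ^ n) + r (\<xi>, \<nu>, \<mu>)) +
           B \<xi> \<nu> \<mu> * ((\<Sum>m<M. a_coeff m (\<nu> + 1/2) * Gamma (\<mu> - of_nat m) * Y \<xi> ^ m) + q (\<xi>, \<nu>, \<mu>))))"

end

theory Submission
  imports Defs
begin

text \<open>
  Put \<open>u = (1 + coth \<xi>) / 2\<close>, so that \<open>2 u = e\<^sup>\<xi> / sinh \<xi>\<close>, \<open>2 (1 - u) = - e\<^bsup>-\<xi>\<^esup> / sinh \<xi>\<close> and the functions are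
  evaluated at \<open>z = 1 - 2 u\<close>. With \<open>G(w) = \<Gamma>(\<nu>+\<mu>+1) \<Gamma>(\<mu>-\<nu>) F(\<nu>+1, -\<nu>; 1+\<mu>; 1-w)\<close>, Euler's integral reads
  \<open>G(w) = \<Gamma>(\<nu>+\<mu>+1) / \<Gamma>(\<nu>+1) \<integral>\<^sub>0\<^sup>1 t\<^sup>\<nu> (1-t)\<^bsup>\<mu>-1\<^esup> (1 + w t/(1-t))\<^sup>\<nu> dt\<close>, and expanding the last factor binomially gives
  \<open>G(w) \<sim> \<Sum> a\<^sub>n(\<nu>+1/2) \<Gamma>(\<mu>-n) (2 w)\<^sup>n\<close> uniformly for bounded \<open>w\<close> off the negative axis. The integrand may be
  singular at \<open>t = 1/(1+|w|)\<close>, but by the symmetry \<open>\<nu> \<mapsto> -1-\<nu>\<close> one may take \<open>Re \<nu> \<ge> -1/2\<close>; the singularity is then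
  integrable and the factor \<open>(1-t)\<^bsup>\<mu>-1\<^esup>\<close> makes its contribution exponentially small.

  The theorem therefore follows from two exact connection formulas that express \<open>P\<close> and \<open>Q\<close> by \<open>G(1-u)\<close> and \<open>G(u)\<close>.
  After division by \<open>(z\<^sup>2-1)\<^bsup>\<mu>/2\<^esup>\<close> all four functions solve one second order linear equation on a half plane, so only
  two constants must be found, and these are read off from the behaviour at \<open>u = 0\<close> and \<open>u = 1\<close>.
\<close>

section \<open>Integrals depending on a parameter and the complex Beta integral\<close>

text \<open>\<open>hypergeo_reg\<close> is a choice operator, so nothing is known about it until a
  continuation to the slit plane has been exhibited for every parameter triple. Euler's integral
  supplies one only for 0 < Re b < Re c; contiguous relations carry it to all other parameters. The
  obstacle in the expansion is uniformity: as Im \<xi> tends to 0, 1 - u comes arbitrarily close to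
  the negative axis, so the estimates may depend on w only through |w|. The condition |sinh \<xi>|
  \<ge> \<epsilon> enters through a common bound for |u| and |1 - u|, and bounded Im \<mu> through
  the comparison of |Gamma| at a complex point with Gamma at its real part. The two connection
  constants are separated by size: the exponents of the equation at u = 0 and at u = 1 are 0 and
  -\<mu>, so for Re \<mu> > 0 multiplication by u^\<mu> or (1 - u)^\<mu> removes one basis solution
  in the limit. The limits required of P at 1 and of Q are those of a hypergeometric series at a
  boundary point of its disc; they are taken along paths in a Stolz angle.\<close>

lemma integrable_Ioo_bounded_continuous:
  fixes f :: "real \<Rightarrow> complex" and g :: "real \<Rightarrow> real"
  assumes "continuous_on {0<..<1} f" "g integrable_on {0<..<1}"
    and "\<And>t. t \<in> {0<..<1} \<Longrightarrow> norm (f t) \<le> g t"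
  shows "f integrable_on {0<..<1}"
  by (rule measurable_bounded_by_integrable_imp_integrable[OF _ assms(2)])
     (use assms in \<open>auto intro!: continuous_imp_measurable_on_sets_lebesgue\<close>)

text \<open>Continuity of the indefinite integral up to both endpoints. The offset 3 starts the
  exhaustion at [1/3, 2/3], so no interval is degenerate.\<close>

lemma integral_exhaust_Ioo:
  fixes g :: "real \<Rightarrow> real"
  assumes "g integrable_on {0<..<1}"
  shows "(\<lambda>n. integral {1 / (real n + 3)..1 - 1 / (real n + 3)} g) \<longlonglongrightarrow> integral {0<..<1} g"
proof -
  have g: "g integrable_on {0..1}" using assms by (simp add: integrable_on_Icc_iff_Ioo)
  define I where "I = (\<lambda>x. integral {0..x} g)"
  have cI: "continuous_on {0..1} I"
    unfolding I_def by (rule indefinite_integral_continuous_1[OF g])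
  have eq: "integral {1 / (real n + 3)..1 - 1 / (real n + 3)} g
      = I (1 - 1 / (real n + 3)) - I (1 / (real n + 3))" for n
  proof -
    have le: "0 \<le> 1 / (real n + 3)" "1 / (real n + 3) \<le> 1 - 1 / (real n + 3)"
      "1 - 1 / (real n + 3) \<le> 1" by (auto simp: field_simps)
    have "g integrable_on {0..1 - 1 / (real n + 3)}"
      by (rule integrable_on_subinterval[OF g]) (use le in auto)
    from Henstock_Kurzweil_Integration.integral_combine[OF le(1,2) this] show ?thesis by (simp add: I_def)
  qed
  have l1: "(\<lambda>n. 1 / (real n + 3)) \<longlonglongrightarrow> 0"
    using LIMSEQ_ignore_initial_segment[OF lim_1_over_n[where 'a=real], of 3] by (simp add: add.commute)
  have "(\<lambda>n. I (1 / (real n + 3))) \<longlonglongrightarrow> I 0"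
    by (rule continuous_on_tendsto_compose[OF cI l1]) auto
  moreover have "(\<lambda>n. I (1 - 1 / (real n + 3))) \<longlonglongrightarrow> I 1"
  proof (rule continuous_on_tendsto_compose[OF cI])
    show "(\<lambda>n. 1 - 1 / (real n + 3)) \<longlonglongrightarrow> 1"
      using tendsto_diff[OF tendsto_const[of 1] l1] by simp
  qed (auto simp: field_simps)
  ultimately have "(\<lambda>n. I (1 - 1 / (real n + 3)) - I (1 / (real n + 3))) \<longlonglongrightarrow> I 1 - I 0"
    by (intro tendsto_diff)
  moreover have "I 1 - I 0 = integral {0<..<1} g"
    by (simp add: I_def integral_open_interval_real)
  ultimately show ?thesis unfolding eq by simp
qed

text \<open>The integrands of interest are singular at both endpoints, where the Leibniz rule does
  not apply. On compact subintervals it does, and the local majorant makes the truncated integrals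
  converge locally uniformly, so the limit is holomorphic. Only \<open>f\<close> has to be
  dominated, not its derivative.\<close>

lemma holomorphic_integral_Ioo:
  fixes f f' :: "complex \<Rightarrow> real \<Rightarrow> complex"
  assumes U: "open U"
    and der: "\<And>z t. z \<in> U \<Longrightarrow> t \<in> {0<..<1} \<Longrightarrow> ((\<lambda>z. f z t) has_field_derivative f' z t) (at z)"
    and cont: "\<And>z. z \<in> U \<Longrightarrow> continuous_on {0<..<1} (f z)"
    and cont': "continuous_on (U \<times> {0<..<1}) (\<lambda>(z, t). f' z t)"
    and dom: "\<And>z. z \<in> U \<Longrightarrow> \<exists>d>0. \<exists>g. cball z d \<subseteq> U \<and> g integrable_on {0<..<1} \<and>
                (\<forall>z'\<in>cball z d. \<forall>t\<in>{0<..<1}. norm (f z' t) \<le> g t)"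
  shows "(\<lambda>z. integral {0<..<1} (f z)) holomorphic_on U"
proof -
  define lo hi :: "nat \<Rightarrow> real" where "lo = (\<lambda>n. 1 / (real n + 3))" and "hi = (\<lambda>n. 1 - 1 / (real n + 3))"
  let ?J = "\<lambda>n z. integral {lo n..hi n} (f z)"
  have lo_pos: "lo n > 0" and hi_less: "hi n < 1" for n by (auto simp: lo_def hi_def)
  have sub: "{lo n..hi n} \<subseteq> {0<..<1}" for n
    using lo_pos[of n] hi_less[of n] by (auto simp: subset_iff)
  have lim: "(\<lambda>n. integral {lo n..hi n} g) \<longlonglongrightarrow> integral {0<..<1} g" if "g integrable_on {0<..<1}" for g :: "real \<Rightarrow> real"
    using integral_exhaust_Ioo[OF that] by (simp add: lo_def hi_def)
  show ?thesis
  proof (rule holomorphic_uniform_sequence[OF U])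
  show "?J n holomorphic_on U" for n
  proof -
    have "?J n field_differentiable at z" if z: "z \<in> U" for z
    proof -
      obtain e where e: "e > 0" "ball z e \<subseteq> U" using U z openE by blast
      have "(\<lambda>z. integral (cbox (lo n) (hi n)) (f z)) holomorphic_on ball z e"
      proof (rule leibniz_rule_holomorphic)
        show "continuous_on (ball z e \<times> cbox (lo n) (hi n)) (\<lambda>(z, t). f' z t)"
        proof (rule continuous_on_subset[OF cont'])
          show "ball z e \<times> cbox (lo n) (hi n) \<subseteq> U \<times> {0<..<1}"
            using Sigma_mono[OF e(2), of "\<lambda>_. {lo n..hi n}" "\<lambda>_. {0<..<1}"] sub[of n] by simp
        qed
        show "f x integrable_on cbox (lo n) (hi n)" if "x \<in> ball z e" for x
          using integrable_continuous_interval[OF continuous_on_subset[OF cont[OF subsetD[OF e(2) that]] sub[of n]]]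
          by simp
        show "((\<lambda>x. f x t) has_field_derivative f' x t) (at x within ball z e)"
          if "x \<in> ball z e" "t \<in> cbox (lo n) (hi n)" for x t
          by (rule has_field_derivative_at_within[OF der[OF subsetD[OF e(2) that(1)] subsetD[OF sub[of n]]]])
             (use that(2) in simp)
      qed auto
      thus ?thesis using e(1) by (simp add: holomorphic_on_imp_differentiable_at)
    qed
    thus ?thesis by (simp add: holomorphic_on_def field_differentiable_at_within)
  qed
  show "\<exists>d>0. cball z d \<subseteq> U \<and> uniform_limit (cball z d) ?J (\<lambda>z. integral {0<..<1} (f z)) sequentially"
    if z: "z \<in> U" for z
  proof -
    obtain d g where d: "d > 0" "cball z d \<subseteq> U" and g: "g integrable_on {0<..<1}"
      and b: "\<And>z' t. z' \<in> cball z d \<Longrightarrow> t \<in> {0<..<1} \<Longrightarrow> norm (f z' t) \<le> g t"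
      using dom[OF z] by blast
    have "uniform_limit (cball z d) ?J (\<lambda>z. integral {0<..<1} (f z)) sequentially"
    proof (rule uniform_limitI)
      fix e :: real assume "e > 0"
      have "\<forall>\<^sub>F n in sequentially. dist (integral {lo n..hi n} g) (integral {0<..<1} g) < e"
        using tendstoD[OF lim[OF g] \<open>e > 0\<close>] .
      thus "\<forall>\<^sub>F n in sequentially. \<forall>x\<in>cball z d. dist (?J n x) (integral {0<..<1} (f x)) < e"
      proof (eventually_elim, safe)
        fix n x assume n: "dist (integral {lo n..hi n} g) (integral {0<..<1} g) < e"
          and x: "x \<in> cball z d"
        let ?B = "{lo n..hi n}"
        let ?r = "\<lambda>h t. if t \<in> ?B then h t else 0"
        have fi: "f x integrable_on {0<..<1}"
          by (rule integrable_Ioo_bounded_continuous[OF cont g]) (use x d b in auto)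
        have fB: "f x integrable_on ?B"
          by (rule integrable_continuous_interval[OF continuous_on_subset[OF cont[OF subsetD[OF d(2) x]] sub[of n]]])
        have gB: "g integrable_on ?B"
          by (rule integrable_on_subinterval[of g "{0..1}"])
             (use g less_imp_le[OF lo_pos[of n]] less_imp_le[OF hi_less[of n]] in \<open>auto simp: integrable_on_Icc_iff_Ioo\<close>)
        have i1: "?r (f x) integrable_on {0<..<1}" "integral {0<..<1} (?r (f x)) = integral ?B (f x)"
          using integrable_integral[OF fB, folded has_integral_restrict[OF sub[of n]]]
          by (auto simp: has_integral_iff)
        have i2: "?r g integrable_on {0<..<1}" "integral {0<..<1} (?r g) = integral ?B g"
          using integrable_integral[OF gB, folded has_integral_restrict[OF sub[of n]]]
          by (auto simp: has_integral_iff)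
        \<comment> \<open>The truncation error is bounded by the tail of the integral of
          \<open>g\<close>, which is the same for all \<open>x\<close> in the disc.\<close>
        have "norm (integral {0<..<1} (\<lambda>t. f x t - ?r (f x) t)) \<le> integral {0<..<1} (\<lambda>t. g t - ?r g t)"
          by (rule integral_norm_bound_integral)
             (use fi g i1 i2 b[OF x] in \<open>auto intro!: integrable_diff\<close>)
        hence "norm (integral {0<..<1} (f x) - ?J n x) \<le> integral {0<..<1} g - integral ?B g"
          using fi g i1 i2 by (simp add: integral_diff)
        also have "\<dots> < e" using n by (auto simp: dist_real_def)
        finally show "dist (?J n x) (integral {0<..<1} (f x)) < e"
          by (simp add: dist_norm norm_minus_commute)
      qed
    qed
    with d show ?thesis by blast
  qed
qed
qed

lemma has_integral_Beta_real_Ioo: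
  assumes "a > 0" "b > (0::real)"
  shows "((\<lambda>t. t powr (a - 1) * (1 - t) powr (b - 1)) has_integral Beta a b) {0<..<1}"
  using has_integral_Beta_real[OF assms] by (simp add: has_integral_Icc_iff_Ioo)

lemma norm_of_real_powr: "t > 0 \<Longrightarrow> norm (complex_of_real t powr z) = t powr Re z"
  by (simp add: norm_powr_real_powr)

lemma powr_between_le:
  fixes t a x :: real
  assumes "0 < t" "t < 1" "a \<le> x"
  shows "t powr x \<le> t powr a"
  using assms by (intro powr_mono') auto

lemma continuous_on_Beta_integrand:
  "continuous_on {0<..<1} (\<lambda>t::real. of_real t powr (p - 1) * of_real (1 - t) powr (q - 1 :: complex))"
  by (intro continuous_intros) (auto simp: complex_nonpos_Reals_iff)

text \<open>The accumulation point that the identity theorem needs when a formula known for positive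
  real parameters is extended to the right half plane.\<close>

lemma islimpt_Re_pos:
  "(1::complex) islimpt of_real ` {0<..}"
proof -
  have "(1::real) islimpt {0<..}" by (rule interior_limit_point) (simp add: interior_open)
  thus ?thesis 
    unfolding islimpt_sequential
  proof (elim exE conjE)
    fix f :: "nat \<Rightarrow> real" assume f: "\<forall>n. f n \<in> {0<..} - {1}" "f \<longlonglongrightarrow> 1"
    have "(\<lambda>n. complex_of_real (f n)) \<longlonglongrightarrow> of_real 1" using f(2) by (intro tendsto_of_real)
    thus "\<exists>f. (\<forall>n. f n \<in> complex_of_real ` {0<..} - {1}) \<and> f \<longlonglongrightarrow> 1"
      using f(1) by (intro exI[of _ "\<lambda>n. complex_of_real (f n)"]) auto
  qed
qed

lemma Re_pos_not_nonpos_Int: "Re z > 0 \<Longrightarrow> z \<notin> \<int>\<^sub>\<le>\<^sub>0"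
  by (auto elim!: nonpos_Ints_cases')

lemma Gamma_rGamma_Re_pos:
  assumes "Re z > 0"
  shows "Gamma z \<noteq> 0" "Gamma z * rGamma z = 1"
  using Re_pos_not_nonpos_Int[OF assms] by (auto simp: Gamma_eq_zero_iff rGamma_inverse_Gamma)

lemma norm_powr_complex_le: "norm (z powr c) \<le> norm z powr Re c * exp (\<bar>Im c\<bar> * pi)" for z c :: complex
proof -
  have "\<bar>Im c * Arg z\<bar> \<le> \<bar>Im c\<bar> * pi"
    unfolding abs_mult by (intro mult_left_mono) (use mpi_less_Arg[of z] Arg_le_pi[of z] in auto)
  thus ?thesis unfolding norm_powr_complex by (intro mult_left_mono) (auto simp: abs_le_iff)
qed

lemma Re_pos_halfplane: "open {z. Re z > 0}" "connected {z. Re z > 0}"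
  by (auto simp: open_halfspace_Re_gt intro: convex_connected convex_halfspace_Re_gt)

lemma integrable_Beta_complex:
  fixes p q :: complex
  assumes "Re p > 0" "Re q > 0"
  shows "(\<lambda>t::real. of_real t powr (p - 1) * of_real (1 - t) powr (q - 1)) integrable_on {0<..<1}"
  by (rule integrable_Ioo_bounded_continuous[OF continuous_on_Beta_integrand
        has_integral_integrable[OF has_integral_Beta_real_Ioo[of "Re p" "Re q"]]])
     (use assms in \<open>auto simp: norm_mult norm_of_real_powr simp del: of_real_diff\<close>)

lemma holomorphic_Beta_integral:
  fixes q :: complex
  assumes "Re q > 0"
  shows "(\<lambda>p. integral {0<..<1} (\<lambda>t::real. of_real t powr (p - 1) * of_real (1 - t) powr (q - 1)))
           holomorphic_on {p. Re p > 0}"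
proof (rule holomorphic_integral_Ioo[where 
      f' = "\<lambda>p t. of_real t powr (p - 1) * Ln (of_real t) * of_real (1 - t) powr (q - 1)"])
  fix p :: complex assume p: "p \<in> {p. Re p > 0}"
  \<comment> \<open>Half the distance to the imaginary axis: all real parts in the disc are at least
    \<open>d\<close>, and since 0 < t < 1 the smallest exponent \<open>d - 1\<close> gives the
    majorant.\<close>
  define d where "d = Re p / 2"
  have d: "d > 0" "2 * d = Re p" using p by (auto simp: d_def)
  have Re: "d \<le> Re p'" if "p' \<in> cball p d" for p'
    using that abs_Re_le_cmod[of "p - p'"] d by (auto simp: dist_norm)
  show "\<exists>d>0. \<exists>g. cball p d \<subseteq> {p. Re p > 0} \<and> g integrable_on {0<..<1} \<and>
      (\<forall>p'\<in>cball p d. \<forall>t\<in>{0<..<1}. norm (of_real t powr (p' - 1) * of_real (1 - t) powr (q - 1)) \<le> g t)"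
  proof (intro exI conjI ballI)
    show "d > 0" by fact
    show "cball p d \<subseteq> {p. Re p > 0}" using Re d by force
    show "(\<lambda>t. t powr (d - 1) * (1 - t) powr (Re q - 1)) integrable_on {0<..<1}"
      by (rule has_integral_integrable[OF has_integral_Beta_real_Ioo]) (use d assms in auto)
    show "norm (of_real t powr (p' - 1) * of_real (1 - t) powr (q - 1)) \<le> t powr (d - 1) * (1 - t) powr (Re q - 1)"
      if "p' \<in> cball p d" "t \<in> {0<..<1}" for p' and t :: real
      using that Re[of p'] by (auto simp: norm_mult norm_of_real_powr simp del: of_real_diff
            intro!: mult_right_mono powr_between_le)
  qed
next
  show "continuous_on ({p. Re p > 0} \<times> {0<..<1}) (\<lambda>(p, t). of_real t powr (p - 1) * Ln (of_real t) * of_real (1 - t) powr (q - 1))"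
    unfolding case_prod_unfold by (intro continuous_intros) (auto simp: complex_nonpos_Reals_iff)
next
  fix p t assume t: "t \<in> {0<..<1::real}"
  have "((\<lambda>z. exp ((z - 1) * Ln (of_real t))) has_field_derivative
      exp ((p - 1) * Ln (of_real t)) * Ln (of_real t)) (at p)"
    by (auto intro!: derivative_eq_intros)
  hence "((\<lambda>z. of_real t powr (z - 1)) has_field_derivative of_real t powr (p - 1) * Ln (of_real t)) (at p)"
    using t by (simp add: powr_def)
  thus "((\<lambda>p. of_real t powr (p - 1) * of_real (1 - t) powr (q - 1)) has_field_derivative
         of_real t powr (p - 1) * Ln (of_real t) * of_real (1 - t) powr (q - 1)) (at p)"
    by (rule DERIV_cmult_right)
qed (auto intro!: Re_pos_halfplane continuous_on_Beta_integrand[simplified])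

text \<open>Analytic continuation from the real Beta integral, one parameter at a time: first in
  \<open>p\<close> with the other parameter real, then in \<open>q\<close> with \<open>p\<close>
  complex. The substitution of 1 - t for t exchanges the parameters, so holomorphy in the first one
  serves both times.\<close>

theorem has_integral_Beta_complex:
  fixes p q :: complex
  assumes p: "Re p > 0" and q: "Re q > 0"
  shows "((\<lambda>t::real. of_real t powr (p - 1) * of_real (1 - t) powr (q - 1)) has_integral Beta p q) {0<..<1}"
proof -
  let ?I = "\<lambda>p q :: complex. integral {0<..<1} (\<lambda>t::real. of_real t powr (p - 1) * of_real (1 - t) powr (q - 1))"
  have swap: "?I p q = ?I q p" if "Re p > 0" "Re q > 0" for p q :: complex
  proof -
    let ?f = "\<lambda>t::real. of_real t powr (p - 1) * of_real (1 - t) powr (q - 1)"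
    have "(?f has_integral ?I p q) (cbox 0 1)"
      using integrable_integral[OF integrable_Beta_complex[OF that]] by (simp add: has_integral_Icc_iff_Ioo)
    from has_integral_affinity[OF this, of "-1" 1]
    have "((\<lambda>t. ?f (1 - t)) has_integral ?I p q) ((\<lambda>t. 1 - t) ` {0..1})" by simp
    also have "(\<lambda>t. 1 - t) ` {0..1::real} = {0..1}" by (auto simp: image_def intro!: bexI[of _ "1 - _"])
    finally have "((\<lambda>t. ?f (1 - t)) has_integral ?I p q) {0<..<1}" by (simp add: has_integral_Icc_iff_Ioo)
    from integral_unique[OF this] show ?thesis by (simp add: mult.commute)
  qed
  have holB: "(\<lambda>p. Beta p q) holomorphic_on {p. Re p > 0}" if "Re q > 0" for q
    unfolding Beta_altdef by (intro holomorphic_intros) (auto dest: Re_pos_not_nonpos_Int)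
  have eq_real: "?I (of_real a) (of_real b) = Beta (of_real a) (of_real b)" if "a > 0" "b > 0" for a b :: real
  proof -
    have "((\<lambda>t. complex_of_real (t powr (a - 1) * (1 - t) powr (b - 1))) has_integral of_real (Beta a b)) {0<..<1}"
      using has_integral_of_real[OF has_integral_Beta_real_Ioo[OF that]] by (simp add: o_def)
    hence "((\<lambda>t. of_real t powr (of_real a - 1) * of_real (1 - t) powr (of_real b - 1)) has_integral Beta (of_real a) (complex_of_real b)) {0<..<1}"
      unfolding Beta_complex_of_real
    proof (rule has_integral_eq[rotated])
      fix t :: real assume "t \<in> {0<..<1}"
      hence "complex_of_real (t powr (a - 1)) = of_real t powr of_real (a - 1)"
        "complex_of_real ((1 - t) powr (b - 1)) = of_real (1 - t) powr of_real (b - 1)"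
        by (simp_all add: powr_of_real del: of_real_diff)
      thus "complex_of_real (t powr (a - 1) * (1 - t) powr (b - 1)) =
          of_real t powr (of_real a - 1) * of_real (1 - t) powr (of_real b - 1)"
        by (simp only: of_real_mult of_real_diff of_real_1)
    qed
    thus ?thesis by (rule integral_unique)
  qed
  have step1: "?I p (of_real b) = Beta p (of_real b)" if "Re p > 0" "b > 0" for p and b :: real
  proof -
    have "?I p (of_real b) - Beta p (of_real b) = 0"
      by (rule analytic_continuation[where S = "{p. Re p > 0}" and U = "of_real ` {0<..}" and \<xi> = 1])
         (use that eq_real in \<open>auto intro!: Re_pos_halfplane islimpt_Re_pos holomorphic_intros holomorphic_Beta_integral[simplified] holB\<close>)
    thus ?thesis by simp
  qed
  have "?I q p - Beta q p = 0"
    by (rule analytic_continuation[where S = "{p. Re p > 0}" and U = "of_real ` {0<..}" and \<xi> = 1])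
       (use p q step1[OF p] swap[OF p] Beta_commute[of p] in \<open>auto intro!: Re_pos_halfplane islimpt_Re_pos holomorphic_intros holomorphic_Beta_integral[simplified] holB\<close>)
  hence "?I p q = Beta p q" using swap[OF p q] by (simp add: Beta_commute)
  thus ?thesis using integrable_Beta_complex[OF p q] by (metis integrable_integral)
qed

section \<open>The regularised hypergeometric function\<close>

definition slit_plane :: "complex set" where
  "slit_plane = - (complex_of_real ` {1..})"

lemma slit_plane_iff: "w \<in> slit_plane \<longleftrightarrow> Im w \<noteq> 0 \<or> Re w < 1"
proof -
  have "w \<in> complex_of_real ` {1..} \<longleftrightarrow> Im w = 0 \<and> Re w \<ge> 1"
    by (auto simp: image_iff complex_eq_iff)
  thus ?thesis by (auto simp: slit_plane_def)
qed

lemma open_slit_plane: "open slit_plane"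
proof -
  have *: "slit_plane = {w. Im w < 0} \<union> {w. Im w > 0} \<union> {w. Re w < 1}" by (auto simp: slit_plane_iff)
  show ?thesis unfolding * by (auto intro!: open_Un open_halfspace_Im_lt open_halfspace_Im_gt open_halfspace_Re_lt)
qed

lemma slit_plane_scale:
  assumes "u \<in> slit_plane" "0 \<le> t" "t \<le> 1"
  shows "of_real t * u \<in> slit_plane"
proof -
  have "t * Re u < 1" if "Re u < 1"
  proof (cases "Re u \<le> 0")
    case True
    thus ?thesis using mult_nonneg_nonpos[OF assms(2) True] by linarith
  next
    case False
    hence "t * Re u \<le> 1 * Re u" using assms by (intro mult_right_mono) auto
    thus ?thesis using that by linarith
  qed
  thus ?thesis using assms by (cases "t = 0") (auto simp: slit_plane_iff)
qed

lemma connected_slit_plane: "connected slit_plane"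
proof (rule starlike_imp_connected)
  show "starlike slit_plane"
    unfolding starlike_def
  proof (intro bexI[of _ 0] ballI subsetI)
    fix x y assume "x \<in> slit_plane" "y \<in> closed_segment 0 x"
    thus "y \<in> slit_plane" using slit_plane_scale[of x]
      by (auto simp: closed_segment_def scaleR_conv_of_real)
  qed (auto simp: slit_plane_iff)
qed

lemma ball_subset_slit_plane: "ball 0 1 \<subseteq> slit_plane"
  using complex_Re_le_cmod by (force simp: slit_plane_iff intro: le_less_trans)

lemma one_minus_slit_plane: "u \<in> slit_plane \<Longrightarrow> 1 - u \<notin> \<real>\<^sub>\<le>\<^sub>0"
  by (auto simp: slit_plane_iff complex_nonpos_Reals_iff)

definition hyp_coeff :: "complex \<Rightarrow> complex \<Rightarrow> complex \<Rightarrow> nat \<Rightarrow> complex" where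
  "hyp_coeff a b c n = pochhammer a n * pochhammer b n * rGamma (c + of_nat n) / fact n"

text \<open>The property by which \<open>hypergeo_reg\<close> is chosen, stated for an arbitrary
  function so that it can be shown to be satisfiable.\<close>

definition hyp_continuation :: "complex \<Rightarrow> complex \<Rightarrow> complex \<Rightarrow> (complex \<Rightarrow> complex) \<Rightarrow> bool" where
  "hyp_continuation a b c f \<longleftrightarrow> f holomorphic_on slit_plane \<and>
     (\<forall>w\<in>ball 0 1. (\<lambda>n. hyp_coeff a b c n * w ^ n) sums f w)"

lemma binomial_series_pochhammer:
  fixes u a :: complex
  assumes "norm u < 1"
  shows "(\<lambda>n. pochhammer a n / fact n * u ^ n) sums (1 - u) powr (-a)"
proof -
  have "(\<lambda>n. ((-a) gchoose n) * (-u) ^ n) sums (1 + -u) powr (-a)"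
    by (rule gen_binomial_complex) (use assms in simp)
  moreover have "((-a) gchoose n) * (-u) ^ n = pochhammer a n / fact n * u ^ n" for n
  proof -
    have "(-u) ^ n = (-1) ^ n * u ^ n" by (metis mult_minus1 power_mult_distrib)
    thus ?thesis by (simp add: gbinomial_pochhammer flip: power_mult_distrib mult.assoc)
  qed
  ultimately show ?thesis by simp
qed

lemma binomial_series_pochhammer_real:
  fixes x m :: real
  assumes "0 \<le> x" "x < 1"
  shows "(\<lambda>n. pochhammer m n / fact n * x ^ n) sums (1 - x) powr (-m)"
proof -
  have "(\<lambda>n. ((-m) gchoose n) * (-x) ^ n) sums (1 + -x) powr (-m)"
    by (rule gen_binomial_real) (use assms in simp)
  moreover have "((-m) gchoose n) * (-x) ^ n = pochhammer m n / fact n * x ^ n" for n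
  proof -
    have "(-x) ^ n = (-1) ^ n * x ^ n" by (metis mult_minus1 power_mult_distrib)
    thus ?thesis by (simp add: gbinomial_pochhammer flip: power_mult_distrib mult.assoc)
  qed
  ultimately show ?thesis by simp
qed

section \<open>Euler's integral on the slit plane\<close>

definition euler_integral :: "complex \<Rightarrow> complex \<Rightarrow> complex \<Rightarrow> complex \<Rightarrow> complex" where
  "euler_integral a b c u = integral {0<..<1}
     (\<lambda>t::real. of_real t powr (b - 1) * of_real (1 - t) powr (c - b - 1) * (1 - u * of_real t) powr (-a))"

lemma continuous_on_powr_nonpos:
  fixes f g :: "'a :: t2_space \<Rightarrow> complex"
  assumes "continuous_on A f" "continuous_on A g" "\<And>x. x \<in> A \<Longrightarrow> f x \<notin> \<real>\<^sub>\<le>\<^sub>0"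
  shows "continuous_on A (\<lambda>x. f x powr g x)"
proof -
  have "continuous_on A (\<lambda>x. exp (g x * Ln (f x)))"
    by (intro continuous_intros assms) (use assms in auto)
  thus ?thesis by (rule continuous_on_eq) (use assms(3) in \<open>force simp: powr_def\<close>)
qed

lemma continuous_on_euler_integrand:
  assumes "u \<in> slit_plane"
  shows "continuous_on {0<..<1} (\<lambda>t::real. of_real t powr (b - 1) * of_real (1 - t) powr (c - b - 1) * (1 - u * of_real t) powr (-a))"
proof -
  have "1 - u * of_real t \<notin> \<real>\<^sub>\<le>\<^sub>0" if "t \<in> {0<..<1}" for t :: real
    using one_minus_slit_plane[OF slit_plane_scale[OF assms, of t]] that by (simp add: mult.commute)
  hence "continuous_on {0<..<1} (\<lambda>t::real. (1 - u * of_real t) powr (-a))"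
    by (intro continuous_on_powr_nonpos continuous_intros) auto
  thus ?thesis by (rule continuous_on_mult[OF continuous_on_Beta_integrand])
qed

text \<open>Compactness: the slit plane is star-shaped about 0, so 1 - v t stays off the branch cut
  even for t = 0 and t = 1, and the last factor is bounded on a closed disc times the closed
  interval. All endpoint singularities are thus in the Beta weight.\<close>

lemma euler_integrand_bounded:
  assumes "u \<in> slit_plane"
  shows "\<exists>d M. d > 0 \<and> cball u d \<subseteq> slit_plane \<and>
    (\<forall>v\<in>cball u d. \<forall>t\<in>{0..1::real}. norm ((1 - v * of_real t) powr (-a)) \<le> M)"
proof -
  have nn: "1 - u * of_real t \<notin> \<real>\<^sub>\<le>\<^sub>0" if "u \<in> slit_plane" "t \<in> {0..1}" for u and t :: real
    using one_minus_slit_plane[OF slit_plane_scale[of u t]] that by (simp add: mult.commute)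
  obtain d where d: "d > 0" "cball u d \<subseteq> slit_plane"
    using open_contains_cball_eq[OF open_slit_plane] assms by blast
  have "continuous_on (cball u d \<times> {0..1::real}) (\<lambda>x. (1 - fst x * of_real (snd x)) powr (-a))"
    by (intro continuous_on_powr_nonpos continuous_intros) (use nn d in force)
  moreover have "compact (cball u d \<times> {0..1::real})" by (intro compact_Times) auto
  ultimately have "bounded ((\<lambda>x. (1 - fst x * of_real (snd x)) powr (-a)) ` (cball u d \<times> {0..1::real}))"
    by (intro compact_imp_bounded compact_continuous_image)
  then obtain M where "\<And>v t. v \<in> cball u d \<Longrightarrow> t \<in> {0..1} \<Longrightarrow> norm ((1 - v * of_real t) powr (-a)) \<le> M"
    unfolding bounded_iff by force
  with d show ?thesis by blast
qed

lemma integrable_euler_integrand: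
  assumes b: "Re b > 0" and c: "Re c > Re b" and u: "u \<in> slit_plane"
  shows "(\<lambda>t::real. of_real t powr (b - 1) * of_real (1 - t) powr (c - b - 1) * (1 - u * of_real t) powr (-a))
    integrable_on {0<..<1}"
proof -
  obtain d M where d: "d > 0"
    and M: "\<And>v t. v \<in> cball u d \<Longrightarrow> t \<in> {0..1} \<Longrightarrow> norm ((1 - v * of_real t) powr (-a)) \<le> M"
    using euler_integrand_bounded[OF u] by blast
  show ?thesis
  proof (rule integrable_Ioo_bounded_continuous[OF continuous_on_euler_integrand[OF u]])
    show "(\<lambda>t. t powr (Re b - 1) * (1 - t) powr (Re (c - b) - 1) * M) integrable_on {0<..<1}"
      by (intro integrable_on_mult_left has_integral_integrable[OF has_integral_Beta_real_Ioo]) (use b c in auto)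
    show "norm (of_real t powr (b - 1) * of_real (1 - t) powr (c - b - 1) * (1 - u * of_real t) powr (-a))
       \<le> t powr (Re b - 1) * (1 - t) powr (Re (c - b) - 1) * M" if "t \<in> {0<..<1}" for t :: real
      using that M[of u t] d by (auto simp: norm_mult norm_of_real_powr simp del: of_real_diff intro!: mult_left_mono)
  qed
qed

lemma holomorphic_euler_integral:
  assumes b: "Re b > 0" and c: "Re c > Re b"
  shows "euler_integral a b c holomorphic_on slit_plane"
proof -
  have nn: "1 - u * of_real t \<notin> \<real>\<^sub>\<le>\<^sub>0" if "u \<in> slit_plane" "t \<in> {0..1}" for u and t :: real
    using one_minus_slit_plane[OF slit_plane_scale[of u t]] that by (simp add: mult.commute)
  have "(\<lambda>u. integral {0<..<1} (\<lambda>t::real. of_real t powr (b - 1) * of_real (1 - t) powr (c - b - 1) * (1 - u * of_real t) powr (-a)))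
     holomorphic_on slit_plane"
  proof (rule holomorphic_integral_Ioo[OF open_slit_plane, where 
        f' = "\<lambda>u t. of_real t powr (b - 1) * of_real (1 - t) powr (c - b - 1) * (a * of_real t * (1 - u * of_real t) powr (-a - 1))"])
    fix u and t :: real assume ut: "u \<in> slit_plane" "t \<in> {0<..<1}"
    have "((\<lambda>u. (1 - u * of_real t) powr (-a)) has_field_derivative (a * of_real t * (1 - u * of_real t) powr (-a - 1))) (at u)"
      using nn[of u t] ut by (auto intro!: derivative_eq_intros simp: field_simps)
    thus "((\<lambda>u. of_real t powr (b - 1) * of_real (1 - t) powr (c - b - 1) * (1 - u * of_real t) powr (-a)) has_field_derivative
      of_real t powr (b - 1) * of_real (1 - t) powr (c - b - 1) * (a * of_real t * (1 - u * of_real t) powr (-a - 1))) (at u)"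
      by (rule DERIV_cmult)
  next
    show "continuous_on (slit_plane \<times> {0<..<1}) (\<lambda>(u, t). of_real t powr (b - 1) * of_real (1 - t) powr (c - b - 1) * (a * of_real t * (1 - u * of_real t) powr (-a - 1)))"
    proof -
      have 1: "continuous_on (slit_plane \<times> {0<..<1::real}) (\<lambda>x. (1 - fst x * of_real (snd x)) powr (-a - 1))"
        by (intro continuous_on_powr_nonpos continuous_intros) (use nn in force)
      have 2: "continuous_on (slit_plane \<times> {0<..<1::real}) (\<lambda>x. of_real (snd x) powr (b - 1) * of_real (1 - snd x) powr (c - b - 1))"
        by (intro continuous_intros) (auto simp: complex_nonpos_Reals_iff)
      have 3: "continuous_on (slit_plane \<times> {0<..<1::real}) (\<lambda>x. a * of_real (snd x))"
        by (intro continuous_intros)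
      show ?thesis unfolding case_prod_unfold by (rule continuous_on_mult[OF 2 continuous_on_mult[OF 3 1]])
    qed
  next
    fix u assume u: "u \<in> slit_plane"
    obtain d M where d: "d > 0" "cball u d \<subseteq> slit_plane"
      and M: "\<And>v t. v \<in> cball u d \<Longrightarrow> t \<in> {0..1} \<Longrightarrow> norm ((1 - v * of_real t) powr (-a)) \<le> M"
      using euler_integrand_bounded[OF u] by blast
    show "\<exists>d>0. \<exists>g. cball u d \<subseteq> slit_plane \<and> g integrable_on {0<..<1} \<and>
       (\<forall>v\<in>cball u d. \<forall>t\<in>{0<..<1}. norm (of_real t powr (b - 1) * of_real (1 - t) powr (c - b - 1) * (1 - v * of_real t) powr (-a)) \<le> g t)"
    proof (intro exI conjI ballI)
      show "d > 0" "cball u d \<subseteq> slit_plane" by fact+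
      show "(\<lambda>t. t powr (Re b - 1) * (1 - t) powr (Re (c - b) - 1) * M) integrable_on {0<..<1}"
        by (intro integrable_on_mult_left has_integral_integrable[OF has_integral_Beta_real_Ioo]) (use b c in auto)
      show "norm (of_real t powr (b - 1) * of_real (1 - t) powr (c - b - 1) * (1 - v * of_real t) powr (-a))
         \<le> t powr (Re b - 1) * (1 - t) powr (Re (c - b) - 1) * M" if "v \<in> cball u d" "t \<in> {0<..<1}" for v and t :: real
        using that M[of v t] by (auto simp: norm_mult norm_of_real_powr simp del: of_real_diff intro!: mult_left_mono)
    qed
  qed (use continuous_on_euler_integrand in auto)
  thus ?thesis unfolding euler_integral_def[abs_def] .
qed

text \<open>The binomial series of (1 - u t)^(-a) is integrated term by term. The exchange is
  justified by \<open>\<tau>\<close>, the tail of the absolutely convergent series at t = 1, which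
  bounds the remainder for all t in (0,1); each term is then a Beta integral.\<close>

lemma sums_euler_integral:
  assumes b: "Re b > 0" and c: "Re c > Re b" and u: "norm u < 1"
  shows "(\<lambda>n. hyp_coeff a b c n * u ^ n) sums (rGamma b * rGamma (c - b) * euler_integral a b c u)"
proof -
  let ?k = "\<lambda>t::real. of_real t powr (b - 1) * of_real (1 - t) powr (c - b - 1)"
  define p where "p = (\<lambda>n. pochhammer a n / fact n * u ^ n)"
  define \<tau> where "\<tau> = (\<lambda>N. (\<Sum>n. norm (p (n + N))))"
  have us: "u \<in> slit_plane" using u ball_subset_slit_plane by auto
  have abs: "summable (\<lambda>n. norm (p n))"
  proof -
    \<comment> \<open>Convergence at any radius strictly between |u| and 1 yields absolute
      convergence at u.\<close>
    define r where "r = (norm u + 1) / 2"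
    have r: "norm u < r" "r < 1" "r > 0" using u by (auto simp: r_def add_nonneg_pos)
    have "summable (\<lambda>n. pochhammer a n / fact n * complex_of_real r ^ n)"
      using binomial_series_pochhammer[of "of_real r" a] r by (auto dest: sums_summable)
    thus ?thesis unfolding p_def by (rule powser_insidea) (use r in simp)
  qed
  have \<tau>: "\<tau> \<longlonglongrightarrow> 0"
    unfolding \<tau>_def using suminf_exist_split2[OF abs] .
  have \<tau>_bound: "norm ((1 - u * of_real t) powr (-a) - (\<Sum>n<N. p n * of_real t ^ n)) \<le> \<tau> N"
    if t: "t \<in> {0<..<1}" for t :: real and N
  proof -
    have "norm (u * of_real t) \<le> norm u * 1" unfolding norm_mult by (intro mult_left_mono) (use t in auto)
    hence "norm (u * of_real t) < 1" using u by simp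
    from binomial_series_pochhammer[OF this, of a]
    have s: "(\<lambda>n. p n * of_real t ^ n) sums (1 - u * of_real t) powr (-a)"
      by (simp add: p_def power_mult_distrib mult.assoc)
    have le: "norm (p (n + N) * of_real t ^ (n + N)) \<le> norm (p (n + N))" for n
      using t by (auto simp: norm_mult norm_power intro!: mult_left_le power_le_one)
    have sN: "summable (\<lambda>n. norm (p (n + N)))" by (rule summable_ignore_initial_segment[OF abs])
    have "(1 - u * of_real t) powr (-a) - (\<Sum>n<N. p n * of_real t ^ n) = (\<Sum>n. p (n + N) * of_real t ^ (n + N))"
      using suminf_split_initial_segment[OF sums_summable[OF s], of N] sums_unique[OF s]
      by (simp add: algebra_simps)
    also have "norm \<dots> \<le> \<tau> N"
      unfolding \<tau>_def by (rule norm_suminf_le[OF le sN])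
    finally show ?thesis .
  qed
  have B: "((\<lambda>t. ?k t * (p n * of_real t ^ n)) has_integral p n * Beta (b + of_nat n) (c - b)) {0<..<1}" for n
  proof -
    have "((\<lambda>t::real. p n * (of_real t powr (b + of_nat n - 1) * of_real (1 - t) powr (c - b - 1))) has_integral p n * Beta (b + of_nat n) (c - b)) {0<..<1}"
      by (intro has_integral_mult_right has_integral_Beta_complex) (use b c in \<open>auto intro: add_pos_nonneg\<close>)
    thus ?thesis
    proof (rule has_integral_eq[rotated])
      fix t :: real assume t: "t \<in> {0<..<1}"
      have "b + of_nat n - 1 = b - 1 + of_nat n" by simp
      hence "complex_of_real t powr (b + of_nat n - 1) = of_real t powr (b - 1) * of_real t ^ n"
        using t powr_nat'[of "complex_of_real t" n] by (simp only: powr_add) simp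
      thus "p n * (complex_of_real t powr (b + of_nat n - 1) * of_real (1 - t) powr (c - b - 1)) = ?k t * (p n * of_real t ^ n)"
        by (simp add: mult_ac)
    qed
  qed
  have PB: "((\<lambda>t. ?k t * (\<Sum>n<N. p n * of_real t ^ n)) has_integral (\<Sum>n<N. p n * Beta (b + of_nat n) (c - b))) {0<..<1}" for N
    unfolding sum_distrib_left by (intro has_integral_sum B) auto
  let ?Br = "Beta (Re b) (Re (c - b))"
  have Br: "((\<lambda>t. t powr (Re b - 1) * (1 - t) powr (Re (c - b) - 1)) has_integral ?Br) {0<..<1}"
    by (rule has_integral_Beta_real_Ioo) (use b c in auto)
  have E: "((\<lambda>t. ?k t * (1 - u * of_real t) powr (-a)) has_integral euler_integral a b c u) {0<..<1}"
    unfolding euler_integral_def by (rule integrable_integral[OF integrable_euler_integrand[OF b c us]])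
  have bound: "norm (euler_integral a b c u - (\<Sum>n<N. p n * Beta (b + of_nat n) (c - b))) \<le> ?Br * \<tau> N" for N
  proof -
    have D: "((\<lambda>t. ?k t * ((1 - u * of_real t) powr (-a) - (\<Sum>n<N. p n * of_real t ^ n))) has_integral
       (euler_integral a b c u - (\<Sum>n<N. p n * Beta (b + of_nat n) (c - b)))) {0<..<1}"
      using has_integral_diff[OF E PB[of N]] by (simp add: right_diff_distrib)
    have BrN: "((\<lambda>t. t powr (Re b - 1) * (1 - t) powr (Re (c - b) - 1) * \<tau> N) has_integral ?Br * \<tau> N) {0<..<1}"
      by (rule has_integral_mult_left[OF Br])
    have "norm (integral {0<..<1} (\<lambda>t. ?k t * ((1 - u * of_real t) powr (-a) - (\<Sum>n<N. p n * of_real t ^ n))))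
        \<le> integral {0<..<1} (\<lambda>t. t powr (Re b - 1) * (1 - t) powr (Re (c - b) - 1) * \<tau> N)"
    proof (rule integral_norm_bound_integral[OF has_integral_integrable[OF D] has_integral_integrable[OF BrN]])
      fix t :: real assume "t \<in> {0<..<1}"
      thus "norm (?k t * ((1 - u * of_real t) powr (-a) - (\<Sum>n<N. p n * of_real t ^ n)))
          \<le> t powr (Re b - 1) * (1 - t) powr (Re (c - b) - 1) * \<tau> N"
        using \<tau>_bound[of t N] by (auto simp: norm_mult norm_of_real_powr simp del: of_real_diff intro!: mult_left_mono)
    qed
    thus ?thesis by (simp only: integral_unique[OF D] integral_unique[OF BrN])
  qed
  have "(\<lambda>N. ?Br * \<tau> N) \<longlonglongrightarrow> ?Br * 0" by (intro tendsto_intros \<tau>)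
  hence "(\<lambda>N. euler_integral a b c u - (\<Sum>n<N. p n * Beta (b + of_nat n) (c - b))) \<longlonglongrightarrow> 0"
    by (intro Lim_null_comparison[OF always_eventually[OF allI[OF bound]]]) simp
  from tendsto_diff[OF tendsto_const[of "euler_integral a b c u"] this]
  have "(\<lambda>n. p n * Beta (b + of_nat n) (c - b)) sums euler_integral a b c u"
    by (simp add: sums_def)
  hence "(\<lambda>n. rGamma b * rGamma (c - b) * (p n * Beta (b + of_nat n) (c - b))) sums (rGamma b * rGamma (c - b) * euler_integral a b c u)"
    by (rule sums_mult)
  moreover have "rGamma b * rGamma (c - b) * (p n * Beta (b + of_nat n) (c - b)) = hyp_coeff a b c n * u ^ n" for n
  proof -
    have "pochhammer b n = Gamma (b + of_nat n) / Gamma b"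
      using b by (intro pochhammer_Gamma Re_pos_not_nonpos_Int)
    moreover have "b + of_nat n + (c - b) = c + of_nat n" by simp
    moreover have "rGamma (c - b) * Gamma (c - b) = 1" "rGamma b = 1 / Gamma b"
      using Gamma_rGamma_Re_pos(2)[of "c - b"] c by (simp_all add: rGamma_inverse_Gamma inverse_eq_divide mult.commute)
    ultimately show ?thesis
      by (simp add: hyp_coeff_def p_def Beta_altdef add.commute[of _ c] flip: mult.assoc)
  qed
  ultimately show ?thesis by simp
qed

section \<open>Contiguous relations and existence of the continuation\<close>

lemma hyp_coeff_commute: "hyp_coeff a b c n = hyp_coeff b a c n"
  by (simp add: hyp_coeff_def mult_ac)

lemma diffs_hyp_coeff: "diffs (hyp_coeff a b c) n = a * b * hyp_coeff (a + 1) (b + 1) (c + 1) n"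
  by (simp add: diffs_def hyp_coeff_def pochhammer_rec field_simps fact_Suc del: of_nat_Suc)
     (simp add: algebra_simps)

lemma sums_shift_power:
  fixes w :: "'a :: real_normed_field"
  assumes "(\<lambda>n. f n * w ^ n) sums s"
  shows "(\<lambda>n. (case n of 0 \<Rightarrow> 0 | Suc m \<Rightarrow> f m) * w ^ n) sums (w * s)"
proof -
  have "(\<lambda>n. f n * w ^ Suc n) sums (w * s)"
    using sums_mult[OF assms, of w] by (simp add: mult_ac)
  thus ?thesis
    using sums_Suc[of "\<lambda>n. (case n of 0 \<Rightarrow> 0 | Suc m \<Rightarrow> f m) * w ^ n" "w * s"] by simp
qed

text \<open>The operator c + u d/du multiplies the n-th coefficient by c + n, and (c + n) rGamma(c +
  n + 1) = rGamma(c + n).\<close>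

lemma hyp_continuation_lower_c:
  assumes "hyp_continuation a b (c + 1) f"
  shows "hyp_continuation a b c (\<lambda>u. c * f u + u * deriv f u)"
  unfolding hyp_continuation_def
proof (intro conjI ballI)
  have hol: "f holomorphic_on slit_plane" using assms by (simp add: hyp_continuation_def)
  thus "(\<lambda>u. c * f u + u * deriv f u) holomorphic_on slit_plane"
    by (intro holomorphic_intros open_slit_plane)
  fix w :: complex assume w: "w \<in> ball 0 1"
  have s: "(\<lambda>n. hyp_coeff a b (c + 1) n * z ^ n) sums f z" if "norm z < 1" for z
    using assms that by (simp add: hyp_continuation_def)
  have "(\<lambda>n. diffs (hyp_coeff a b (c + 1)) n * w ^ n) sums deriv f w"
    by (rule termdiffs_sums_strong[OF s])
       (use w hol ball_subset_slit_plane in \<open>auto intro!: holomorphic_derivI open_slit_plane\<close>)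
  from sums_add[OF sums_mult[OF s[of w], of c] sums_shift_power[OF this]] w
  have "(\<lambda>n. c * (hyp_coeff a b (c + 1) n * w ^ n) + (case n of 0 \<Rightarrow> 0 | Suc m \<Rightarrow> diffs (hyp_coeff a b (c + 1)) m) * w ^ n)
      sums (c * f w + w * deriv f w)" by simp
  moreover have "c * (hyp_coeff a b (c + 1) n * w ^ n) + (case n of 0 \<Rightarrow> 0 | Suc m \<Rightarrow> diffs (hyp_coeff a b (c + 1)) m) * w ^ n
      = hyp_coeff a b c n * w ^ n" for n
  proof -
    have "(case n of 0 \<Rightarrow> 0 | Suc m \<Rightarrow> diffs (hyp_coeff a b (c + 1)) m) = of_nat n * hyp_coeff a b (c + 1) n"
      by (cases n) (auto simp: diffs_def)
    moreover have "hyp_coeff a b c n = (c + of_nat n) * hyp_coeff a b (c + 1) n"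
      using rGamma_plus1[of "c + of_nat n"] by (simp add: hyp_coeff_def field_simps)
    ultimately show ?thesis by (simp add: algebra_simps)
  qed
  ultimately show "(\<lambda>n. hyp_coeff a b c n * w ^ n) sums (c * f w + w * deriv f w)" by simp
qed

text \<open>Rests on (b)_n = (b+1)_n - n (b+1)_(n-1). Both functions on the right have second
  parameter b + 1, so an induction on b can use this relation although it also moves a and
  c.\<close>

lemma hyp_continuation_lower_b:
  assumes f: "hyp_continuation a (b + 1) c f" and g: "hyp_continuation (a + 1) (b + 1) (c + 1) g"
  shows "hyp_continuation a b c (\<lambda>u. f u - a * (u * g u))"
  unfolding hyp_continuation_def
proof (intro conjI ballI)
  show "(\<lambda>u. f u - a * (u * g u)) holomorphic_on slit_plane"
    using f g by (auto simp: hyp_continuation_def intro!: holomorphic_intros)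
  fix w :: complex assume w: "w \<in> ball 0 1"
  have "(\<lambda>n. hyp_coeff a (b + 1) c n * w ^ n) sums f w" "(\<lambda>n. hyp_coeff (a + 1) (b + 1) (c + 1) n * w ^ n) sums g w"
    using f g w by (auto simp: hyp_continuation_def)
  from sums_diff[OF this(1) sums_mult[OF sums_shift_power[OF this(2)], of a]]
  show "(\<lambda>n. hyp_coeff a b c n * w ^ n) sums (f w - a * (w * g w))"
  proof (rule sums_cong[THEN iffD1, rotated])
    fix n
    show "hyp_coeff a (b + 1) c n * w ^ n - a * ((case n of 0 \<Rightarrow> 0 | Suc m \<Rightarrow> hyp_coeff (a + 1) (b + 1) (c + 1) m) * w ^ n)
       = hyp_coeff a b c n * w ^ n"
    proof (cases n)
      case 0 thus ?thesis by (simp add: hyp_coeff_def)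
    next
      case (Suc m)
      define g pa pb where "g = rGamma (c + 1 + of_nat m)"
        and "pa = pochhammer (a + 1) m" and "pb = pochhammer (b + 1) m"
      have 1: "hyp_coeff a (b + 1) c n = a * pa * (pb * (b + 1 + of_nat m)) * g / fact (Suc m)"
      proof -
        have "pochhammer (b + 1) (Suc m) = pb * (b + 1 + of_nat m)" by (simp add: pochhammer_Suc pb_def)
        thus ?thesis unfolding Suc hyp_coeff_def by (simp add: pochhammer_rec[of a m] g_def pa_def add_ac)
      qed
      have 2: "hyp_coeff a b c n = a * pa * (b * pb) * g / fact (Suc m)"
        by (simp add: Suc hyp_coeff_def pochhammer_rec[of a m] pochhammer_rec[of b m] g_def pa_def pb_def add_ac)
      have 3: "hyp_coeff (a + 1) (b + 1) (c + 1) m = of_nat (Suc m) * (pa * pb * g) / fact (Suc m)"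
        by (simp add: hyp_coeff_def g_def pa_def pb_def del: of_nat_Suc)
      have "a * pa * (pb * (b + 1 + of_nat m)) * g - a * (of_nat (Suc m) * (pa * pb * g)) = a * pa * (b * pb) * g"
        by (simp add: algebra_simps)
      hence "hyp_coeff a (b + 1) c n - a * hyp_coeff (a + 1) (b + 1) (c + 1) m = hyp_coeff a b c n"
        unfolding 1 2 3 by (simp only: times_divide_eq_right diff_divide_distrib[symmetric])
      from arg_cong[OF this, of "\<lambda>x. x * w ^ n"] show ?thesis
        by (simp add: Suc left_diff_distrib mult.assoc)
    qed
  qed
qed

text \<open>The order of the reductions matters: c is lowered first, at fixed b with Re b > 0, so
  that the induction on b may call on arbitrary a and c. No parameter is exceptional because
  \<open>rGamma\<close> is entire.\<close>

lemma hyp_continuation_exists: "\<exists>f. hyp_continuation a b c f"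
proof -
  have base: "\<exists>f. hyp_continuation a b c f" if "Re b > 0" "Re c > Re b" for a b c
    using holomorphic_euler_integral[OF that, of a] sums_euler_integral[OF that, of _ a]
    by (intro exI[of _ "\<lambda>u. rGamma b * rGamma (c - b) * euler_integral a b c u"])
       (auto simp: hyp_continuation_def intro!: holomorphic_intros)
  have stepc: "\<exists>f. hyp_continuation a b c f" if "Re b > 0" "Re (c + of_nat n) > Re b" for a b c n
    using that(2)
  proof (induction n arbitrary: c)
    case 0 thus ?case using base that(1) by simp
  next
    case (Suc n)
    have "\<exists>f. hyp_continuation a b (c + 1) f" by (rule Suc.IH) (use Suc.prems in simp)
    thus ?case using hyp_continuation_lower_c by blast
  qed
  have allc: "\<exists>f. hyp_continuation a b c f" if "Re b > 0" for a b c
  proof -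
    obtain n :: nat where "real n > Re b - Re c" using reals_Archimedean2 by blast
    thus ?thesis using stepc[OF that, of c n] by simp
  qed
  have stepb: "\<exists>f. hyp_continuation a b c f" if "Re (b + of_nat n) > 0" for a b c n
    using that
  proof (induction n arbitrary: a b c)
    case 0 thus ?case using allc by simp
  next
    case (Suc n)
    have "\<exists>f. hyp_continuation a (b + 1) c f" "\<exists>f. hyp_continuation (a + 1) (b + 1) (c + 1) f"
      by (rule Suc.IH; use Suc.prems in simp)+
    thus ?case using hyp_continuation_lower_b by blast
  qed
  obtain n :: nat where "real n > - Re b" using reals_Archimedean2 by blast
  thus ?thesis using stepb[of b n] by simp
qed

lemma hypergeo_reg_continuation: "hyp_continuation a b c (hypergeo_reg a b c)"
proof -
  have "hyp_continuation a b c = (\<lambda>f. f holomorphic_on - (complex_of_real ` {1..}) \<and>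
     (\<forall>w\<in>ball 0 1. (\<lambda>n. pochhammer a n * pochhammer b n * rGamma (c + of_nat n) / fact n * w ^ n) sums f w))"
    by (simp add: hyp_continuation_def[abs_def] slit_plane_def hyp_coeff_def)
  thus ?thesis using someI_ex[OF hyp_continuation_exists[of a b c]] by (simp add: hypergeo_reg_def)
qed

lemma holomorphic_hypergeo_reg: "hypergeo_reg a b c holomorphic_on slit_plane"
  and sums_hypergeo_reg: "norm w < 1 \<Longrightarrow> (\<lambda>n. hyp_coeff a b c n * w ^ n) sums hypergeo_reg a b c w"
  using hypergeo_reg_continuation[of a b c] by (auto simp: hyp_continuation_def)

lemma hypergeo_reg_at_0: "hypergeo_reg a b c 0 = rGamma c"
proof -
  have "(\<lambda>n. hyp_coeff a b c n * 0 ^ n) sums hyp_coeff a b c 0"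
    using powser_sums_zero[of "hyp_coeff a b c"] by simp
  thus ?thesis using sums_unique2[OF sums_hypergeo_reg[of 0 a b c]] by (auto simp: hyp_coeff_def)
qed

lemma slit_plane_identity:
  assumes "f holomorphic_on slit_plane" "g holomorphic_on slit_plane"
    and "\<And>w. norm w < 1 \<Longrightarrow> f w = g w" and "u \<in> slit_plane"
  shows "f u = g u"
  by (rule analytic_continuation_open[of "ball 0 1" slit_plane])
     (use assms open_slit_plane connected_slit_plane ball_subset_slit_plane in auto)

lemma hypergeo_reg_unique:
  assumes "hyp_continuation a b c f" "u \<in> slit_plane"
  shows "hypergeo_reg a b c u = f u"
  by (rule slit_plane_identity[of "hypergeo_reg a b c" f u])
     (use assms holomorphic_hypergeo_reg sums_unique2[OF sums_hypergeo_reg]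
      in \<open>auto simp: hyp_continuation_def\<close>)

lemma hypergeo_reg_commute: "u \<in> slit_plane \<Longrightarrow> hypergeo_reg a b c u = hypergeo_reg b a c u"
  by (rule hypergeo_reg_unique) 
     (use hypergeo_reg_continuation[of b a c] in \<open>simp_all add: hyp_continuation_def hyp_coeff_commute[of a b]\<close>)

lemma hypergeo_reg_euler:
  assumes "Re b > 0" "Re c > Re b" "u \<in> slit_plane"
  shows "hypergeo_reg a b c u = rGamma b * rGamma (c - b) * euler_integral a b c u"
  by (rule hypergeo_reg_unique)
     (use assms holomorphic_euler_integral[OF assms(1,2), of a] sums_euler_integral[OF assms(1,2), of _ a]
      in \<open>auto simp: hyp_continuation_def intro!: holomorphic_intros\<close>)

section \<open>Derivative and differential equation\<close>

lemma has_field_derivative_hypergeo_reg: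
  assumes "u \<in> slit_plane"
  shows "(hypergeo_reg a b c has_field_derivative a * b * hypergeo_reg (a + 1) (b + 1) (c + 1) u) (at u)"
proof -
  have "deriv (hypergeo_reg a b c) u = a * b * hypergeo_reg (a + 1) (b + 1) (c + 1) u"
  proof (rule slit_plane_identity[OF _ _ _ assms])
    fix w :: complex assume w: "norm w < 1"
    have "(\<lambda>n. diffs (hyp_coeff a b c) n * w ^ n) sums deriv (hypergeo_reg a b c) w"
      by (rule termdiffs_sums_strong[OF sums_hypergeo_reg])
         (use w ball_subset_slit_plane in \<open>auto intro!: holomorphic_derivI[OF holomorphic_hypergeo_reg] open_slit_plane\<close>)
    moreover have "(\<lambda>n. diffs (hyp_coeff a b c) n * w ^ n) sums (a * b * hypergeo_reg (a + 1) (b + 1) (c + 1) w)"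
      using sums_mult[OF sums_hypergeo_reg[OF w, of "a + 1" "b + 1" "c + 1"], of "a * b"]
      by (simp add: diffs_hyp_coeff mult.assoc)
    ultimately show "deriv (hypergeo_reg a b c) w = a * b * hypergeo_reg (a + 1) (b + 1) (c + 1) w"
      by (rule sums_unique2)
  qed (auto intro!: holomorphic_intros holomorphic_hypergeo_reg open_slit_plane)
  thus ?thesis using holomorphic_derivI[OF holomorphic_hypergeo_reg open_slit_plane assms, of a b c] by simp
qed

text \<open>The hypergeometric equation with the common factor a b of F, F' and F'' divided out, so
  that it retains its content when a b = 0. It is a coefficient identity in the unit disc, carried
  to the slit plane by the identity theorem.\<close>

lemma hypergeo_reg_ode:
  assumes "u \<in> slit_plane"
  shows "u * (1 - u) * ((a + 1) * (b + 1) * hypergeo_reg (a + 2) (b + 2) (c + 2) u)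
      + (c - (a + b + 1) * u) * hypergeo_reg (a + 1) (b + 1) (c + 1) u = hypergeo_reg a b c u"
proof (rule slit_plane_identity[OF _ _ _ assms])
  fix w :: complex assume w: "norm w < 1"
  let ?d = "hyp_coeff (a + 1) (b + 1) (c + 1)"
  let ?e = "\<lambda>n. (a + 1) * (b + 1) * hyp_coeff (a + 2) (b + 2) (c + 2) n"
  let ?sh = "\<lambda>f n. (case n of 0 \<Rightarrow> 0 | Suc m \<Rightarrow> f m)"
  have e: "(\<lambda>n. ?e n * w ^ n) sums ((a + 1) * (b + 1) * hypergeo_reg (a + 2) (b + 2) (c + 2) w)" (is "_ sums ?E")
    using sums_mult[OF sums_hypergeo_reg[OF w], of "(a + 1) * (b + 1)"] by (simp add: mult.assoc)
  have d: "(\<lambda>n. ?d n * w ^ n) sums hypergeo_reg (a + 1) (b + 1) (c + 1) w" (is "_ sums ?D")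
    by (rule sums_hypergeo_reg[OF w])
  have "(\<lambda>n. ?sh ?e n * w ^ n - ?sh (?sh ?e) n * w ^ n + (c * (?d n * w ^ n) - (a + b + 1) * (?sh ?d n * w ^ n)))
     sums (w * ?E - w * (w * ?E) + (c * ?D - (a + b + 1) * (w * ?D)))"
    by (intro sums_add sums_diff sums_mult sums_shift_power e d)
  moreover have "?sh ?e n * w ^ n - ?sh (?sh ?e) n * w ^ n + (c * (?d n * w ^ n) - (a + b + 1) * (?sh ?d n * w ^ n))
      = hyp_coeff a b c n * w ^ n" for n
  proof -
    have e_d: "?e n = of_nat (Suc n) * ?d (Suc n)" for n
      using diffs_hyp_coeff[of "a + 1" "b + 1" "c + 1" n] by (simp add: diffs_def add.assoc)
    have s1: "?sh ?e n = of_nat n * ?d n" by (cases n) (simp_all add: e_d del: of_nat_Suc)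
    have s2: "?sh (?sh ?e) n = ?sh (\<lambda>m. of_nat m * ?d m) n"
      by (cases n) (auto simp: e_d split: nat.splits)
    have A: "hyp_coeff a b c n = (c + of_nat n) * ?d n - ?sh (\<lambda>m. (of_nat m + a + b + 1) * ?d m) n"
    proof (cases n)
      case 0
      show ?thesis using rGamma_plus1[of c] by (simp add: 0 hyp_coeff_def)
    next
      case (Suc m)
      define g where "g = rGamma (c + 2 + of_nat m)"
      define pa pb where "pa = pochhammer (a + 1) m" and "pb = pochhammer (b + 1) m"
      have g: "rGamma (c + 1 + of_nat m) = (c + 1 + of_nat m) * g"
        using rGamma_plus1[of "c + 1 + of_nat m"] by (simp add: g_def add_ac)
      have 1: "hyp_coeff a b c n = a * pa * (b * pb) * ((c + 1 + of_nat m) * g) / fact (Suc m)"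
        using g by (simp add: hyp_coeff_def Suc pochhammer_rec pa_def pb_def add_ac)
      have 2: "?d n = pa * (a + 1 + of_nat m) * (pb * (b + 1 + of_nat m)) * g / fact (Suc m)"
        by (simp add: hyp_coeff_def Suc pochhammer_Suc pa_def pb_def g_def add_ac)
      have 3: "?d m = of_nat (Suc m) * (pa * pb * ((c + 1 + of_nat m) * g)) / fact (Suc m)"
        using g by (simp add: hyp_coeff_def pa_def pb_def del: of_nat_Suc)
      have "a * pa * (b * pb) * ((c + 1 + of_nat m) * g) = (c + of_nat (Suc m)) * (pa * (a + 1 + of_nat m) * (pb * (b + 1 + of_nat m)) * g)
          - (of_nat m + a + b + 1) * (of_nat (Suc m) * (pa * pb * ((c + 1 + of_nat m) * g)))"
        by (simp add: algebra_simps)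
      thus ?thesis unfolding 1 2 unfolding Suc by (simp add: 3 diff_divide_distrib del: of_nat_Suc)
    qed
    show ?thesis unfolding A s1 s2 by (cases n) (auto simp: algebra_simps)
  qed
  ultimately have "(\<lambda>n. hyp_coeff a b c n * w ^ n) sums (w * ?E - w * (w * ?E) + (c * ?D - (a + b + 1) * (w * ?D)))"
    by simp
  from sums_unique2[OF this sums_hypergeo_reg[OF w]]
  show "w * (1 - w) * ?E + (c - (a + b + 1) * w) * ?D = hypergeo_reg a b c w"
    by (simp add: algebra_simps)
qed (auto intro!: holomorphic_intros holomorphic_hypergeo_reg)

section \<open>Uniform expansion of Euler's integral\<close>

text \<open>In the product approximating 1/Gamma each factor satisfies |z + k| \<ge> Re z + k, while
  the remaining factor n^z has a modulus that depends on Re z only.\<close>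

lemma norm_rGamma_ge:
  assumes "Re z > 0"
  shows "rGamma (Re z) \<le> norm (rGamma z)"
proof (rule LIMSEQ_le)
  show "rGamma_series (Re z) \<longlonglongrightarrow> rGamma (Re z)" by (rule rGamma_series_LIMSEQ)
  show "(\<lambda>n. norm (rGamma_series z n)) \<longlonglongrightarrow> norm (rGamma z)" by (intro tendsto_intros)
  have "pochhammer (Re z) (n + 1) \<le> norm (pochhammer z (n + 1))" for n
    unfolding pochhammer_prod prod_norm[symmetric]
    by (intro prod_mono conjI) (use assms in \<open>auto intro: order_trans[OF _ complex_Re_le_cmod]\<close>)
  thus "\<exists>N. \<forall>n\<ge>N. rGamma_series (Re z) n \<le> norm (rGamma_series z n)"
    by (auto simp: rGamma_series_def norm_divide norm_mult intro!: divide_right_mono)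
qed

text \<open>Conversely |z + k| \<le> (Re z + k) (1 + y^2/(k+1)^2) with y = Im z, because Re z + k
  \<ge> k + 1. Bounding 1 + s by exp(s) turns the product into a sum, and the sum of 1/(k+1)^2 gives
  pi^2/6. With the previous lemma, |Gamma z| and Gamma(Re z) are comparable as long as Im z is
  bounded.\<close>

lemma norm_rGamma_le:
  assumes "Re z \<ge> 1"
  shows "norm (rGamma z) \<le> exp ((Im z)\<^sup>2 * (pi\<^sup>2 / 6)) * rGamma (Re z)"
proof (rule LIMSEQ_le)
  let ?E = "exp ((Im z)\<^sup>2 * (pi\<^sup>2 / 6))"
  show "(\<lambda>n. ?E * rGamma_series (Re z) n) \<longlonglongrightarrow> ?E * rGamma (Re z)"
    by (intro tendsto_intros)
  show "(\<lambda>n. norm (rGamma_series z n)) \<longlonglongrightarrow> norm (rGamma z)" by (intro tendsto_intros)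
  have "norm (pochhammer z (n + 1)) \<le> ?E * pochhammer (Re z) (n + 1)" for n
  proof -
    have fac: "norm (z + of_nat k) \<le> exp ((Im z)\<^sup>2 * (1 / (real k + 1)\<^sup>2)) * (Re z + real k)" for k
    proof -
      define x where "x = Re z + real k"
      have x: "x \<ge> real k + 1" using assms by (simp add: x_def)
      have "norm (z + of_nat k) = sqrt (x\<^sup>2 + (Im z)\<^sup>2)" by (simp add: cmod_def x_def)
      also have "\<dots> \<le> x * (1 + (Im z)\<^sup>2 * (1 / (real k + 1)\<^sup>2))"
      proof (rule real_le_lsqrt)
        have "x\<^sup>2 * (1 / (real k + 1)\<^sup>2) \<ge> 1" using x by (simp add: power_mono field_simps)
        hence 1: "(Im z)\<^sup>2 * 1 \<le> (Im z)\<^sup>2 * (x\<^sup>2 * (1 / (real k + 1)\<^sup>2))" by (intro mult_left_mono) auto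
        define s where "s = (Im z)\<^sup>2 * (1 / (real k + 1)\<^sup>2)"
        have s: "s \<ge> 0" by (simp add: s_def)
        have "x\<^sup>2 + (Im z)\<^sup>2 \<le> x\<^sup>2 * (1 + s)" using 1 by (simp add: s_def algebra_simps)
        also have "\<dots> \<le> x\<^sup>2 * (1 + s)\<^sup>2" using s by (intro mult_left_mono) (auto simp: power2_eq_square algebra_simps)
        finally show "x\<^sup>2 + (Im z)\<^sup>2 \<le> (x * (1 + (Im z)\<^sup>2 * (1 / (real k + 1)\<^sup>2)))\<^sup>2"
          by (simp add: s_def power_mult_distrib)
      qed (use x in auto)
      also have "\<dots> \<le> x * exp ((Im z)\<^sup>2 * (1 / (real k + 1)\<^sup>2))"
        using x by (intro mult_left_mono exp_ge_add_one_self) auto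
      finally show ?thesis by (simp add: x_def mult.commute)
    qed
    have "norm (pochhammer z (n + 1)) = (\<Prod>k = 0..<n + 1. norm (z + of_nat k))"
      by (simp add: pochhammer_prod prod_norm)
    also have "\<dots> \<le> (\<Prod>k = 0..<n + 1. exp ((Im z)\<^sup>2 * (1 / (real k + 1)\<^sup>2)) * (Re z + real k))"
      by (intro prod_mono conjI fac) auto
    also have "\<dots> = exp ((Im z)\<^sup>2 * (\<Sum>k = 0..<n + 1. 1 / (real k + 1)\<^sup>2)) * pochhammer (Re z) (n + 1)"
      unfolding prod.distrib sum_distrib_left by (simp only: exp_sum finite_atLeastLessThan pochhammer_prod)
    also have "\<dots> \<le> ?E * pochhammer (Re z) (n + 1)"
    proof (intro mult_right_mono)
      have "(\<Sum>k = 0..<n + 1. 1 / (real k + 1)\<^sup>2) \<le> pi\<^sup>2 / 6"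
        using sum_le_suminf[OF sums_summable[OF inverse_squares_sums], of "{0..<n + 1}"]
          sums_unique[OF inverse_squares_sums] by (simp add: add.commute)
      thus "exp ((Im z)\<^sup>2 * (\<Sum>k = 0..<n + 1. 1 / (real k + 1)\<^sup>2)) \<le> ?E"
        unfolding exp_le_cancel_iff by (rule mult_left_mono) simp
      show "0 \<le> pochhammer (Re z) (n + 1)"
        using assms by (intro pochhammer_nonneg) auto
    qed
    finally show ?thesis .
  qed
  thus "\<exists>N. \<forall>n\<ge>N. norm (rGamma_series z n) \<le> ?E * rGamma_series (Re z) n"
    by (auto simp: rGamma_series_def norm_divide norm_mult intro!: divide_right_mono)
qed

lemma norm_Gamma_le: 
  assumes "Re z > 0"
  shows "norm (Gamma z) \<le> Gamma (Re z)"
proof -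
  have "rGamma (Re z) > 0" using Gamma_real_pos[OF assms] by (simp add: rGamma_inverse_Gamma)
  thus ?thesis using norm_rGamma_ge[OF assms] 
    by (simp add: Gamma_def norm_inverse le_imp_inverse_le)
qed

lemma Gamma_Re_le: 
  assumes "Re z \<ge> 1"
  shows "Gamma (Re z) \<le> exp ((Im z)\<^sup>2 * (pi\<^sup>2 / 6)) * norm (Gamma z)"
proof -
  have 1: "rGamma (Re z) > 0" using Gamma_real_pos[of "Re z"] assms by (simp add: rGamma_inverse_Gamma)
  have "0 < norm (rGamma z)" using norm_rGamma_ge[of z] 1 assms by linarith
  define E where "E = exp ((Im z)\<^sup>2 * (pi\<^sup>2 / 6))"
  have "E > 0" by (simp add: E_def)
  have "inverse (E * rGamma (Re z)) \<le> inverse (norm (rGamma z))"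
    using norm_rGamma_le[OF assms] \<open>0 < norm (rGamma z)\<close> unfolding E_def by (intro le_imp_inverse_le)
  hence "E * inverse (E * rGamma (Re z)) \<le> E * inverse (norm (rGamma z))"
    using \<open>E > 0\<close> by (intro mult_left_mono) auto
  moreover have "E * inverse (E * rGamma (Re z)) = inverse (rGamma (Re z))" using \<open>E > 0\<close> by simp
  ultimately show ?thesis by (simp only: Gamma_def norm_inverse E_def)
qed

section \<open>Coefficients and the binomial remainder\<close>

text \<open>Each factor 4 (\<nu> + 1/2)^2 - (2k - 1)^2 splits as 4 (\<nu> + k) (\<nu> + 1 - k). This
  recognises \<open>a_coeff\<close> in what the binomial expansion of Euler's integral
  produces.\<close>

lemma a_coeff_eq: "a_coeff n (\<nu> + 1/2) * 2 ^ n = pochhammer (\<nu> + 1) n * (\<nu> gchoose n)"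
proof -
  have "(\<Prod>k=1..n. 4 * (\<nu> + 1/2)\<^sup>2 - (2 * of_nat k - 1)\<^sup>2) = 4 ^ n * fact n * (pochhammer (\<nu> + 1) n * (\<nu> gchoose n))"
  proof (induction n)
    case (Suc n)
    have "fact (Suc n) * (\<nu> gchoose Suc n) = fact n * (\<nu> gchoose n) * (\<nu> - of_nat n)"
      using gbinomial_mult_1[of \<nu> n] by (simp add: algebra_simps)
    moreover have "(\<Prod>k=1..Suc n. 4 * (\<nu> + 1/2)\<^sup>2 - (2 * of_nat k - 1)\<^sup>2)
       = 4 ^ n * fact n * (pochhammer (\<nu> + 1) n * (\<nu> gchoose n)) * (4 * (\<nu> - of_nat n) * (\<nu> + 1 + of_nat n))"
      using Suc.IH by (simp add: power2_eq_square algebra_simps)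
    ultimately show ?case by (simp add: pochhammer_Suc del: fact_Suc of_nat_Suc)
  qed simp
  moreover have "(8::complex) ^ n = 4 ^ n * 2 ^ n" by (simp flip: power_mult_distrib)
  ultimately show ?thesis by (simp add: a_coeff_def)
qed

text \<open>The bounds are the Taylor coefficients of (1 - x)^(-B), a majorant series whose sum is
  known.\<close>

lemma norm_gbinomial_le:
  fixes \<nu> :: complex
  assumes "norm \<nu> \<le> B"
  shows "norm (\<nu> gchoose n) \<le> pochhammer B n / fact n"
proof -
  have "norm (\<nu> gchoose n) = (\<Prod>k = 0..<n. norm (\<nu> - of_nat k)) / fact n"
    by (simp add: gbinomial_prod_rev norm_divide prod_norm)
  also have "\<dots> \<le> (\<Prod>k = 0..<n. B + of_nat k) / fact n"
    by (intro divide_right_mono prod_mono conjI) (use assms in \<open>auto intro!: norm_triangle_le_diff\<close>)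
  finally show ?thesis by (simp add: pochhammer_prod)
qed

text \<open>For |x| \<le> 1/2 the tail is controlled by the majorant series at 1/2, whose sum is
  2^B. For |x| > 1/2 the factor (2|x|)^N is at least 1, so the power and the Taylor polynomial can
  be bounded separately. The right-hand side sees only |x|, as uniformity in the direction of x
  demands. On |x| = 1 the term \<open>0 powr (-1/2)\<close> would be 0 and the singularity at x = -1
  would go uncounted.\<close>

lemma binomial_remainder_bound:
  fixes \<nu> x :: complex and B :: nat
  assumes \<nu>: "norm \<nu> \<le> real B" "Re \<nu> \<ge> -1/2" and x: "norm x \<noteq> 1" 
  shows "norm ((1 + x) powr \<nu> - (\<Sum>n<N. (\<nu> gchoose n) * x ^ n))
    \<le> 2 ^ N * (2 * 2 powr B + exp (pi * B)) * norm x ^ N * ((1 + norm x) ^ B + \<bar>1 - norm x\<bar> powr (-1/2))"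
proof -
  define c where "c = (\<lambda>n. pochhammer (real B) n / fact n)"
  have c0: "c n \<ge> 0" for n by (auto simp: c_def pochhammer_prod intro!: divide_nonneg_nonneg prod_nonneg)
  have cs: "(\<lambda>n. c n * (1/2) ^ n) sums 2 powr B"
    using binomial_series_pochhammer_real[of "1/2" "real B"] by (simp add: c_def powr_minus_divide powr_divide)
  have gc: "norm (\<nu> gchoose n) \<le> c n" for n unfolding c_def by (rule norm_gbinomial_le[OF \<nu>(1)])
  define D where "D = (1 + norm x) ^ B + \<bar>1 - norm x\<bar> powr (-1/2)"
  have D: "D \<ge> 1" unfolding D_def using one_le_power[of "1 + norm x" B] by (simp add: add_increasing2)
  have main: "norm ((1 + x) powr \<nu> - (\<Sum>n<N. (\<nu> gchoose n) * x ^ n)) \<le> (2 * norm x) ^ N * (2 * 2 powr B + exp (pi * B)) * D"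
  proof (cases "norm x \<le> 1/2")
    case True
    have s: "(\<lambda>n. (\<nu> gchoose n) * x ^ n) sums (1 + x) powr \<nu>" by (rule gen_binomial_complex) (use True in simp)
    have le: "norm ((\<nu> gchoose (n + N)) * x ^ (n + N)) \<le> (2 * norm x) ^ N * (c (n + N) * (1/2) ^ (n + N))" for n
    proof -
      have "norm ((\<nu> gchoose (n + N)) * x ^ (n + N)) \<le> c (n + N) * (norm x ^ n * norm x ^ N)"
        unfolding norm_mult norm_power power_add by (intro mult_right_mono gc) auto
      also have "\<dots> \<le> c (n + N) * ((1/2) ^ n * norm x ^ N)"
        by (intro mult_left_mono mult_right_mono power_mono True c0) auto
      also have "\<dots> = (2 * norm x) ^ N * (c (n + N) * (1/2) ^ (n + N))"
        by (simp add: power_add power_mult_distrib power_divide)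
      finally show ?thesis .
    qed
    have sm: "summable (\<lambda>n. c (n + N) * (1/2) ^ (n + N))"
      by (rule summable_ignore_initial_segment[OF sums_summable[OF cs]])
    have "norm ((1 + x) powr \<nu> - (\<Sum>n<N. (\<nu> gchoose n) * x ^ n)) = norm (\<Sum>n. (\<nu> gchoose (n + N)) * x ^ (n + N))"
      using suminf_split_initial_segment[OF sums_summable[OF s], of N] sums_unique[OF s] by (simp add: algebra_simps)
    also have "\<dots> \<le> (\<Sum>n. (2 * norm x) ^ N * (c (n + N) * (1/2) ^ (n + N)))"
      by (rule norm_suminf_le[OF le summable_mult[OF sm]])
    also have "\<dots> = (2 * norm x) ^ N * (\<Sum>n. c (n + N) * (1/2) ^ (n + N))" by (rule suminf_mult[OF sm])
    also have "(\<Sum>n. c (n + N) * (1/2) ^ (n + N)) \<le> 2 powr B"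
      using suminf_split_initial_segment[OF sums_summable[OF cs], of N] sums_unique[OF cs]
        sum_nonneg[of "{..<N}" "\<lambda>n. c n * (1/2) ^ n"] c0 by simp
    also have "2 powr B \<le> (2 * 2 powr B + exp (pi * B)) * D"
    proof -
      have "2 powr B * 1 \<le> (2 * 2 powr B + exp (pi * B)) * D" using D by (intro mult_mono) auto
      thus ?thesis by simp
    qed
    finally show ?thesis by (simp add: mult_left_mono mult.assoc)
  next
    case False
    hence x1: "1 \<le> (2 * norm x) ^ k" for k by (intro one_le_power) simp
    have "norm (\<Sum>n<N. (\<nu> gchoose n) * x ^ n) \<le> (\<Sum>n<N. c n * (1/2) ^ n * (2 * norm x) ^ N)"
    proof (rule sum_norm_le)
      fix n assume n: "n \<in> {..<N}"
      have "norm ((\<nu> gchoose n) * x ^ n) \<le> c n * norm x ^ n"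
        unfolding norm_mult norm_power by (intro mult_right_mono gc) auto
      also have "\<dots> = c n * (1/2) ^ n * (2 * norm x) ^ n" by (simp add: power_mult_distrib power_divide)
      also have "\<dots> \<le> c n * (1/2) ^ n * (2 * norm x) ^ N"
        by (intro mult_left_mono power_increasing) (use n False c0 in auto)
      finally show "norm ((\<nu> gchoose n) * x ^ n) \<le> c n * (1/2) ^ n * (2 * norm x) ^ N" .
    qed
    also have "\<dots> = (\<Sum>n<N. c n * (1/2) ^ n) * (2 * norm x) ^ N" by (simp add: sum_distrib_right)
    also have "\<dots> \<le> 2 powr B * (2 * norm x) ^ N"
      using sum_le_suminf[OF sums_summable[OF cs], of "{..<N}"] sums_unique[OF cs] c0
      by (intro mult_right_mono) auto
    finally have S: "norm (\<Sum>n<N. (\<nu> gchoose n) * x ^ n) \<le> (2 * norm x) ^ N * (2 powr B * 1)" by (simp add: mult.commute)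
    have P: "norm ((1 + x) powr \<nu>) \<le> exp (pi * B) * D"
    proof -
      have Im: "\<bar>Im \<nu>\<bar> \<le> real B" "Re \<nu> \<le> real B" using \<nu>(1) abs_Im_le_cmod[of \<nu>] complex_Re_le_cmod[of \<nu>] by linarith+
      hence 1: "exp (\<bar>Im \<nu>\<bar> * pi) \<le> exp (pi * B)" by (simp add: mult.commute)
      have "norm (1 + x) powr Re \<nu> \<le> D"
      proof (cases "norm (1 + x) \<ge> 1")
        case True
        have "norm (1 + x) powr Re \<nu> \<le> norm (1 + x) powr real B" by (intro powr_mono Im True)
        also have "\<dots> = norm (1 + x) ^ B" using True by (intro powr_realpow) linarith
        also have "\<dots> \<le> (1 + norm x) ^ B" by (intro power_mono) (use norm_triangle_ineq[of 1 x] in auto)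
        finally show ?thesis unfolding D_def by (simp add: add_increasing2)
      next
        case lt: False
        \<comment> \<open>The reverse triangle inequality removes the dependence on the direction of
          x; together with Re \<nu> \<ge> -1/2 it leaves at worst an inverse square root.\<close>
        have ge: "\<bar>1 - norm x\<bar> \<le> norm (1 + x)" using norm_triangle_ineq3[of 1 "-x"] by simp
        have "norm (1 + x) powr Re \<nu> \<le> norm (1 + x) powr (-1/2)" by (intro powr_mono' \<nu>) (use lt in auto)
        also have "\<dots> \<le> \<bar>1 - norm x\<bar> powr (-1/2)" by (intro powr_mono2' ge) (use x in auto)
        finally show ?thesis unfolding D_def by (simp add: add_increasing)
      qed
      hence "norm (1 + x) powr Re \<nu> * exp (\<bar>Im \<nu>\<bar> * pi) \<le> D * exp (pi * B)" using 1 D by (intro mult_mono) auto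
      thus ?thesis using norm_powr_complex_le[of "1 + x" \<nu>] by (simp add: mult.commute)
    qed
    have "norm ((1 + x) powr \<nu> - (\<Sum>n<N. (\<nu> gchoose n) * x ^ n)) \<le> exp (pi * B) * D + (2 * norm x) ^ N * (2 powr B * 1)"
      by (rule order_trans[OF norm_triangle_ineq4 add_mono[OF P S]])
    also have "\<dots> \<le> (2 * norm x) ^ N * (exp (pi * B) * D) + (2 * norm x) ^ N * (2 * 2 powr B * D)"
    proof (intro add_mono mult_left_mono)
      show "exp (pi * B) * D \<le> (2 * norm x) ^ N * (exp (pi * B) * D)"
        using mult_right_mono[OF x1[of N], of "exp (pi * B) * D"] D by simp
      show "2 powr B * 1 \<le> 2 * 2 powr B * D" using D by (intro mult_mono) auto
    qed auto
    also have "\<dots> = (2 * norm x) ^ N * (2 * 2 powr B + exp (pi * B)) * D"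
      by (simp only: ring_distribs mult.assoc add.commute)
    finally show ?thesis .
  qed
  thus ?thesis by (simp add: D_def power_mult_distrib mult_ac)
qed

lemma inv_sqrt_powr: "1 / sqrt y = y powr (-1/2)" if "y > 0" for y :: real
proof -
  have "y powr (-(1/2)) = inverse (sqrt y)" unfolding powr_minus using that by (simp add: powr_half_sqrt)
  thus ?thesis by (simp add: inverse_eq_divide)
qed

text \<open>Square roots are antiderivatives on both sides of the singularity 1/K and are continuous
  there. What matters is a bound independent of K, which will be 1 + |w|.\<close>

lemma abs_linear_inv_sqrt_integral:
  fixes K :: real
  assumes K: "K > 1"
  shows "\<exists>I\<le>4. ((\<lambda>t. \<bar>1 - K * t\<bar> powr (-1/2)) has_integral I) {0<..<1}"
proof -
  have i1: "((\<lambda>t. \<bar>1 - K * t\<bar> powr (-1/2)) has_integral (- 2 / K * sqrt (1 - K * (1/K)) - (- 2 / K * sqrt (1 - K * 0)))) {0..1/K}"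
  proof (rule fundamental_theorem_of_calculus_interior)
    fix t assume "t \<in> {0<..<1/K}"
    hence pos: "1 - K * t > 0" using K by (auto simp: field_simps)
    have "((\<lambda>t. - 2 / K * sqrt (1 - K * t)) has_real_derivative 1 / sqrt (1 - K * t)) (at t)"
      using pos K by (auto intro!: derivative_eq_intros simp: field_simps)
    also have "1 / sqrt (1 - K * t) = \<bar>1 - K * t\<bar> powr (-1/2)"
      using inv_sqrt_powr[OF pos] pos by (simp add: abs_if)
    finally show "((\<lambda>t. - 2 / K * sqrt (1 - K * t)) has_vector_derivative \<bar>1 - K * t\<bar> powr (-1/2)) (at t)"
      by (simp add: has_real_derivative_iff_has_vector_derivative)
  qed (use K in \<open>auto intro!: continuous_intros\<close>)
  have i2: "((\<lambda>t. \<bar>1 - K * t\<bar> powr (-1/2)) has_integral (2 / K * sqrt (K * 1 - 1) - 2 / K * sqrt (K * (1/K) - 1))) {1/K..1}"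
  proof (rule fundamental_theorem_of_calculus_interior)
    fix t assume "t \<in> {1/K<..<1}"
    hence pos: "K * t - 1 > 0" using K by (auto simp: field_simps)
    have "((\<lambda>t. 2 / K * sqrt (K * t - 1)) has_real_derivative 1 / sqrt (K * t - 1)) (at t)"
      using pos K by (auto intro!: derivative_eq_intros simp: field_simps)
    also have "1 / sqrt (K * t - 1) = \<bar>1 - K * t\<bar> powr (-1/2)"
      using inv_sqrt_powr[OF pos] pos by (simp add: abs_if)
    finally show "((\<lambda>t. 2 / K * sqrt (K * t - 1)) has_vector_derivative \<bar>1 - K * t\<bar> powr (-1/2)) (at t)"
      by (simp add: has_real_derivative_iff_has_vector_derivative)
  qed (use K in \<open>auto intro!: continuous_intros\<close>)
  have "((\<lambda>t. \<bar>1 - K * t\<bar> powr (-1/2)) has_integral (2 / K + 2 / K * sqrt (K - 1))) {0..1}"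
    using has_integral_combine[OF _ _ i1 i2] K by simp
  moreover have "2 / K + 2 / K * sqrt (K - 1) \<le> 4"
  proof -
    have "sqrt (K - 1) \<le> sqrt (K ^ 2)" using K by (intro real_sqrt_le_mono) (auto simp: power2_eq_square intro: order_trans[of _ "K * 1"])
    hence "sqrt (K - 1) \<le> K" using K by simp
    thus ?thesis using K by (simp add: field_simps)
  qed
  ultimately show ?thesis unfolding has_integral_Icc_iff_Ioo by blast
qed

lemma power_le_fact_exp:
  fixes x :: real
  assumes "x \<ge> 0"
  shows "x ^ n \<le> fact n * exp x"
proof -
  have "(\<Sum>k\<in>{n}. x ^ k /\<^sub>R fact k) \<le> (\<Sum>k. x ^ k /\<^sub>R fact k)"
    by (rule sum_le_suminf) (use assms summable_exp_generic[of x] in auto)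
  also have "\<dots> = exp x" by (simp add: exp_def)
  finally show ?thesis by (simp add: field_simps)
qed

text \<open>Absorbs the exponentially small part of the remainder into the main part: Gamma(q +
  p)/Gamma(q) is a polynomial in q, so Beta decays only like a power of q, whereas (1 - \<delta>)^q
  decays exponentially. Beta decreases in its first argument, so a fixed integer p \<ge> a serves
  all a at once.\<close>

lemma geometric_le_Beta:
  fixes \<delta> :: real and p B :: nat
  assumes \<delta>: "0 < \<delta>" "\<delta> < 1" and p: "p > 0"
  shows "\<exists>C>0. \<forall>a q. 0 < a \<and> a \<le> real p \<and> q \<ge> 1 + real B \<longrightarrow> (1 - \<delta>) powr (q - 1 - real B) \<le> C * Beta a q"
proof (intro exI conjI allI impI)
  let ?C = "fact p * exp (\<delta> * (p + 1 + B)) / \<delta> ^ p"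
  show "?C > 0" using \<delta> by simp
  fix a q :: real assume "0 < a \<and> a \<le> real p \<and> q \<ge> 1 + real B"
  hence aq: "0 < a \<and> a \<le> real p \<and> q > 0" and True: "q - 1 - real B \<ge> 0" by auto
  have l: "ln (1 - \<delta>) \<le> -\<delta>" using \<delta> ln_le_minus_one[of "1 - \<delta>"] by simp
  define \<rho> where "\<rho> = (1 - \<delta>) powr (q - 1 - real B)"
  have Bp: "Beta (real p) q \<ge> 1 / (q + p) ^ p"
  proof -
    have "pochhammer q p = Gamma (q + real p) / Gamma q"
      using aq by (intro pochhammer_Gamma) (auto elim!: nonpos_Ints_cases')
    moreover have "Gamma q > 0" "Gamma (q + real p) > 0" using aq by (auto intro!: Gamma_real_pos)
    ultimately have "Beta (real p) q = Gamma (real p) / pochhammer q p"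
      by (simp add: Beta_def add.commute)
    moreover have "Gamma (real p) \<ge> 1"
    proof -
      have "real p = 1 + real (p - 1)" using p by simp
      hence "Gamma (real p) = fact (p - 1)" by (simp only: Gamma_fact)
      thus ?thesis by simp
    qed
    moreover have "pochhammer q p \<le> (q + p) ^ p"
    proof -
      have "pochhammer q p \<le> (\<Prod>k=0..<p. q + p)" unfolding pochhammer_prod
        by (intro prod_mono) (use aq in auto)
      thus ?thesis by simp
    qed
    moreover have "pochhammer q p > 0" using aq by (intro pochhammer_pos) auto
    ultimately show ?thesis by (simp add: frac_le)
  qed
  have pw: "(q + p) ^ p \<le> fact p * exp (\<delta> * (q + p)) / \<delta> ^ p"
    using power_le_fact_exp[of "\<delta> * (q + p)" p] \<delta> aq
    by (simp only: power_mult_distrib pos_le_divide_eq zero_less_power mult.commute[of _ "\<delta> ^ p"]) simp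
  have "\<rho> \<le> exp (-\<delta> * (q - 1 - real B))"
  proof -
    have "(q - 1 - real B) * ln (1 - \<delta>) \<le> (q - 1 - real B) * (-\<delta>)" using l True by (rule mult_left_mono)
    thus ?thesis unfolding \<rho>_def powr_def using \<delta> by (simp add: mult.commute)
  qed
  hence "\<rho> * (q + p) ^ p \<le> exp (-\<delta> * (q - 1 - real B)) * (fact p * exp (\<delta> * (q + p)) / \<delta> ^ p)"
    using pw aq by (intro mult_mono) auto
  also have "\<dots> = fact p / \<delta> ^ p * (exp (-\<delta> * (q - 1 - real B)) * exp (\<delta> * (q + p)))" by simp
  also have "exp (-\<delta> * (q - 1 - real B)) * exp (\<delta> * (q + p)) = exp (\<delta> * (p + 1 + B))"
    unfolding exp_add[symmetric] by (simp add: algebra_simps)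
  finally have "\<rho> * (q + p) ^ p \<le> ?C" by simp
  hence "\<rho> \<le> ?C * (1 / (q + p) ^ p)" 
    unfolding times_divide_eq_right mult_1_right
    by (rule mult_imp_le_div_pos[rotated]) (use aq in simp)
  also have "\<dots> \<le> ?C * Beta (real p) q" using Bp \<delta> by (intro mult_left_mono) auto
  also have "\<dots> \<le> ?C * Beta a q" using aq \<delta> by (intro mult_left_mono Beta_real_mono) auto
finally show "(1 - \<delta>) powr (q - 1 - real B) \<le> ?C * Beta a q" unfolding \<rho>_def .
qed

section \<open>The function G and its remainder\<close>

text \<open>The Gamma factors normalise the limit at w = 0 to Gamma(\<mu>) and are exchanged by the
  symmetry that sends \<nu> to -1 - \<nu>.\<close>

definition legendre_G :: "complex \<Rightarrow> complex \<Rightarrow> complex \<Rightarrow> complex" where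
  "legendre_G \<nu> \<mu> w = Gamma (\<nu> + \<mu> + 1) * Gamma (\<mu> - \<nu>) * hypergeo_reg (\<nu> + 1) (-\<nu>) (1 + \<mu>) (1 - w)"

definition legendre_G_rem :: "nat \<Rightarrow> complex \<Rightarrow> complex \<Rightarrow> complex \<Rightarrow> complex" where
  "legendre_G_rem N \<nu> \<mu> w = legendre_G \<nu> \<mu> w - (\<Sum>n<N. a_coeff n (\<nu> + 1/2) * Gamma (\<mu> - of_nat n) * (2 * w) ^ n)"

text \<open>1 - (1 - w) t = (1 - t) (1 + w t/(1 - t)), and the positive factor 1 - t may be taken
  out of a principal power without a branch correction.\<close>

lemma euler_integrand_shift:
  fixes t :: real and \<nu> \<mu> w :: complex
  assumes t: "0 < t" "t < 1"
  shows "of_real t powr (\<nu> + 1 - 1) * of_real (1 - t) powr (1 + \<mu> - (\<nu> + 1) - 1) * (1 - (1 - w) * of_real t) powr (- (- \<nu>))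
     = of_real t powr \<nu> * of_real (1 - t) powr (\<mu> - 1) * (1 + w * of_real (t / (1 - t))) powr \<nu>"
proof -
  define s where "s = 1 - t"
  have s: "s > 0" "complex_of_real s \<noteq> 0" using t by (auto simp: s_def)
  have "1 - (1 - w) * of_real t = of_real s * (1 + w * of_real (t / s))"
    using s by (simp add: s_def field_simps)
  hence "(1 - (1 - w) * of_real t) powr (- (- \<nu>)) = of_real s powr \<nu> * (1 + w * of_real (t / s)) powr \<nu>"
    using s by (simp add: powr_times_real_left)
  moreover have "of_real s powr (1 + \<mu> - (\<nu> + 1) - 1) * of_real s powr \<nu> = of_real s powr (\<mu> - 1)"
    unfolding powr_add[symmetric] by (simp add: algebra_simps)
  ultimately show ?thesis unfolding s_def[symmetric] by (simp add: mult_ac)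
qed

lemma legendre_G_symmetric:
  assumes "1 - w \<in> slit_plane"
  shows "legendre_G (-1 - \<nu>) \<mu> w = legendre_G \<nu> \<mu> w"
  using hypergeo_reg_commute[OF assms, of "\<nu> + 1" "-\<nu>" "1 + \<mu>"]
  by (simp add: legendre_G_def add_ac algebra_simps)

text \<open>The n-th binomial term has the weight t^(\<nu>+n) (1-t)^(\<mu>-n-1), integrable for n <
  N because Re \<mu> > N. The Beta arguments \<nu>+1+n and \<mu>-n have a sum independent of n, so
  the denominator cancels against the prefactor Gamma(\<nu>+\<mu>+1) and each term becomes exactly
  one term of the expansion.\<close>

lemma legendre_G_remainder_integral:
  fixes N :: nat
  assumes \<nu>: "Re \<nu> \<ge> -1/2" and \<mu>: "Re \<mu> > Re \<nu>" "Re \<mu> > real N" and w: "1 - w \<in> slit_plane"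
  shows "\<exists>J. ((\<lambda>t::real. of_real t powr \<nu> * of_real (1 - t) powr (\<mu> - 1) *
             ((1 + w * of_real (t / (1 - t))) powr \<nu> - (\<Sum>n<N. (\<nu> gchoose n) * (w * of_real (t / (1 - t))) ^ n))) has_integral J) {0<..<1} \<and>
         legendre_G_rem N \<nu> \<mu> w
           = Gamma (\<nu> + \<mu> + 1) * rGamma (\<nu> + 1) * J"
proof -
  let ?k = "\<lambda>t::real. of_real t powr \<nu> * of_real (1 - t) powr (\<mu> - 1)"
  let ?\<tau> = "\<lambda>t::real. complex_of_real (t / (1 - t))"
  let ?E = "euler_integral (-\<nu>) (\<nu> + 1) (1 + \<mu>) (1 - w)"
  have E: "((\<lambda>t. ?k t * (1 + w * ?\<tau> t) powr \<nu>) has_integral ?E) {0<..<1}"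
  proof -
    let ?f = "\<lambda>t::real. of_real t powr (\<nu> + 1 - 1) * of_real (1 - t) powr (1 + \<mu> - (\<nu> + 1) - 1) * (1 - (1 - w) * of_real t) powr (- (- \<nu>))"
    have "(?f has_integral ?E) {0<..<1}"
      unfolding euler_integral_def
      by (rule integrable_integral[OF integrable_euler_integrand]) (use \<nu> \<mu> w in auto)
    thus ?thesis by (rule has_integral_eq[rotated]) (rule euler_integrand_shift, auto)
  qed
  have T: "((\<lambda>t. ?k t * ((\<nu> gchoose n) * (w * ?\<tau> t) ^ n)) has_integral
      (\<nu> gchoose n) * w ^ n * Beta (\<nu> + 1 + of_nat n) (\<mu> - of_nat n)) {0<..<1}" if "n < N" for n
  proof -
    have "((\<lambda>t::real. (\<nu> gchoose n) * w ^ n * (of_real t powr (\<nu> + 1 + of_nat n - 1) * of_real (1 - t) powr (\<mu> - of_nat n - 1))) has_integral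
      (\<nu> gchoose n) * w ^ n * Beta (\<nu> + 1 + of_nat n) (\<mu> - of_nat n)) {0<..<1}"
      by (intro has_integral_mult_right has_integral_Beta_complex) (use that \<nu> \<mu> in auto)
    thus ?thesis
    proof (rule has_integral_eq[rotated])
      fix t :: real assume t: "t \<in> {0<..<1}"
      define s where "s = 1 - t"
      have s: "complex_of_real s \<noteq> 0" "complex_of_real t \<noteq> 0" using t by (auto simp: s_def)
      have "\<nu> + 1 + of_nat n - 1 = \<nu> + of_nat n" "\<mu> - of_nat n - 1 = \<mu> - 1 - of_nat n" by auto
      hence "complex_of_real t powr (\<nu> + 1 + of_nat n - 1) = of_real t powr \<nu> * of_real t ^ n"
        "complex_of_real s powr (\<mu> - of_nat n - 1) = of_real s powr (\<mu> - 1) / of_real s ^ n"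
        using s by (simp_all only: powr_add powr_diff powr_complexpow not_False_eq_True)
      thus "(\<nu> gchoose n) * w ^ n * (of_real t powr (\<nu> + 1 + of_nat n - 1) * of_real (1 - t) powr (\<mu> - of_nat n - 1))
         = ?k t * ((\<nu> gchoose n) * (w * ?\<tau> t) ^ n)"
        unfolding s_def[symmetric] by (simp add: power_mult_distrib power_divide)
    qed
  qed
  have TS: "((\<lambda>t. ?k t * (\<Sum>n<N. (\<nu> gchoose n) * (w * ?\<tau> t) ^ n)) has_integral
      (\<Sum>n<N. (\<nu> gchoose n) * w ^ n * Beta (\<nu> + 1 + of_nat n) (\<mu> - of_nat n))) {0<..<1}"
    unfolding sum_distrib_left by (intro has_integral_sum T) auto
  have ne: "Gamma (\<mu> - \<nu>) * rGamma (\<mu> - \<nu>) = 1" 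
    "Gamma (\<nu> + \<mu> + 1) * rGamma (\<nu> + \<mu> + 1) = 1" 
    by (rule Gamma_rGamma_Re_pos; use \<nu> \<mu> in simp)+
  have "legendre_G \<nu> \<mu> w = Gamma (\<nu> + \<mu> + 1) * Gamma (\<mu> - \<nu>) * (rGamma (\<nu> + 1) * rGamma (\<mu> - \<nu>) * ?E)"
    unfolding legendre_G_def using \<nu> \<mu>
    by (subst hypergeo_reg_commute[OF w], subst hypergeo_reg_euler[OF _ _ w]) (auto simp: algebra_simps)
  also have "\<dots> = Gamma (\<nu> + \<mu> + 1) * rGamma (\<nu> + 1) * ?E * (Gamma (\<mu> - \<nu>) * rGamma (\<mu> - \<nu>))" by (simp only: mult_ac)
  finally have G: "legendre_G \<nu> \<mu> w = Gamma (\<nu> + \<mu> + 1) * rGamma (\<nu> + 1) * ?E" by (simp only: ne mult_1_right)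
  have summand: "a_coeff n (\<nu> + 1/2) * Gamma (\<mu> - of_nat n) * (2 * w) ^ n
     = Gamma (\<nu> + \<mu> + 1) * rGamma (\<nu> + 1) * ((\<nu> gchoose n) * w ^ n * Beta (\<nu> + 1 + of_nat n) (\<mu> - of_nat n))" for n
  proof -
    have "\<nu> + 1 + of_nat n + (\<mu> - of_nat n) = \<nu> + \<mu> + 1" by simp
    hence B: "Beta (\<nu> + 1 + of_nat n) (\<mu> - of_nat n) = Gamma (\<nu> + 1 + of_nat n) * Gamma (\<mu> - of_nat n) * rGamma (\<nu> + \<mu> + 1)"
      unfolding Beta_altdef by (simp only:)
    have p: "rGamma (\<nu> + 1) * Gamma (\<nu> + 1 + of_nat n) = pochhammer (\<nu> + 1) n"
    proof -
      have "\<nu> + 1 \<notin> \<int>\<^sub>\<le>\<^sub>0" by (rule Re_pos_not_nonpos_Int) (use \<nu> in simp)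
      from pochhammer_Gamma[OF this, of n] show ?thesis
        by (simp only: rGamma_inverse_Gamma divide_inverse mult.commute)
    qed
    have "Gamma (\<nu> + \<mu> + 1) * rGamma (\<nu> + 1) * ((\<nu> gchoose n) * w ^ n * Beta (\<nu> + 1 + of_nat n) (\<mu> - of_nat n))
       = (rGamma (\<nu> + 1) * Gamma (\<nu> + 1 + of_nat n)) * (\<nu> gchoose n) * w ^ n * Gamma (\<mu> - of_nat n) * (Gamma (\<nu> + \<mu> + 1) * rGamma (\<nu> + \<mu> + 1))"
      unfolding B by (simp only: mult_ac)
    also have "\<dots> = a_coeff n (\<nu> + 1/2) * 2 ^ n * w ^ n * Gamma (\<mu> - of_nat n)"
      unfolding p ne a_coeff_eq by simp
    also have "\<dots> = a_coeff n (\<nu> + 1/2) * Gamma (\<mu> - of_nat n) * (2 * w) ^ n"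
      by (simp only: power_mult_distrib mult_ac)
    finally show ?thesis by (rule sym)
  qed
  show ?thesis
  proof (intro exI conjI)
    show "((\<lambda>t. ?k t * ((1 + w * ?\<tau> t) powr \<nu> - (\<Sum>n<N. (\<nu> gchoose n) * (w * ?\<tau> t) ^ n))) has_integral
       (?E - (\<Sum>n<N. (\<nu> gchoose n) * w ^ n * Beta (\<nu> + 1 + of_nat n) (\<mu> - of_nat n)))) {0<..<1}"
      using has_integral_diff[OF E TS] by (simp only: right_diff_distrib)
    show "legendre_G_rem N \<nu> \<mu> w
           = Gamma (\<nu> + \<mu> + 1) * rGamma (\<nu> + 1) * (?E - (\<Sum>n<N. (\<nu> gchoose n) * w ^ n * Beta (\<nu> + 1 + of_nat n) (\<mu> - of_nat n)))"
      unfolding legendre_G_rem_def G summand sum_distrib_left[symmetric] by (simp only: right_diff_distrib)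
  qed
qed

text \<open>The two terms of the bound come from \<open>t \<le> \<delta>\<close>, where the weight is bounded, and from \<open>t > \<delta>\<close>, where
  \<open>1 - t\<close> to a large power is at most \<open>1 - \<delta>\<close> to that power.\<close>

lemma remainder_weight_bound:
  fixes t k W r m :: real and N B :: nat
  defines "\<delta> \<equiv> 1 / (2 * (1 + W))"
  assumes t: "0 < t" "t < 1" and k: "0 < k" "k \<le> W" and t0: "t \<noteq> 1 / (1 + k)"
    and r: "r \<ge> -1/2" and m: "m \<ge> real N + real B + 2"
  shows "t powr r * (1 - t) powr (m - 1) * ((t / (1 - t)) ^ N * ((1 + k * (t / (1 - t))) ^ B + \<bar>1 - k * (t / (1 - t))\<bar> powr (-1/2)))
    \<le> ((1 + W) ^ B * 2 ^ B + 2) * (t powr (r + real N + 1 - 1) * (1 - t) powr (m - real N - 1))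
      + \<delta> powr (-1/2) * (1 - \<delta>) powr (m - real N - 1 - real B) * ((1 + W) ^ B + \<bar>1 - (1 + k) * t\<bar> powr (-1/2))"
proof -
  define s where "s = 1 - t"
  have s: "0 < s" "s < 1" using t by (auto simp: s_def)
  have \<delta>: "0 < \<delta>" "\<delta> \<le> 1/2" using k by (auto simp: \<delta>_def field_simps)
  define q where "q = \<bar>1 - (1 + k) * t\<bar> powr (-1/2)"
  have q0: "q \<ge> 0" by (simp add: q_def)
  have ne: "\<bar>1 - (1 + k) * t\<bar> > 0" using t0 k by (auto simp: field_simps)
  have a1: "(1 + k * (t / s)) ^ B \<le> (1 + W) ^ B * s powr (- real B)"
  proof -
    have "1 + k * (t / s) = (s + k * t) / s" using s by (simp add: field_simps)
    also have "\<dots> \<le> (1 + W) / s"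
    proof (intro divide_right_mono add_mono)
      have "k * t \<le> W * 1" using k t by (intro mult_mono) auto
      thus "k * t \<le> W" by simp
    qed (use s in auto)
    finally have "(1 + k * (t / s)) ^ B \<le> ((1 + W) / s) ^ B" using k t s by (intro power_mono) auto
    thus ?thesis using s by (simp add: powr_minus powr_realpow divide_inverse power_mult_distrib power_inverse)
  qed
  \<comment> \<open>Replaces the singularity in t/(1-t) by one that is linear in t, whose integral
    is explicit; dividing by s < 1 only enlarges the base, and the exponent is negative.\<close>
  have a2: "\<bar>1 - k * (t / s)\<bar> powr (-1/2) \<le> q"
    unfolding q_def
  proof (rule powr_mono2')
    have "1 - k * (t / s) = (1 - (1 + k) * t) / s" using s by (simp add: s_def field_simps)
    hence "\<bar>1 - k * (t / s)\<bar> = \<bar>1 - (1 + k) * t\<bar> / s" using s by (simp add: abs_divide)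
    also have "\<dots> \<ge> \<bar>1 - (1 + k) * t\<bar>" using s ne by (simp add: field_simps mult_le_cancel_left1)
    finally show "\<bar>1 - (1 + k) * t\<bar> \<le> \<bar>1 - k * (t / s)\<bar>" .
  qed (use ne in auto)
  define S where "S = t powr (r + real N) * s powr (m - 1 - real N)"
  have S0: "S \<ge> 0" by (simp add: S_def)
  have eqS: "t powr r * s powr (m - 1) * (t / s) ^ N = S"
    using t s by (simp add: S_def powr_add powr_diff powr_realpow power_divide)
  have "t powr r * s powr (m - 1) * ((t / s) ^ N * ((1 + k * (t / s)) ^ B + \<bar>1 - k * (t / s)\<bar> powr (-1/2)))
     = S * ((1 + k * (t / s)) ^ B + \<bar>1 - k * (t / s)\<bar> powr (-1/2))" unfolding eqS[symmetric] by (simp only: mult.assoc)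
  also have "\<dots> \<le> S * ((1 + W) ^ B * s powr (- real B) + q)"
    using a1 a2 S0 by (intro mult_left_mono add_mono)
  also have "\<dots> \<le> ((1 + W) ^ B * 2 ^ B + 2) * S + \<delta> powr (-1/2) * (1 - \<delta>) powr (m - real N - 1 - real B) * ((1 + W) ^ B + q)"
  proof (cases "t \<le> \<delta>")
    case True
    have "s powr (- real B) \<le> (1/2) powr (- real B)" using True \<delta> s by (intro powr_mono2') (auto simp: s_def)
    also have "\<dots> = 2 ^ B" by (simp add: powr_minus powr_realpow power_divide)
    finally have 1: "s powr (- real B) \<le> 2 ^ B" .
    \<comment> \<open>The choice of \<open>\<delta>\<close> keeps t \<le> \<delta> away from the
      singular point 1/(1+k). The base is then at least 1/2; the weaker lower bound 1/4 gives the
      round value 2.\<close>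
    have "(1 + k) * t \<le> (1 + W) * \<delta>" using k True t by (intro mult_mono) auto
    also have "\<dots> = 1/2" using k by (simp add: \<delta>_def)
    finally have "q \<le> (1/4) powr (-1/2)" unfolding q_def by (intro powr_mono2') auto
    also have "(1/4 :: real) powr (-1/2) = 2" using inv_sqrt_powr[of "1/4"] by (simp add: real_sqrt_divide)
    finally have 2: "q \<le> 2" .
    have "S * ((1 + W) ^ B * s powr (- real B) + q) \<le> S * ((1 + W) ^ B * 2 ^ B + 2)"
      using 1 2 S0 k by (intro mult_left_mono add_mono) auto
    also have "\<dots> \<le> ((1 + W) ^ B * 2 ^ B + 2) * S + \<delta> powr (-1/2) * (1 - \<delta>) powr (m - real N - 1 - real B) * ((1 + W) ^ B + q)"
      using q0 k by (simp add: mult.commute)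
    finally show ?thesis .
  next
    case False
    have "t powr (r + real N) \<le> t powr (-1/2)" using t r by (intro powr_mono') auto
    also have "\<dots> \<le> \<delta> powr (-1/2)" using False \<delta> by (intro powr_mono2') auto
    finally have 1: "t powr (r + real N) \<le> \<delta> powr (-1/2)" .
    have 2: "s powr (m - 1 - real N - real B) \<le> (1 - \<delta>) powr (m - 1 - real N - real B)"
      using False \<delta> s m by (intro powr_mono2) (auto simp: s_def)
    have 3: "s powr (m - 1 - real N) \<le> s powr (m - 1 - real N - real B)" using s by (intro powr_mono') auto
    have 4: "S * s powr (- real B) = t powr (r + real N) * s powr (m - 1 - real N - real B)"
      by (simp add: S_def powr_diff powr_minus divide_inverse)
    have 5: "t powr (r + real N) * s powr (m - 1 - real N - real B) \<le> \<delta> powr (-1/2) * (1 - \<delta>) powr (m - 1 - real N - real B)"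
      using 1 2 by (intro mult_mono) auto
    have 6: "S \<le> t powr (r + real N) * s powr (m - 1 - real N - real B)"
      unfolding S_def using 3 by (intro mult_left_mono) auto
    have "S * ((1 + W) ^ B * s powr (- real B) + q) = (1 + W) ^ B * (S * s powr (- real B)) + S * q"
      by (simp add: algebra_simps)
    also have "\<dots> \<le> (1 + W) ^ B * (\<delta> powr (-1/2) * (1 - \<delta>) powr (m - 1 - real N - real B))
         + (\<delta> powr (-1/2) * (1 - \<delta>) powr (m - 1 - real N - real B)) * q"
      using 4 5 6 q0 k by (intro add_mono mult_left_mono mult_right_mono) auto
    also have "\<dots> = \<delta> powr (-1/2) * (1 - \<delta>) powr (m - real N - 1 - real B) * ((1 + W) ^ B + q)"
      by (simp add: algebra_simps)
    also have "\<dots> \<le> ((1 + W) ^ B * 2 ^ B + 2) * S + \<dots>" using S0 k by simp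
    finally show ?thesis .
  qed
  finally show ?thesis unfolding s_def[symmetric] q_def[symmetric]
    by (simp add: S_def algebra_simps)
qed

lemma bounded_rGamma_shift: "\<exists>c>0. \<forall>\<nu>::complex. norm \<nu> \<le> B \<longrightarrow> norm (rGamma (\<nu> + 1)) \<le> c"
proof -
  have "continuous_on (cball 0 B) (\<lambda>\<nu>::complex. rGamma (\<nu> + 1))"
    by (intro continuous_intros continuous_on_compose2[OF continuous_on_rGamma[of UNIV]]) auto
  hence "bounded ((\<lambda>\<nu>::complex. rGamma (\<nu> + 1)) ` cball 0 B)"
    by (intro compact_imp_bounded compact_continuous_image) auto
  thus ?thesis unfolding bounded_pos by (auto simp: dist_norm)
qed

lemma bounded_Gamma_Icc: "\<exists>c>0. \<forall>x::real. 1/2 \<le> x \<and> x \<le> M \<longrightarrow> Gamma x \<le> c"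
proof -
  have "continuous_on {1/2..M} (Gamma :: real \<Rightarrow> real)"
    by (intro continuous_on_Gamma) (auto elim!: nonpos_Ints_cases')
  hence "bounded ((Gamma :: real \<Rightarrow> real) ` {1/2..M})"
    by (intro compact_imp_bounded compact_continuous_image) auto
  thus ?thesis unfolding bounded_pos by (auto simp: abs_le_iff)
qed

text \<open>After integration the majorant is a multiple of Beta(Re \<nu> + N + 1, Re \<mu> - N),
  its exponentially small part being absorbed by \<open>geometric_le_Beta\<close>. The prefactor
  Gamma(\<nu>+\<mu>+1) cancels the denominator of this Beta value up to a constant, which leaves
  Gamma(Re \<mu> - N); bounded Im \<mu> allows its replacement by |Gamma(\<mu> - N)|.\<close>

lemma legendre_G_expansion_halfplane:
  fixes B N :: nat and W Y :: real
  assumes W: "W > 0"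
  shows "\<exists>C>0. \<forall>\<nu> \<mu> w. norm \<nu> \<le> real B \<longrightarrow> Re \<nu> \<ge> -1/2 \<longrightarrow> Re \<mu> \<ge> real N + real B + 2 \<longrightarrow> \<bar>Im \<mu>\<bar> \<le> Y \<longrightarrow>
    w \<noteq> 0 \<longrightarrow> norm w \<le> W \<longrightarrow> 1 - w \<in> slit_plane \<longrightarrow>
    norm (legendre_G_rem N \<nu> \<mu> w)
      \<le> C * norm (Gamma (\<mu> - of_nat N)) * norm w ^ N"
proof -
  define \<delta> where "\<delta> = 1 / (2 * (1 + W))"
  have \<delta>: "0 < \<delta>" "\<delta> < 1" using W by (auto simp: \<delta>_def field_simps)
  obtain C\<beta> where C\<beta>: "C\<beta> > 0" "\<And>a q. 0 < a \<Longrightarrow> a \<le> real (B + N + 1) \<Longrightarrow> q \<ge> 1 + real B \<Longrightarrow>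
      (1 - \<delta>) powr (q - 1 - real B) \<le> C\<beta> * Beta a q"
    using geometric_le_Beta[OF \<delta>, of "B + N + 1" B] by auto
  obtain c4 where c4: "c4 > 0" "\<And>\<nu>::complex. norm \<nu> \<le> real B \<Longrightarrow> norm (rGamma (\<nu> + 1)) \<le> c4"
    using bounded_rGamma_shift[of "real B"] by blast
  obtain c5 where c5: "c5 > 0" "\<And>x::real. 1/2 \<le> x \<Longrightarrow> x \<le> real (B + N + 1) \<Longrightarrow> Gamma x \<le> c5"
    using bounded_Gamma_Icc[of "real (B + N + 1)"] by blast
  define C0 where "C0 = 2 ^ N * (2 * 2 powr real B + exp (pi * real B))"
  have C0: "C0 > 0" by (auto simp: C0_def intro!: mult_pos_pos add_pos_pos)
  define c1 where "c1 = (1 + W) ^ B * 2 ^ B + 2"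
  define c2 where "c2 = \<delta> powr (-1/2)"
  define c3 where "c3 = c1 + c2 * C\<beta> * ((1 + W) ^ B + 4)"
  have c123: "c1 > 0" "c2 \<ge> 0" "c3 > 0" using W C\<beta>(1)
    by (auto simp: c1_def c2_def c3_def intro!: add_pos_pos add_pos_nonneg mult_nonneg_nonneg)
  define CY where "CY = exp (Y\<^sup>2 * (pi\<^sup>2 / 6))"
  show ?thesis
  proof (rule exI[of _ "c4 * C0 * c3 * c5 * CY"], intro conjI allI impI)
    show "c4 * C0 * c3 * c5 * CY > 0" using c4 C0 c123 c5 by (simp add: CY_def)
    fix \<nu> \<mu> w :: complex
    assume \<nu>: "norm \<nu> \<le> real B" "Re \<nu> \<ge> -1/2" and \<mu>: "Re \<mu> \<ge> real N + real B + 2" "\<bar>Im \<mu>\<bar> \<le> Y"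
      and w: "w \<noteq> 0" "norm w \<le> W" "1 - w \<in> slit_plane"
    define r m k where "r = Re \<nu>" and "m = Re \<mu>" and "k = norm w"
    have r: "r \<ge> -1/2" "r \<le> real B" using \<nu> complex_Re_le_cmod[of \<nu>] by (auto simp: r_def)
    have k: "0 < k" "k \<le> W" using w by (auto simp: k_def)
    have m: "m \<ge> real N + real B + 2" using \<mu> by (simp add: m_def)
    let ?b = "Beta (r + real N + 1) (m - real N)"
    define f where "f = (\<lambda>t::real. of_real t powr \<nu> * of_real (1 - t) powr (\<mu> - 1) *
             ((1 + w * of_real (t / (1 - t))) powr \<nu> - (\<Sum>n<N. (\<nu> gchoose n) * (w * of_real (t / (1 - t))) ^ n)))"
    obtain J where J: "(f has_integral J) {0<..<1}"
      and eq: "legendre_G_rem N \<nu> \<mu> w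
           = Gamma (\<nu> + \<mu> + 1) * rGamma (\<nu> + 1) * J"
      using legendre_G_remainder_integral[of \<nu> \<mu> N w] \<nu> r m w(3) unfolding f_def r_def m_def by auto
    obtain I where I: "I \<le> 4" "((\<lambda>t. \<bar>1 - (1 + k) * t\<bar> powr (-1/2)) has_integral I) {0<..<1}"
      using abs_linear_inv_sqrt_integral[of "1 + k"] k by auto
    define \<rho> where "\<rho> = (1 - \<delta>) powr (m - real N - 1 - real B)"
    define g where "g = (\<lambda>t. C0 * k ^ N * (c1 * (t powr (r + real N + 1 - 1) * (1 - t) powr (m - real N - 1))
        + c2 * \<rho> * ((1 + W) ^ B + \<bar>1 - (1 + k) * t\<bar> powr (-1/2))))"
    have const: "((\<lambda>t. (1 + W) ^ B) has_integral (1 + W) ^ B) {0<..<1::real}"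
      using has_integral_const_real[of "(1 + W) ^ B" 0 1] by (simp add: has_integral_Icc_iff_Ioo)
    have g: "(g has_integral (C0 * k ^ N * (c1 * ?b + c2 * \<rho> * ((1 + W) ^ B + I)))) {0<..<1}"
      unfolding g_def
      by (intro has_integral_mult_right has_integral_add const I has_integral_Beta_real_Ioo) (use r m in auto)
    \<comment> \<open>At t = 1/(1+k) the majorant has the value \<open>0 powr (-1/2) = 0\<close> in
      place of a pole, so domination may fail there. Changing it at this one point leaves its
      integral unchanged.\<close>
    define g' where "g' = (\<lambda>t. if t = 1 / (1 + k) then norm (f t) else g t)"
    have g': "(g' has_integral (C0 * k ^ N * (c1 * ?b + c2 * \<rho> * ((1 + W) ^ B + I)))) {0<..<1}"
      by (rule has_integral_spike_finite[OF _ _ g, of "{1 / (1 + k)}"]) (auto simp: g'_def)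
    have "norm (f t) \<le> g' t" if t: "t \<in> {0<..<1}" for t
    proof (cases "t = 1 / (1 + k)")
      case False
      define \<tau> where "\<tau> = t / (1 - t)"
      have \<tau>: "\<tau> > 0" using t by (simp add: \<tau>_def)
      have nx: "norm (w * of_real \<tau>) = k * \<tau>" using \<tau> by (simp add: norm_mult k_def)
      have "k * \<tau> \<noteq> 1" using False t k by (auto simp: \<tau>_def field_simps)
      hence R: "norm ((1 + w * of_real \<tau>) powr \<nu> - (\<Sum>n<N. (\<nu> gchoose n) * (w * of_real \<tau>) ^ n))
         \<le> C0 * (k * \<tau>) ^ N * ((1 + k * \<tau>) ^ B + \<bar>1 - k * \<tau>\<bar> powr (-1/2))"
        using binomial_remainder_bound[OF \<nu>, of "w * of_real \<tau>" N] unfolding nx C0_def by simp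
      have "norm (f t) = t powr r * (1 - t) powr (m - 1) * norm ((1 + w * of_real \<tau>) powr \<nu> - (\<Sum>n<N. (\<nu> gchoose n) * (w * of_real \<tau>) ^ n))"
        unfolding f_def \<tau>_def[symmetric] norm_mult using t by (simp add: norm_of_real_powr r_def m_def del: of_real_diff)
      also have "\<dots> \<le> t powr r * (1 - t) powr (m - 1) * (C0 * (k * \<tau>) ^ N * ((1 + k * \<tau>) ^ B + \<bar>1 - k * \<tau>\<bar> powr (-1/2)))"
        by (intro mult_left_mono R) auto
      also have "\<dots> = C0 * k ^ N * (t powr r * (1 - t) powr (m - 1) * (\<tau> ^ N * ((1 + k * \<tau>) ^ B + \<bar>1 - k * \<tau>\<bar> powr (-1/2))))"
        by (simp only: power_mult_distrib mult_ac)
      also have "\<dots> \<le> g t"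
        unfolding g_def \<tau>_def c1_def c2_def \<rho>_def \<delta>_def
        by (intro mult_left_mono remainder_weight_bound) (use t k False r m C0 in auto)
      finally show ?thesis using False by (simp add: g'_def)
    qed (simp add: g'_def)
    hence "norm (integral {0<..<1} f) \<le> integral {0<..<1} g'"
      using J g' by (intro integral_norm_bound_integral) (auto intro: has_integral_integrable)
    hence "norm J \<le> C0 * k ^ N * (c1 * ?b + c2 * \<rho> * ((1 + W) ^ B + I))"
      by (simp only: integral_unique[OF J] integral_unique[OF g'])
    also have "\<dots> \<le> C0 * k ^ N * (c1 * ?b + c2 * (C\<beta> * ?b) * ((1 + W) ^ B + 4))"
    proof (intro mult_left_mono add_mono order_refl mult_mono)
      show "\<rho> \<le> C\<beta> * ?b" unfolding \<rho>_def by (rule C\<beta>(2)) (use r m in auto)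
      have "0 \<le> I" by (rule has_integral_nonneg[OF I(2)]) auto
      thus "0 \<le> (1 + W) ^ B + I" using W by simp
      have "?b \<ge> 0" by (rule has_integral_nonneg[OF has_integral_Beta_real_Ioo]) (use r m in auto)
      thus "0 \<le> c2 * (C\<beta> * ?b)" using c123 C\<beta> by simp
    qed (use I C0 k c123 \<rho>_def in auto)
    also have "\<dots> = C0 * k ^ N * c3 * ?b" by (simp add: c3_def algebra_simps)
    finally have nJ: "norm J \<le> C0 * k ^ N * c3 * ?b" .
    have Gpos: "Gamma (r + m + 1) > 0" "Gamma (m - real N) > 0" "Gamma (r + real N + 1) > 0"
      using r m by (auto intro!: Gamma_real_pos)
    have b: "?b = Gamma (r + real N + 1) * Gamma (m - real N) / Gamma (r + m + 1)"
    proof -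
      have "r + real N + 1 + (m - real N) = r + m + 1" by simp
      thus ?thesis unfolding Beta_def by (simp only:)
    qed
    have G1: "norm (Gamma (\<nu> + \<mu> + 1)) \<le> Gamma (r + m + 1)"
      using norm_Gamma_le[of "\<nu> + \<mu> + 1"] r m by (simp add: r_def m_def)
    have G2: "Gamma (m - real N) \<le> CY * norm (Gamma (\<mu> - of_nat N))"
    proof -
      have "Gamma (m - real N) \<le> exp ((Im \<mu>)\<^sup>2 * (pi\<^sup>2 / 6)) * norm (Gamma (\<mu> - of_nat N))"
        using Gamma_Re_le[of "\<mu> - of_nat N"] m by (simp add: m_def)
      also have "exp ((Im \<mu>)\<^sup>2 * (pi\<^sup>2 / 6)) \<le> CY"
        unfolding CY_def exp_le_cancel_iff
        by (intro mult_right_mono) (use \<mu>(2) abs_le_square_iff[of "Im \<mu>" Y] in auto)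
      finally show ?thesis by (simp add: mult_right_mono)
    qed
    have "norm (Gamma (\<nu> + \<mu> + 1) * rGamma (\<nu> + 1) * J) \<le> Gamma (r + m + 1) * c4 * (C0 * k ^ N * c3 * ?b)"
      unfolding norm_mult using G1 c4 \<nu>(1) nJ Gpos by (intro mult_mono) auto
    also have "\<dots> = c4 * C0 * c3 * k ^ N * (Gamma (r + real N + 1) * Gamma (m - real N))"
      unfolding b using Gpos by simp
    also have "\<dots> \<le> c4 * C0 * c3 * k ^ N * (c5 * (CY * norm (Gamma (\<mu> - of_nat N))))"
      using c4 C0 c123 k Gpos c5(1) by (intro mult_left_mono mult_mono G2 c5(2)) (use r in \<open>auto simp: CY_def\<close>)
    finally show "norm (legendre_G_rem N \<nu> \<mu> w)
      \<le> c4 * C0 * c3 * c5 * CY * norm (Gamma (\<mu> - of_nat N)) * norm w ^ N"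
      unfolding eq by (simp add: k_def mult_ac)
  qed
qed

lemma a_coeff_symmetric: "a_coeff n (-1 - \<nu> + 1/2) = a_coeff n (\<nu> + 1/2)"
  by (simp add: a_coeff_def power2_eq_square algebra_simps)

theorem legendre_G_expansion:
  fixes B N :: nat and W Y :: real
  assumes W: "W > 0"
  shows "\<exists>C>0. \<forall>\<nu> \<mu> w. norm \<nu> \<le> real B \<longrightarrow> Re \<mu> \<ge> real N + real B + 3 \<longrightarrow> \<bar>Im \<mu>\<bar> \<le> Y \<longrightarrow>
    w \<noteq> 0 \<longrightarrow> norm w \<le> W \<longrightarrow> 1 - w \<in> slit_plane \<longrightarrow>
    norm (legendre_G_rem N \<nu> \<mu> w)
      \<le> C * norm (Gamma (\<mu> - of_nat N)) * norm w ^ N"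
proof -
  \<comment> \<open>The reflected degree -1 - \<nu> has norm at most B + 1; hence the shift in
    \<open>B\<close>, which raises the threshold for Re \<mu> to N + B + 3.\<close>
  obtain C where C: "C > 0" "\<And>\<nu> \<mu> w. norm \<nu> \<le> real (B + 1) \<Longrightarrow> Re \<nu> \<ge> -1/2 \<Longrightarrow> Re \<mu> \<ge> real N + real (B + 1) + 2 \<Longrightarrow> \<bar>Im \<mu>\<bar> \<le> Y \<Longrightarrow>
    w \<noteq> 0 \<Longrightarrow> norm w \<le> W \<Longrightarrow> 1 - w \<in> slit_plane \<Longrightarrow>
    norm (legendre_G_rem N \<nu> \<mu> w)
      \<le> C * norm (Gamma (\<mu> - of_nat N)) * norm w ^ N"
    using legendre_G_expansion_halfplane[OF W, of "B + 1" N Y] by blast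
  show ?thesis
  proof (rule exI[of _ C], intro conjI allI impI)
    fix \<nu> \<mu> w :: complex
    assume *: "norm \<nu> \<le> real B" "Re \<mu> \<ge> real N + real B + 3" "\<bar>Im \<mu>\<bar> \<le> Y" "w \<noteq> 0" "norm w \<le> W" "1 - w \<in> slit_plane"
    show "norm (legendre_G_rem N \<nu> \<mu> w)
      \<le> C * norm (Gamma (\<mu> - of_nat N)) * norm w ^ N"
    proof (cases "Re \<nu> \<ge> -1/2")
      case True
      show ?thesis by (rule C(2)) (use * True in auto)
    next
      case False
      have "norm (-1 - \<nu>) \<le> real (B + 1)" using norm_triangle_ineq4[of "-1" \<nu>] * by simp
      from C(2)[OF this, of \<mu> w] * False show ?thesis
        unfolding legendre_G_rem_def legendre_G_symmetric[OF *(6)] a_coeff_symmetric by simp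
    qed
  qed fact
qed

section \<open>Behaviour of the hypergeometric function at 1\<close>

text \<open>For Re c > 0 this is the product formula of Gauss for Gamma(c). Lowering c by one
  multiplies the sequence by 1 + c/n, with c the larger of the two values; since this tends to 1,
  the limit persists further left.\<close>

lemma rGamma_shift_asymptotic:
  "(\<lambda>n. rGamma (c + of_nat n + 1) * fact n * exp (c * of_real (ln (of_nat n)))) \<longlonglongrightarrow> (1 :: complex)"
proof -
  have base: "(\<lambda>n. rGamma (c + of_nat n + 1) * fact n * exp (c * of_real (ln (of_nat n)))) \<longlonglongrightarrow> 1"
    if c: "Re c > 0" for c :: complex
  proof -
    have nz: "c \<notin> \<int>\<^sub>\<le>\<^sub>0" by (rule Re_pos_not_nonpos_Int[OF c])
    have "(\<lambda>n. rGamma c * Gamma_series c n) \<longlonglongrightarrow> rGamma c * Gamma c" by (intro tendsto_intros)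
    moreover have "rGamma c * Gamma c = 1" using Gamma_rGamma_Re_pos(2)[OF c] by (simp add: mult.commute)
    moreover have "rGamma c * Gamma_series c n = rGamma (c + of_nat n + 1) * fact n * exp (c * of_real (ln (of_nat n)))" for n
    proof -
      have "pochhammer c (n + 1) \<noteq> 0" using nz pochhammer_eq_0_imp_nonpos_Int by blast
      thus ?thesis using pochhammer_rGamma[of c "n + 1"] by (simp add: Gamma_series_def add_ac)
    qed
    ultimately show ?thesis by simp
  qed
  have step: "(\<lambda>n. rGamma (c + of_nat n + 1) * fact n * exp (c * of_real (ln (of_nat n)))) \<longlonglongrightarrow> 1"
    if "Re (c + of_nat k) > 0" for c :: complex and k
    using that
  proof (induction k arbitrary: c)
    case 0 thus ?case using base by simp
  next
    case (Suc k)
    have IH: "(\<lambda>n. rGamma (c + 1 + of_nat n + 1) * fact n * exp ((c + 1) * of_real (ln (of_nat n)))) \<longlonglongrightarrow> 1"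
      by (rule Suc.IH) (use Suc.prems in simp)
    have l: "(\<lambda>n. 1 + (c + 1) * (1 / of_nat n)) \<longlonglongrightarrow> 1 + (c + 1) * 0" by (intro tendsto_intros lim_1_over_n)
    have "(\<lambda>n. (1 + (c + 1) * (1 / of_nat n)) * (rGamma (c + 1 + of_nat n + 1) * fact n * exp ((c + 1) * of_real (ln (of_nat n))))) \<longlonglongrightarrow> 1"
      using tendsto_mult[OF l IH] by simp
    moreover have "\<forall>\<^sub>F n in sequentially. (1 + (c + 1) * (1 / of_nat n)) * (rGamma (c + 1 + of_nat n + 1) * fact n * exp ((c + 1) * of_real (ln (of_nat n))))
       = rGamma (c + of_nat n + 1) * fact n * exp (c * of_real (ln (of_nat n)))"
      using eventually_gt_at_top[of 0]
    proof eventually_elim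
      case (elim n)
      have "exp ((c + 1) * of_real (ln (of_nat n))) = exp (c * of_real (ln (of_nat n))) * of_nat n"
        using elim by (simp add: ring_distribs exp_add exp_of_real)
      moreover have "rGamma (c + of_nat n + 1) = (c + of_nat n + 1) * rGamma (c + 1 + of_nat n + 1)"
        using rGamma_plus1[of "c + of_nat n + 1"] by (simp add: add_ac)
      ultimately show ?case using elim by (simp add: field_simps)
    qed
    ultimately show ?case by (rule Lim_transform_eventually)
  qed
  obtain k :: nat where "real k > - Re c" using reals_Archimedean2 by blast
  thus ?thesis by (intro step[of _ k]) simp
qed

text \<open>Writing each Pochhammer symbol as \<open>rGamma_series\<close> times n! n^x, the powers
  of n combine to n^(a+b-c) = n^M, and the remaining quotients converge. \<open>lam\<close> is the
  value that makes the leading terms cancel. The error is measured against (Re M)_n/n!, a positive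
  sequence with a summable power series of known sum.\<close>

lemma hyp_coeff_comparison:
  fixes a b c :: complex
  defines "M \<equiv> a + b - c"
  defines "lam \<equiv> Gamma M * rGamma a * rGamma b"
  assumes M: "Re M > 0"
  shows "(\<lambda>n. norm (hyp_coeff a b c n - lam * (pochhammer M n / fact n)) / (pochhammer (Re M) n / fact n)) \<longlonglongrightarrow> 0"
proof (rule LIMSEQ_imp_Suc)
  let ?L = "\<lambda>n. rGamma (c + of_nat n + 1) * fact n * exp (c * of_real (ln (of_nat n)))"
  let ?d = "\<lambda>n. norm (rGamma_series a n * rGamma_series b n * ?L n - lam * rGamma_series M n) / rGamma_series (Re M) n"
  have rM: "rGamma (Re M) > 0" using Gamma_real_pos[OF M] by (simp add: rGamma_inverse_Gamma)
  have 0: "rGamma a * rGamma b * 1 - lam * rGamma M = 0"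
    using Gamma_rGamma_Re_pos(2)[OF M] by (simp add: lam_def)
  have "?d \<longlonglongrightarrow> norm (rGamma a * rGamma b * 1 - lam * rGamma M) / rGamma (Re M)"
    by (intro tendsto_intros rGamma_shift_asymptotic) (use rM in simp)
  hence "?d \<longlonglongrightarrow> 0" unfolding 0 by simp
  moreover have "\<forall>\<^sub>F n in sequentially. ?d n = norm (hyp_coeff a b c (Suc n) - lam * (pochhammer M (Suc n) / fact (Suc n))) / (pochhammer (Re M) (Suc n) / fact (Suc n))"
    using eventually_gt_at_top[of 0]
  proof eventually_elim
    case (elim n)
    define E where "E = (\<lambda>x::complex. exp (x * of_real (ln (of_nat n))))"
    have Ea: "E (x + y) = E x * E y" for x y by (simp add: E_def ring_distribs exp_add)
    have nE: "norm (E M) = exp (Re M * ln (real n))" by (simp add: E_def)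
    \<comment> \<open>\<open>rGamma_series x n\<close> contains the Pochhammer symbol of length n +
      1; this is why the limit is proved for the shifted sequence.\<close>
    have ph: "pochhammer x (Suc n) = rGamma_series x n * fact n * E x" for x
      by (simp add: rGamma_series_def E_def)
    have phr: "pochhammer (Re M) (Suc n) = rGamma_series (Re M) n * fact n * exp (Re M * ln (real n))"
      by (simp add: rGamma_series_def)
    have h: "hyp_coeff a b c (Suc n) = rGamma_series a n * rGamma_series b n * ?L n * (fact n * E M / fact (Suc n))"
    proof -
      have "E a * E b = E M * E c" unfolding Ea[symmetric] by (simp add: M_def)
      hence "(rGamma_series a n * fact n * E a) * (rGamma_series b n * fact n * E b) * rGamma (c + of_nat n + 1) / fact (Suc n)
         = rGamma_series a n * rGamma_series b n * (rGamma (c + of_nat n + 1) * fact n * E c) * (fact n * E M / fact (Suc n))"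
        by (simp del: fact_Suc)
      thus ?thesis unfolding hyp_coeff_def ph by (simp add: E_def add_ac del: fact_Suc)
    qed
    have "hyp_coeff a b c (Suc n) - lam * (pochhammer M (Suc n) / fact (Suc n))
        = (rGamma_series a n * rGamma_series b n * ?L n - lam * rGamma_series M n) * (fact n * E M / fact (Suc n))"
    proof -
      define X where "X = (fact n * E M / fact (Suc n) :: complex)"
      have "pochhammer M (Suc n) / fact (Suc n) = rGamma_series M n * X" by (simp add: ph X_def del: fact_Suc)
      thus ?thesis unfolding h X_def[symmetric] by (simp only: left_diff_distrib mult.assoc)
    qed
    hence "norm (hyp_coeff a b c (Suc n) - lam * (pochhammer M (Suc n) / fact (Suc n)))
       = norm (rGamma_series a n * rGamma_series b n * ?L n - lam * rGamma_series M n) * (fact n * exp (Re M * ln (real n)) / fact (Suc n))"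
      by (simp only: norm_mult norm_divide nE norm_fact)
    thus ?case unfolding phr by (simp del: fact_Suc)
  qed
  ultimately show "(\<lambda>n. norm (hyp_coeff a b c (Suc n) - lam * (pochhammer M (Suc n) / fact (Suc n))) / (pochhammer (Re M) (Suc n) / fact (Suc n))) \<longlonglongrightarrow> 0"
    by (rule Lim_transform_eventually)
qed

text \<open>Abel-type limit in a Stolz angle: near the singularity \<open>1\<close> the hypergeometric series is compared
  coefficientwise with the binomial series of \<open>(1 - x)\<close> to the power \<open>c - a - b\<close>.\<close>

lemma hypergeo_reg_limit_at_1:
  fixes a b c :: complex and x :: "nat \<Rightarrow> complex" and Q :: real
  defines "M \<equiv> a + b - c"
  assumes M: "Re M > 0" and x: "\<And>k. norm (x k) < 1" "x \<longlonglongrightarrow> 1"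
    and stolz: "\<And>k. norm (1 - x k) \<le> Q * (1 - norm (x k))"
  shows "(\<lambda>k. (1 - x k) powr M * hypergeo_reg a b c (x k)) \<longlonglongrightarrow> Gamma M * rGamma a * rGamma b"
proof -
  define lam where "lam = Gamma M * rGamma a * rGamma b"
  define h where "h = (\<lambda>n. hyp_coeff a b c n - lam * (pochhammer M n / fact n))"
  define r where "r = (\<lambda>n. pochhammer (Re M) n / fact n)"
  define E where "E = exp (\<bar>Im M\<bar> * pi)"
  have r: "r n > 0" for n using M by (auto simp: r_def intro!: divide_pos_pos pochhammer_pos)
  have x1: "x k \<noteq> 1" for k using x(1)[of k] by auto
  have Q: "Q > 0"
  proof -
    have "0 < norm (1 - x 0)" using x1[of 0] by simp
    also note stolz[of 0]
    finally show ?thesis using x(1)[of 0] by (simp add: zero_less_mult_iff)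
  qed
  have lim: "(\<lambda>n. norm (h n) / r n) \<longlonglongrightarrow> 0"
    using hyp_coeff_comparison[of a b c] M unfolding h_def r_def lam_def M_def by simp
  have "(\<lambda>k. (1 - x k) powr M * hypergeo_reg a b c (x k) - lam) \<longlonglongrightarrow> 0"
  proof (rule LIMSEQ_I)
    fix e :: real assume e: "e > 0"
    \<comment> \<open>\<open>E\<close> will bound the phase of the power and
      \<open>Q powr Re M\<close> the effect of the Stolz condition, so that the tail contributes
      e/2.\<close>
    define \<eta> where "\<eta> = e / (2 * E * Q powr Re M)"
    have \<eta>: "\<eta> > 0" using e Q by (simp add: \<eta>_def E_def)
    obtain n0 where n0: "\<And>n. n \<ge> n0 \<Longrightarrow> norm (h n) / r n < \<eta>"
      using LIMSEQ_D[OF lim \<eta>] by (auto simp: r abs_of_nonneg less_imp_le)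
    define H where "H = (\<Sum>n<n0. norm (h n))"
    have bound: "norm ((1 - x k) powr M * hypergeo_reg a b c (x k) - lam) \<le> E * H * norm (1 - x k) powr Re M + e / 2" for k
    proof -
      define y where "y = x k"
      have y: "norm y < 1" "y \<noteq> 1" "norm (1 - y) \<le> Q * (1 - norm y)" using x(1) x1 stolz by (auto simp: y_def)
      have s: "(\<lambda>n. h n * y ^ n) sums (hypergeo_reg a b c y - lam * (1 - y) powr (-M))"
        using sums_diff[OF sums_hypergeo_reg[OF y(1), of a b c] sums_mult[OF binomial_series_pochhammer[OF y(1), of M], of lam]]
        by (simp add: h_def left_diff_distrib mult.assoc)
      have rs: "(\<lambda>n. r n * norm y ^ n) sums (1 - norm y) powr (- Re M)"
        unfolding r_def by (rule binomial_series_pochhammer_real) (use y in auto)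
      \<comment> \<open>The first \<open>n0\<close> terms have a sum bounded by \<open>H\<close>, to
        be annihilated by the vanishing factor |1 - y|^(Re M). All later terms are compared with
        \<eta> times the binomial series at |y|.\<close>
      let ?g = "\<lambda>n. (if n < n0 then norm (h n) else 0) + \<eta> * (r n * norm y ^ n)"
      have gs: "?g sums (H + \<eta> * (1 - norm y) powr (- Re M))"
      proof (intro sums_add sums_mult rs)
        show "(\<lambda>n. if n < n0 then norm (h n) else 0) sums H"
          using sums_If_finite_set[of "{..<n0}" "\<lambda>n. norm (h n)"] by (simp add: H_def)
      qed
      have "norm (h n * y ^ n) \<le> ?g n" for n
      proof (cases "n < n0")
        case True
        have "norm (h n * y ^ n) \<le> norm (h n) * 1"
          unfolding norm_mult norm_power by (intro mult_left_mono power_le_one) (use y in auto)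
        also have "\<dots> \<le> ?g n" using True \<eta> r[of n] by simp
        finally show ?thesis .
      next
        case False
        hence "norm (h n) \<le> \<eta> * r n" using n0[of n] r[of n] by (simp add: pos_divide_less_eq)
        hence "norm (h n) * norm y ^ n \<le> \<eta> * r n * norm y ^ n" by (intro mult_right_mono) auto
        thus ?thesis using False by (simp add: norm_mult norm_power mult.assoc)
      qed
      hence "norm (\<Sum>n. h n * y ^ n) \<le> (\<Sum>n. ?g n)"
        by (intro norm_suminf_le sums_summable[OF gs])
      hence nb: "norm (hypergeo_reg a b c y - lam * (1 - y) powr (-M)) \<le> H + \<eta> * (1 - norm y) powr (- Re M)"
        by (simp only: sums_unique[OF s, symmetric] sums_unique[OF gs, symmetric])
      have pw: "norm ((1 - y) powr M) \<le> E * norm (1 - y) powr Re M"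
        using norm_powr_complex_le[of "1 - y" M] by (simp add: E_def mult.commute)
      have "(1 - y) powr M * hypergeo_reg a b c y - lam = (1 - y) powr M * (hypergeo_reg a b c y - lam * (1 - y) powr (-M))"
      proof -
        have "(1 - y) powr M * (1 - y) powr (-M) = 1" using y by (simp flip: powr_add)
        thus ?thesis by (simp add: right_diff_distrib mult.left_commute)
      qed
      also have "norm \<dots> \<le> (E * norm (1 - y) powr Re M) * (H + \<eta> * (1 - norm y) powr (- Re M))"
        unfolding norm_mult by (intro mult_mono pw nb) (auto simp: E_def)
      also have "\<dots> = E * H * norm (1 - y) powr Re M + E * \<eta> * (norm (1 - y) powr Re M * (1 - norm y) powr (- Re M))"
        by (simp add: algebra_simps)
      \<comment> \<open>The point where the Stolz angle is needed: the series grows like a power of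
        1/(1 - |y|), while the factor in front decays only in |1 - y|.\<close>
      also have "norm (1 - y) powr Re M * (1 - norm y) powr (- Re M) \<le> Q powr Re M"
      proof -
        have "norm (1 - y) powr Re M \<le> (Q * (1 - norm y)) powr Re M" using y M by (intro powr_mono2) auto
        also have "\<dots> = Q powr Re M * (1 - norm y) powr Re M" by (rule powr_mult)
        finally show ?thesis using y by (simp add: powr_minus field_simps)
      qed
      also have "E * \<eta> * Q powr Re M = e / 2" using Q by (simp add: \<eta>_def E_def)
      finally show ?thesis using \<eta> by (simp add: y_def E_def mult_left_mono)
    qed
    have "(\<lambda>k. E * H * norm (1 - x k) powr Re M) \<longlonglongrightarrow> E * H * 0"
    proof (intro tendsto_mult tendsto_const)
      have "(\<lambda>k. norm (1 - x k)) \<longlonglongrightarrow> norm (1 - 1 :: complex)" by (intro tendsto_intros x)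
      hence "(\<lambda>k. norm (1 - x k)) \<longlonglongrightarrow> 0" by simp
      thus "(\<lambda>k. norm (1 - x k) powr Re M) \<longlonglongrightarrow> 0"
        by (rule tendsto_zero_powrI[OF _ tendsto_const]) (use M in auto)
    qed
    hence "\<forall>\<^sub>F k in sequentially. E * H * norm (1 - x k) powr Re M < e / 2"
      using e by (intro order_tendstoD(2)) auto
    then obtain k0 where k0: "\<And>k. k \<ge> k0 \<Longrightarrow> E * H * norm (1 - x k) powr Re M < e / 2"
      unfolding eventually_sequentially by blast
    show "\<exists>k0. \<forall>k\<ge>k0. norm ((1 - x k) powr M * hypergeo_reg a b c (x k) - lam - 0) < e"
    proof (intro exI[of _ k0] allI impI)
      fix k assume "k \<ge> k0"
      from k0[OF this] bound[of k] show "norm ((1 - x k) powr M * hypergeo_reg a b c (x k) - lam - 0) < e"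
        unfolding diff_zero by linarith
    qed
  qed
  thus ?thesis unfolding lam_def by (rule LIM_zero_cancel)
qed

section \<open>Connection formulas\<close>

text \<open>In the variable \<open>u = (1 - z) / 2\<close>, the functions \<open>(z - 1)\<close> to the power \<open>-\<mu>/2\<close> times \<open>(z + 1)\<close> to
  the power \<open>-\<mu>/2\<close> times a Legendre function of order \<open>\<mu>\<close> and degree \<open>\<nu>\<close> solve this equation, which is
  symmetric under \<open>u \<mapsto> 1 - u\<close>.\<close>

definition gegenbauer_sol ::
  "complex \<Rightarrow> complex \<Rightarrow> complex set \<Rightarrow> (complex \<Rightarrow> complex) \<Rightarrow> (complex \<Rightarrow> complex) \<Rightarrow> (complex \<Rightarrow> complex) \<Rightarrow> bool" where
  "gegenbauer_sol \<nu> \<mu> S f f1 f2 \<longleftrightarrow> (\<forall>u\<in>S. (f has_field_derivative f1 u) (at u) \<and> (f1 has_field_derivative f2 u) (at u) \<and>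
     u * (1 - u) * f2 u + (\<mu> + 1) * (1 - 2 * u) * f1 u = (\<mu> - \<nu>) * (\<mu> + \<nu> + 1) * f u)"

definition half_plane :: "real \<Rightarrow> complex set" where
  "half_plane s = {u. s * Im u > 0}"

lemma half_plane_props:
  shows "open (half_plane s)" "convex (half_plane s)" "u \<in> half_plane s \<Longrightarrow> Im u \<noteq> 0"
    "1 - u \<in> half_plane (-s) \<longleftrightarrow> u \<in> half_plane s"
proof -
  have eq: "half_plane s = Im -` {y. s * y > 0}" by (auto simp: half_plane_def)
  have "open {y::real. s * y > 0}" by (intro open_Collect_less continuous_intros)
  thus "open (half_plane s)" unfolding eq by (intro open_vimage continuous_intros) 
  have "half_plane s = {u. (s * \<i>) \<bullet> u > 0}" by (auto simp: half_plane_def inner_complex_def)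
  thus "convex (half_plane s)" using convex_halfspace_gt[of 0 "s * \<i>"] by simp
qed (auto simp: half_plane_def)

lemma half_plane_notin:
  assumes "u \<in> half_plane s"
  shows "u \<noteq> 0" "1 - u \<noteq> 0" "u \<notin> \<real>\<^sub>\<le>\<^sub>0" "1 - u \<notin> \<real>\<^sub>\<le>\<^sub>0" "u \<in> slit_plane" "1 - u \<in> slit_plane"
  using half_plane_props(3)[OF assms] by (auto simp: complex_nonpos_Reals_iff slit_plane_iff)

section \<open>The differential equation: Wronskian, reflection and change of gauge\<close>

lemma DERIV_one_minus: "((\<lambda>u::complex. 1 - u) has_field_derivative -1) (at u)"
  by (auto intro!: derivative_eq_intros)

lemma has_field_derivative_powr_div:
  fixes v c :: complex
  assumes "v \<notin> \<real>\<^sub>\<le>\<^sub>0"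
  shows "((\<lambda>v. v powr c) has_field_derivative c * v powr c / v) (at v)"
proof -
  have "v \<noteq> 0" using assms by auto
  have "((\<lambda>v. v powr c) has_field_derivative c * v powr (c - 1)) (at v)"
    by (rule has_field_derivative_powr[OF assms])
  thus ?thesis using \<open>v \<noteq> 0\<close> by (simp add: powr_diff)
qed

text \<open>Abel's identity: (u (1-u))^(\<mu>+1) is the integrating factor, because its logarithmic
  derivative (\<mu>+1)(1-2u)/(u(1-u)) is the coefficient of the first derivative in the normalised
  equation. A half plane is convex, so a vanishing derivative means a constant.\<close>

lemma gegenbauer_wronskian:
  assumes f: "gegenbauer_sol \<nu> \<mu> (half_plane s) f f1 f2" and g: "gegenbauer_sol \<nu> \<mu> (half_plane s) g g1 g2"
  shows "\<exists>c. \<forall>u\<in>half_plane s. (f u * g1 u - f1 u * g u) * (u powr (\<mu> + 1) * (1 - u) powr (\<mu> + 1)) = c"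
proof -
  let ?p = "\<lambda>u. u powr (\<mu> + 1) * (1 - u) powr (\<mu> + 1)"
  have D: "((\<lambda>u. (f u * g1 u - f1 u * g u) * ?p u) has_field_derivative 0) (at u)" if u: "u \<in> half_plane s" for u
  proof -
    note n = half_plane_notin[OF u]
    have d: "(f has_field_derivative f1 u) (at u)" "(f1 has_field_derivative f2 u) (at u)"
      "(g has_field_derivative g1 u) (at u)" "(g1 has_field_derivative g2 u) (at u)"
      and e: "u * (1 - u) * f2 u + (\<mu> + 1) * (1 - 2 * u) * f1 u = (\<mu> - \<nu>) * (\<mu> + \<nu> + 1) * f u"
      "u * (1 - u) * g2 u + (\<mu> + 1) * (1 - 2 * u) * g1 u = (\<mu> - \<nu>) * (\<mu> + \<nu> + 1) * g u"
      using f g u by (auto simp: gegenbauer_sol_def)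
    have W: "((\<lambda>u. f u * g1 u - f1 u * g u) has_field_derivative f u * g2 u - f2 u * g u) (at u)"
      by (auto intro!: derivative_eq_intros d)
    have p1: "((\<lambda>u. u powr (\<mu> + 1)) has_field_derivative (\<mu> + 1) * u powr (\<mu> + 1) / u) (at u)"
      by (rule has_field_derivative_powr_div[OF n(3)])
    have p2: "((\<lambda>u. (1 - u) powr (\<mu> + 1)) has_field_derivative - ((\<mu> + 1) * (1 - u) powr (\<mu> + 1) / (1 - u))) (at u)"
      using DERIV_chain2[OF has_field_derivative_powr_div[OF n(4)] DERIV_one_minus] by simp
    define a b where "a = u powr (\<mu> + 1)" and "b = (1 - u) powr (\<mu> + 1)"
    have P: "(?p has_field_derivative (\<mu> + 1) * (1 - 2 * u) / (u * (1 - u)) * (a * b)) (at u)"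
    proof -
      have "(?p has_field_derivative (\<mu> + 1) * a / u * b + a * (- ((\<mu> + 1) * b / (1 - u)))) (at u)"
        unfolding a_def b_def using DERIV_mult[OF p1 p2] by (simp add: mult_ac add_ac)
      moreover have "(\<mu> + 1) * a / u * b + a * (- ((\<mu> + 1) * b / (1 - u))) = (\<mu> + 1) * (1 - 2 * u) / (u * (1 - u)) * (a * b)"
        using n by (simp add: field_simps)
      ultimately show ?thesis by simp
    qed
    have z: "f u * g2 u - f2 u * g u = - ((\<mu> + 1) * (1 - 2 * u) / (u * (1 - u)) * (f u * g1 u - f1 u * g u))"
    proof -
      have "u * (1 - u) * (f u * g2 u - f2 u * g u) = f u * (u * (1 - u) * g2 u) - g u * (u * (1 - u) * f2 u)"
        by (simp add: algebra_simps)
      also have "\<dots> = f u * ((\<mu> - \<nu>) * (\<mu> + \<nu> + 1) * g u - (\<mu> + 1) * (1 - 2 * u) * g1 u)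
          - g u * ((\<mu> - \<nu>) * (\<mu> + \<nu> + 1) * f u - (\<mu> + 1) * (1 - 2 * u) * f1 u)"
        by (simp only: e[symmetric] add_diff_cancel_right')
      also have "\<dots> = - ((\<mu> + 1) * (1 - 2 * u) * (f u * g1 u - f1 u * g u))" by (simp add: algebra_simps)
      finally have "u * (1 - u) * (f u * g2 u - f2 u * g u) = - ((\<mu> + 1) * (1 - 2 * u) * (f u * g1 u - f1 u * g u))" .
      moreover have "u * (1 - u) \<noteq> 0" using n by simp
      ultimately show ?thesis
        by (metis (no_types) nonzero_mult_div_cancel_left times_divide_eq_left minus_divide_left)
    qed
    define q where "q = (\<mu> + 1) * (1 - 2 * u) / (u * (1 - u))"
    show ?thesis using DERIV_mult[OF W P] unfolding z a_def[symmetric] b_def[symmetric] q_def[symmetric] by (simp add: mult_ac)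
  qed
  show ?thesis
    by (rule has_field_derivative_zero_constant[OF half_plane_props(2)]) (rule has_field_derivative_at_within[OF D])
qed

lemma gegenbauer_sol_reflect:
  assumes "gegenbauer_sol \<nu> \<mu> (half_plane (-s)) f f1 f2"
  shows "gegenbauer_sol \<nu> \<mu> (half_plane s) (\<lambda>u. f (1 - u)) (\<lambda>u. - f1 (1 - u)) (\<lambda>u. f2 (1 - u))"
  unfolding gegenbauer_sol_def
proof (intro ballI conjI)
  fix u assume "u \<in> half_plane s"
  hence u: "1 - u \<in> half_plane (-s)" using half_plane_props(4) by simp
  have d: "(f has_field_derivative f1 (1 - u)) (at (1 - u))" "(f1 has_field_derivative f2 (1 - u)) (at (1 - u))"
    and e: "(1 - u) * (1 - (1 - u)) * f2 (1 - u) + (\<mu> + 1) * (1 - 2 * (1 - u)) * f1 (1 - u) = (\<mu> - \<nu>) * (\<mu> + \<nu> + 1) * f (1 - u)"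
    using assms u by (auto simp: gegenbauer_sol_def)
  show "((\<lambda>u. f (1 - u)) has_field_derivative - f1 (1 - u)) (at u)" using DERIV_chain2[OF d(1) DERIV_one_minus] by simp
  show "((\<lambda>u. - f1 (1 - u)) has_field_derivative f2 (1 - u)) (at u)" using DERIV_minus[OF DERIV_chain2[OF d(2) DERIV_one_minus]] by simp
  show "u * (1 - u) * f2 (1 - u) + (\<mu> + 1) * (1 - 2 * u) * - f1 (1 - u) = (\<mu> - \<nu>) * (\<mu> + \<nu> + 1) * f (1 - u)"
    unfolding e[symmetric] by (simp add: algebra_simps)
qed

text \<open>The factor u^(-\<mu>) turns the hypergeometric equation with parameters \<nu>+1, -\<nu>,
  1-\<mu> into the symmetric equation. It serves P directly, and G as well, since reflection in u
  replaces the third parameter 1-\<mu> by 1+\<mu>.\<close>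

lemma gegenbauer_sol_gauge:
  assumes H: "\<And>u. u \<in> half_plane s \<Longrightarrow> (h has_field_derivative h1 u) (at u)"
      "\<And>u. u \<in> half_plane s \<Longrightarrow> (h1 has_field_derivative h2 u) (at u)"
    and e: "\<And>u. u \<in> half_plane s \<Longrightarrow> u * (1 - u) * h2 u + (1 - \<mu> - 2 * u) * h1 u + \<nu> * (\<nu> + 1) * h u = 0"
  shows "gegenbauer_sol \<nu> \<mu> (half_plane s) (\<lambda>u. u powr (-\<mu>) * h u) (\<lambda>u. u powr (-\<mu>) * (h1 u - \<mu> * h u / u))
    (\<lambda>u. u powr (-\<mu>) * (h2 u - 2 * \<mu> * h1 u / u + \<mu> * (\<mu> + 1) * h u / u\<^sup>2))"
  unfolding gegenbauer_sol_def
proof (intro ballI conjI)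
  fix u assume u: "u \<in> half_plane s"
  note n = half_plane_notin[OF u]
  have p: "((\<lambda>u. u powr (-\<mu>)) has_field_derivative - \<mu> * u powr (-\<mu>) / u) (at u)"
    by (rule has_field_derivative_powr_div[OF n(3)])
  define a where "a = u powr (-\<mu>)"
  note p' = p[folded a_def]
  have "((\<lambda>u. u powr (-\<mu>) * h u) has_field_derivative - \<mu> * a / u * h u + h1 u * a) (at u)"
    using DERIV_mult[OF p' H(1)[OF u]] by (simp add: a_def)
  moreover have "- \<mu> * a / u * h u + h1 u * a = a * (h1 u - \<mu> * h u / u)" by (simp add: algebra_simps)
  ultimately show "((\<lambda>u. u powr (-\<mu>) * h u) has_field_derivative u powr (-\<mu>) * (h1 u - \<mu> * h u / u)) (at u)"
    by (simp add: a_def)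
  have q: "((\<lambda>u. h1 u - \<mu> * h u / u) has_field_derivative h2 u - (\<mu> * h1 u * u - \<mu> * h u * 1) / (u * u)) (at u)"
    using n by (intro DERIV_diff H[OF u] DERIV_divide DERIV_cmult DERIV_ident)
  have "((\<lambda>u. u powr (-\<mu>) * (h1 u - \<mu> * h u / u)) has_field_derivative
      - \<mu> * a / u * (h1 u - \<mu> * h u / u) + (h2 u - (\<mu> * h1 u * u - \<mu> * h u * 1) / (u * u)) * a) (at u)"
    using DERIV_mult[OF p' q] by (simp add: a_def)
  moreover have "- \<mu> * a / u * (h1 u - \<mu> * h u / u) + (h2 u - (\<mu> * h1 u * u - \<mu> * h u * 1) / (u * u)) * a
     = a * (h2 u - 2 * \<mu> * h1 u / u + \<mu> * (\<mu> + 1) * h u / u\<^sup>2)"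
    using n by (simp add: field_simps power2_eq_square)
  ultimately show "((\<lambda>u. u powr (-\<mu>) * (h1 u - \<mu> * h u / u)) has_field_derivative
      u powr (-\<mu>) * (h2 u - 2 * \<mu> * h1 u / u + \<mu> * (\<mu> + 1) * h u / u\<^sup>2)) (at u)"
    by (simp add: a_def)
  have "u * (1 - u) * (h2 u - 2 * \<mu> * h1 u / u + \<mu> * (\<mu> + 1) * h u / u\<^sup>2) + (\<mu> + 1) * (1 - 2 * u) * (h1 u - \<mu> * h u / u)
     = (u * (1 - u) * h2 u + (1 - \<mu> - 2 * u) * h1 u + \<nu> * (\<nu> + 1) * h u) + (\<mu> - \<nu>) * (\<mu> + \<nu> + 1) * h u"
    using n by (simp add: field_simps power2_eq_square)
  hence "u * (1 - u) * (h2 u - 2 * \<mu> * h1 u / u + \<mu> * (\<mu> + 1) * h u / u\<^sup>2) + (\<mu> + 1) * (1 - 2 * u) * (h1 u - \<mu> * h u / u)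
     = (\<mu> - \<nu>) * (\<mu> + \<nu> + 1) * h u" using e[OF u] by simp
  from arg_cong[OF this, of "\<lambda>x. a * x"]
  show "u * (1 - u) * (u powr (-\<mu>) * (h2 u - 2 * \<mu> * h1 u / u + \<mu> * (\<mu> + 1) * h u / u\<^sup>2)) +
    (\<mu> + 1) * (1 - 2 * u) * (u powr (-\<mu>) * (h1 u - \<mu> * h u / u)) = (\<mu> - \<nu>) * (\<mu> + \<nu> + 1) * (u powr (-\<mu>) * h u)"
    unfolding a_def[symmetric] by (simp only: ring_distribs mult_ac)
qed

lemma legendre_hypergeo_ode:
  fixes \<nu> c u :: complex
  assumes "u \<in> slit_plane"
  defines "h1 \<equiv> \<lambda>u. (\<nu> + 1) * (-\<nu>) * hypergeo_reg (\<nu> + 2) (-\<nu> + 1) (c + 1) u"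
  defines "h2 \<equiv> \<lambda>u. (\<nu> + 1) * (-\<nu>) * ((\<nu> + 2) * (-\<nu> + 1) * hypergeo_reg (\<nu> + 3) (-\<nu> + 2) (c + 2) u)"
  shows "(hypergeo_reg (\<nu> + 1) (-\<nu>) c has_field_derivative h1 u) (at u)"
    "(h1 has_field_derivative h2 u) (at u)"
    "u * (1 - u) * h2 u + (c - 2 * u) * h1 u + \<nu> * (\<nu> + 1) * hypergeo_reg (\<nu> + 1) (-\<nu>) c u = 0"
proof -
  have e: "\<nu> + 1 + 1 = \<nu> + 2" "\<nu> + 2 + 1 = \<nu> + 3" "-\<nu> + 1 + 1 = -\<nu> + 2" "c + 1 + 1 = c + 2" "\<nu> + 1 + 2 = \<nu> + 3" by auto
  show "(hypergeo_reg (\<nu> + 1) (-\<nu>) c has_field_derivative h1 u) (at u)"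
    using has_field_derivative_hypergeo_reg[OF assms(1), of "\<nu> + 1" "-\<nu>" c] unfolding h1_def e .
  show "(h1 has_field_derivative h2 u) (at u)"
    using DERIV_cmult[OF has_field_derivative_hypergeo_reg[OF assms(1), of "\<nu> + 2" "-\<nu> + 1" "c + 1"]] unfolding h1_def h2_def e .
  have o: "u * (1 - u) * ((\<nu> + 2) * (-\<nu> + 1) * hypergeo_reg (\<nu> + 3) (-\<nu> + 2) (c + 2) u)
      + (c - (\<nu> + 1 + - \<nu> + 1) * u) * hypergeo_reg (\<nu> + 2) (-\<nu> + 1) (c + 1) u = hypergeo_reg (\<nu> + 1) (-\<nu>) c u"
    using hypergeo_reg_ode[OF assms(1), of "\<nu> + 1" "-\<nu>" c] unfolding e by simp
  show "u * (1 - u) * h2 u + (c - 2 * u) * h1 u + \<nu> * (\<nu> + 1) * hypergeo_reg (\<nu> + 1) (-\<nu>) c u = 0"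
    unfolding o[symmetric] h1_def h2_def by (simp add: algebra_simps)
qed

lemma legendre_P_sol:
  "\<exists>f1 f2. gegenbauer_sol \<nu> \<mu> (half_plane s) (\<lambda>u. u powr (-\<mu>) * hypergeo_reg (\<nu> + 1) (-\<nu>) (1 - \<mu>) u) f1 f2"
proof -
  note L = legendre_hypergeo_ode[OF half_plane_notin(5), of _ s \<nu> "1 - \<mu>"]
  show ?thesis by (intro exI, rule gegenbauer_sol_gauge, erule L(1), erule L(2)) (rule L(3))
qed

lemma legendre_G_sol:
  "\<exists>f1 f2. gegenbauer_sol \<nu> \<mu> (half_plane s) (\<lambda>u. u powr (-\<mu>) * legendre_G \<nu> \<mu> u) f1 f2"
proof -
  define K where "K = Gamma (\<nu> + \<mu> + 1) * Gamma (\<mu> - \<nu>)"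
  define h where "h = hypergeo_reg (\<nu> + 1) (-\<nu>) (1 + \<mu>)"
  define h1 where "h1 = (\<lambda>u. (\<nu> + 1) * (-\<nu>) * hypergeo_reg (\<nu> + 2) (-\<nu> + 1) (1 + \<mu> + 1) u)"
  define h2 where "h2 = (\<lambda>u. (\<nu> + 1) * (-\<nu>) * ((\<nu> + 2) * (-\<nu> + 1) * hypergeo_reg (\<nu> + 3) (-\<nu> + 2) (1 + \<mu> + 2) u))"
  have G: "legendre_G \<nu> \<mu> = (\<lambda>u. K * h (1 - u))" by (simp add: fun_eq_iff legendre_G_def K_def h_def)
  have "gegenbauer_sol \<nu> \<mu> (half_plane s) (\<lambda>u. u powr (-\<mu>) * legendre_G \<nu> \<mu> u)
     (\<lambda>u. u powr (-\<mu>) * (- K * h1 (1 - u) - \<mu> * legendre_G \<nu> \<mu> u / u))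
     (\<lambda>u. u powr (-\<mu>) * (K * h2 (1 - u) - 2 * \<mu> * (- K * h1 (1 - u)) / u + \<mu> * (\<mu> + 1) * legendre_G \<nu> \<mu> u / u\<^sup>2))"
  proof (rule gegenbauer_sol_gauge)
    fix u assume u: "u \<in> half_plane s"
    have L: "(h has_field_derivative h1 (1 - u)) (at (1 - u))" "(h1 has_field_derivative h2 (1 - u)) (at (1 - u))"
      "(1 - u) * (1 - (1 - u)) * h2 (1 - u) + (1 + \<mu> - 2 * (1 - u)) * h1 (1 - u) + \<nu> * (\<nu> + 1) * h (1 - u) = 0"
      unfolding h_def h1_def h2_def by (rule legendre_hypergeo_ode[OF half_plane_notin(6)[OF u]])+
    show "(legendre_G \<nu> \<mu> has_field_derivative - K * h1 (1 - u)) (at u)"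
      unfolding G using DERIV_cmult[OF DERIV_chain2[OF L(1) DERIV_one_minus], of K] by simp
    show "((\<lambda>u. - K * h1 (1 - u)) has_field_derivative K * h2 (1 - u)) (at u)"
      using DERIV_cmult[OF DERIV_chain2[OF L(2) DERIV_one_minus], of "- K"] by simp
    have "u * (1 - u) * (K * h2 (1 - u)) + (1 - \<mu> - 2 * u) * (- K * h1 (1 - u)) + \<nu> * (\<nu> + 1) * (K * h (1 - u))
       = K * ((1 - u) * (1 - (1 - u)) * h2 (1 - u) + (1 + \<mu> - 2 * (1 - u)) * h1 (1 - u) + \<nu> * (\<nu> + 1) * h (1 - u))"
      by (simp add: algebra_simps)
    thus "u * (1 - u) * (K * h2 (1 - u)) + (1 - \<mu> - 2 * u) * (- K * h1 (1 - u)) + \<nu> * (\<nu> + 1) * legendre_G \<nu> \<mu> u = 0"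
      unfolding G by (simp only: L(3) mult_zero_right)
  qed
  thus ?thesis by blast
qed

section \<open>Connection constants from the behaviour at 0 and 1\<close>

lemma tendsto_powr_zero:
  fixes u :: "nat \<Rightarrow> complex"
  assumes "u \<longlonglongrightarrow> 0" "Re \<mu> > 0"
  shows "(\<lambda>n. u n powr \<mu>) \<longlonglongrightarrow> 0"
proof (rule Lim_null_comparison)
  show "(\<lambda>n. norm (u n) powr Re \<mu> * exp (\<bar>Im \<mu>\<bar> * pi)) \<longlonglongrightarrow> 0"
  proof (rule tendsto_mult_left_zero)
    show "(\<lambda>n. norm (u n) powr Re \<mu>) \<longlonglongrightarrow> 0"
      by (rule tendsto_zero_powrI[OF tendsto_norm_zero[OF assms(1)] tendsto_const]) (use assms(2) in auto)
  qed
  show "\<forall>\<^sub>F n in sequentially. norm (u n powr \<mu>) \<le> norm (u n) powr Re \<mu> * exp (\<bar>Im \<mu>\<bar> * pi)"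
    by (simp add: norm_powr_complex_le)
qed

lemma half_plane_seq_exists: "s \<noteq> 0 \<Longrightarrow> \<exists>u. (\<forall>n. u n \<in> half_plane s) \<and> u \<longlonglongrightarrow> 0"
proof (intro exI[of _ "\<lambda>n. \<i> * of_real (s / of_nat (Suc n))"] conjI allI)
  assume "s \<noteq> 0"
  thus "\<i> * of_real (s / of_nat (Suc n)) \<in> half_plane s" for n
    by (auto simp: half_plane_def zero_less_mult_iff divide_less_0_iff zero_less_divide_iff)
  have "(\<lambda>n. s * inverse (of_nat (Suc n))) \<longlonglongrightarrow> s * 0" by (intro tendsto_intros LIMSEQ_inverse_real_of_nat)
  from tendsto_of_real[OF this, where 'a=complex]
  have "(\<lambda>n. \<i> * of_real (s * inverse (of_nat (Suc n)))) \<longlonglongrightarrow> \<i> * of_real (s * 0)"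
    by (intro tendsto_mult tendsto_const)
  thus "(\<lambda>n. \<i> * of_real (s / of_nat (Suc n))) \<longlonglongrightarrow> 0" by (simp add: divide_inverse)
qed

text \<open>The basis consists of B = u^(-\<mu>) G(u), of size u^(-\<mu>) at 0 and regular at 1, and
  its mirror image A. Multiplying by u^\<mu> makes A vanish at 0 and sends B to Gamma(\<mu>), so
  \<open>l0\<close> is Gamma(\<mu>) times the coefficient of B; \<open>l1\<close> does the same for
  A at 1. The limit of G is assumed along all nonreal sequences because reflection moves to the
  opposite half plane.\<close>

theorem gegenbauer_connection:
  assumes s: "s \<noteq> 0" and \<mu>: "Re \<mu> > 0" "Re (\<mu> - \<nu>) > 0" "Re (\<nu> + \<mu> + 1) > 0"
    and G0: "\<And>u. (\<And>n::nat. Im (u n) \<noteq> 0) \<Longrightarrow> u \<longlonglongrightarrow> 0 \<Longrightarrow> (\<lambda>n. legendre_G \<nu> \<mu> (u n)) \<longlonglongrightarrow> Gamma \<mu>"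
    and f: "gegenbauer_sol \<nu> \<mu> (half_plane s) f f1 f2"
    and U0: "\<And>n. U0 n \<in> half_plane s" "U0 \<longlonglongrightarrow> 0" "(\<lambda>n. U0 n powr \<mu> * f (U0 n)) \<longlonglongrightarrow> l0"
    and U1: "\<And>n. U1 n \<in> half_plane s" "U1 \<longlonglongrightarrow> 1" "(\<lambda>n. (1 - U1 n) powr \<mu> * f (U1 n)) \<longlonglongrightarrow> l1"
    and u: "u \<in> half_plane s"
  shows "Gamma \<mu> * f u = l0 * (u powr (-\<mu>) * legendre_G \<nu> \<mu> u) + l1 * ((1 - u) powr (-\<mu>) * legendre_G \<nu> \<mu> (1 - u))"
proof -
  define B where "B = (\<lambda>u. u powr (-\<mu>) * legendre_G \<nu> \<mu> u)"
  define A where "A = (\<lambda>u. B (1 - u))"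
  obtain B1 B2 where B: "gegenbauer_sol \<nu> \<mu> (half_plane s) B B1 B2" using legendre_G_sol unfolding B_def by blast
  obtain A1 A2 where A: "gegenbauer_sol \<nu> \<mu> (half_plane s) A A1 A2"
    using legendre_G_sol[of \<nu> \<mu> "-s"] gegenbauer_sol_reflect unfolding A_def B_def by blast
  note Gm = Gamma_rGamma_Re_pos(1)[OF \<mu>(1)]
  have inv: "u powr \<mu> * u powr (-\<mu>) = 1" if "u \<noteq> 0" for u using that by (simp flip: powr_add)
  define a0 where "a0 = Gamma (\<nu> + \<mu> + 1) * Gamma (\<mu> - \<nu>) * rGamma (1 + \<mu>)"
  have a0: "a0 \<noteq> 0"
    using Re_pos_not_nonpos_Int[OF \<mu>(2)] Re_pos_not_nonpos_Int[OF \<mu>(3)] Re_pos_not_nonpos_Int[of "1 + \<mu>"] \<mu>(1)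
    by (auto simp: a0_def Gamma_eq_zero_iff rGamma_eq_zero_iff)
  have contA: "isCont B 1"
  proof -
    have "1 - 1 \<in> slit_plane" by (simp add: slit_plane_iff)
    from DERIV_isCont[OF DERIV_chain2[OF has_field_derivative_hypergeo_reg[OF this] DERIV_one_minus]]
    have "isCont (\<lambda>u. hypergeo_reg (\<nu> + 1) (-\<nu>) (1 + \<mu>) (1 - u)) 1" .
    thus ?thesis unfolding B_def legendre_G_def by (intro continuous_intros) auto
  qed
  have B1v: "B 1 = a0"
    by (simp add: B_def legendre_G_def a0_def hypergeo_reg_at_0)
  have A0: "(\<lambda>n. A (v n)) \<longlonglongrightarrow> a0" if "v \<longlonglongrightarrow> 0" for v :: "nat \<Rightarrow> complex"
    unfolding A_def B1v[symmetric]
    by (rule isCont_tendsto_compose[OF contA]) (use tendsto_diff[OF tendsto_const[of 1] that] in simp)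
  have vA: "(\<lambda>n. v n powr \<mu> * A (v n)) \<longlonglongrightarrow> 0" if "v \<longlonglongrightarrow> 0" for v :: "nat \<Rightarrow> complex"
    using tendsto_mult[OF tendsto_powr_zero[OF that \<mu>(1)] A0[OF that]] by simp
  have vB: "(\<lambda>n. v n powr \<mu> * B (v n)) \<longlonglongrightarrow> Gamma \<mu>" if "v \<longlonglongrightarrow> 0" "\<And>n. v n \<in> half_plane s'" for v :: "nat \<Rightarrow> complex" and s'
  proof -
    have "v n powr \<mu> * B (v n) = legendre_G \<nu> \<mu> (v n)" for n
      using inv[OF half_plane_notin(1)[OF that(2)]] by (simp add: B_def flip: mult.assoc)
    moreover have "(\<lambda>n. legendre_G \<nu> \<mu> (v n)) \<longlonglongrightarrow> Gamma \<mu>"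
      by (rule G0[OF half_plane_props(3)[OF that(2)] that(1)])
    ultimately show ?thesis by simp
  qed
  obtain c1 where c1: "\<And>u. u \<in> half_plane s \<Longrightarrow> (f u * A1 u - f1 u * A u) * (u powr (\<mu> + 1) * (1 - u) powr (\<mu> + 1)) = c1"
    using gegenbauer_wronskian[OF f A] by blast
  obtain c2 where c2: "\<And>u. u \<in> half_plane s \<Longrightarrow> (f u * B1 u - f1 u * B u) * (u powr (\<mu> + 1) * (1 - u) powr (\<mu> + 1)) = c2"
    using gegenbauer_wronskian[OF f B] by blast
  obtain c3 where c3: "\<And>u. u \<in> half_plane s \<Longrightarrow> (A u * B1 u - A1 u * B u) * (u powr (\<mu> + 1) * (1 - u) powr (\<mu> + 1)) = c3"
    using gegenbauer_wronskian[OF A B] by blast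
  \<comment> \<open>Cramer's rule with Wronskians: a purely algebraic identity among f, A, B and
    their first derivatives, so linear dependence follows as soon as \<open>c3\<close> is
    nonzero.\<close>
  have id: "c3 * f u = c2 * A u - c1 * B u" if "u \<in> half_plane s" for u
    unfolding c1[OF that, symmetric] c2[OF that, symmetric] c3[OF that, symmetric] by (simp add: algebra_simps)
  have c3nz: "c3 \<noteq> 0"
    \<comment> \<open>otherwise \<open>B\<close> is a multiple of \<open>A\<close> near \<open>0\<close>, but \<open>A\<close> is bounded there and \<open>B\<close> is not\<close>
  proof
    assume "c3 = 0"
    hence W0: "A u * B1 u - A1 u * B u = 0" if "u \<in> half_plane s" for u
      using c3[OF that] half_plane_notin[OF that] by simp
    have "isCont A 0" unfolding A_def by (rule isCont_o2[of _ "\<lambda>u. 1 - u"]) (use contA in auto)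
    moreover have "A 0 \<noteq> 0" using B1v a0 by (simp add: A_def)
    ultimately obtain e where e: "e > 0" "\<And>v. dist v 0 < e \<Longrightarrow> A v \<noteq> 0"
      using continuous_at_avoid[of 0 A 0] by (auto simp: dist_commute)
    define S where "S = half_plane s \<inter> ball 0 e"
    have "\<exists>c. \<forall>v\<in>S. B v / A v = c"
    proof (rule has_field_derivative_zero_constant)
      show "convex S" unfolding S_def by (intro convex_Int half_plane_props) auto
      fix v assume v: "v \<in> S"
      have d: "(A has_field_derivative A1 v) (at v)" "(B has_field_derivative B1 v) (at v)" "A v \<noteq> 0"
        using A B v e by (auto simp: gegenbauer_sol_def S_def)
      have "((\<lambda>v. B v / A v) has_field_derivative (B1 v * A v - B v * A1 v) / (A v * A v)) (at v)"
        by (rule DERIV_divide[OF d(2,1,3)])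
      moreover have "B1 v * A v - B v * A1 v = 0" using W0[of v] v by (simp add: S_def algebra_simps)
      ultimately show "((\<lambda>v. B v / A v) has_field_derivative 0) (at v within S)"
        by (simp add: has_field_derivative_at_within)
    qed
    then obtain \<kappa> where \<kappa>: "\<And>v. v \<in> S \<Longrightarrow> B v / A v = \<kappa>" by blast
    obtain v where v: "\<And>n. v n \<in> half_plane s" "v \<longlonglongrightarrow> 0" using half_plane_seq_exists[OF s] by blast
    have "\<forall>\<^sub>F n in sequentially. v n \<in> ball 0 e"
      using tendstoD[OF v(2) e(1)] by (simp add: dist_commute)
    hence "\<forall>\<^sub>F n in sequentially. \<kappa> * (v n powr \<mu> * A (v n)) = v n powr \<mu> * B (v n)"
    proof eventually_elim
      case (elim n)
      hence "B (v n) = \<kappa> * A (v n)" using \<kappa>[of "v n"] v(1)[of n] e(2)[of "v n"] by (auto simp: S_def field_simps)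
      thus ?case by simp
    qed
    hence "(\<lambda>n. v n powr \<mu> * B (v n)) \<longlonglongrightarrow> 0"
      using tendsto_mult[OF tendsto_const[of \<kappa>] vA[OF v(2)]] by (auto intro: Lim_transform_eventually)
    thus False using LIMSEQ_unique[OF vB[OF v(2,1)]] Gm by auto
  qed
  define \<alpha> \<beta> where "\<alpha> = - c1 / c3" and "\<beta> = c2 / c3"
  have rep: "f u = \<alpha> * B u + \<beta> * A u" if "u \<in> half_plane s" for u
    using id[OF that] c3nz by (simp add: \<alpha>_def \<beta>_def field_simps)
  have "(\<lambda>n. \<alpha> * (U0 n powr \<mu> * B (U0 n)) + \<beta> * (U0 n powr \<mu> * A (U0 n))) \<longlonglongrightarrow> \<alpha> * Gamma \<mu> + \<beta> * 0"
    by (intro tendsto_intros vA vB[of _ s] U0)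
  hence "(\<lambda>n. U0 n powr \<mu> * f (U0 n)) \<longlonglongrightarrow> \<alpha> * Gamma \<mu>"
    unfolding rep[OF U0(1)] by (simp add: algebra_simps)
  hence l0: "l0 = \<alpha> * Gamma \<mu>" using LIMSEQ_unique U0(3) by blast
  \<comment> \<open>Reflection brings the point 1 to 0, interchanges A and B, and leads into the
    half plane with the opposite sign.\<close>
  define V where "V = (\<lambda>n. 1 - U1 n)"
  have V: "V \<longlonglongrightarrow> 0" "\<And>n. V n \<in> half_plane (-s)"
    using tendsto_diff[OF tendsto_const[of 1] U1(2)] U1(1) half_plane_props(4) by (auto simp: V_def)
  have VA: "A (U1 n) = B (V n)" "B (U1 n) = A (V n)" for n by (auto simp: A_def V_def)
  have "(\<lambda>n. \<alpha> * (V n powr \<mu> * A (V n)) + \<beta> * (V n powr \<mu> * B (V n))) \<longlonglongrightarrow> \<alpha> * 0 + \<beta> * Gamma \<mu>"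
    by (intro tendsto_intros vA vB[of _ "-s"] V)
  hence "(\<lambda>n. (1 - U1 n) powr \<mu> * f (U1 n)) \<longlonglongrightarrow> \<beta> * Gamma \<mu>"
    unfolding rep[OF U1(1)] VA V_def[symmetric] by (simp add: V_def algebra_simps)
  hence l1: "l1 = \<beta> * Gamma \<mu>" using LIMSEQ_unique U1(3) by blast
  show ?thesis using rep[OF u] by (simp add: l0 l1 A_def B_def algebra_simps)
qed

section \<open>The Q series as a solution\<close>

lemma Ln_minus_half_plane:
  assumes "u \<in> half_plane s" "s = 1 \<or> s = -1"
  shows "Ln (-u) = Ln u - of_real (s * pi) * \<i>"
  using assms Ln_minus[OF half_plane_notin(1)[OF assms(1)]] by (auto simp: half_plane_def mult.commute)

text \<open>Up to a constant this is \<open>Q\<close> divided by \<open>(z - 1)\<close> to the power \<open>\<mu>/2\<close> and \<open>(z + 1)\<close> to the power \<open>\<mu>/2\<close>,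
  at \<open>z = 1 - 2 u\<close>.\<close>

definition legendre_Q_series :: "complex \<Rightarrow> complex \<Rightarrow> complex \<Rightarrow> complex" where
  "legendre_Q_series \<nu> \<mu> u = (1 - 2 * u) powr (- (\<nu> + \<mu> + 1)) *
     hypergeo_reg ((\<nu> + \<mu> + 2) / 2) ((\<nu> + \<mu> + 1) / 2) (\<nu> + 3 / 2) (1 / (1 - 2 * u)\<^sup>2)"

lemma inverse_square_slit_plane:
  assumes "Im z \<noteq> 0"
  shows "1 / z\<^sup>2 \<in> slit_plane"
proof (rule ccontr)
  assume "1 / z\<^sup>2 \<notin> slit_plane"
  then obtain r where r: "1 / z\<^sup>2 = complex_of_real r" "r \<ge> 1" by (auto simp: slit_plane_def)
  have "z \<noteq> 0" using assms by auto
  hence "z\<^sup>2 = complex_of_real (1 / r)" using r by (simp add: field_simps)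
  also have "\<dots> = (complex_of_real (sqrt (1 / r)))\<^sup>2" using r by (simp flip: of_real_power)
  finally have "z = complex_of_real (sqrt (1 / r)) \<or> z = - complex_of_real (sqrt (1 / r))" by (simp only: power2_eq_iff)
  thus False using assms by auto
qed

text \<open>In z = 1 - 2u the equation reads (1-z^2) v'' - 2(\<mu>+1) z v' =
  (\<mu>-\<nu>)(\<mu>+\<nu>+1) v. The substitution x = 1/z^2 with the factor z^(-\<sigma>), \<sigma>
  = \<nu>+\<mu>+1, reduces it to a hypergeometric equation; 4ab = \<sigma>(\<sigma>+1) is the
  relation that makes the parameters fit. Off the real z-axis x avoids the slit.\<close>

lemma legendre_Q_sol: "\<exists>f1 f2. gegenbauer_sol \<nu> \<mu> (half_plane s) (legendre_Q_series \<nu> \<mu>) f1 f2"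
proof -
  define \<sigma> where "\<sigma> = \<nu> + \<mu> + 1"
  define a b c where "a = (\<nu> + \<mu> + 2) / 2" and "b = (\<nu> + \<mu> + 1) / 2" and "c = \<nu> + 3 / 2"
  have ab: "4 * (a * b) = \<sigma> * (\<sigma> + 1)" "a + b + 1 = \<sigma> + 3/2" "2 * c = 2 * \<nu> + 3" by (simp_all add: a_def b_def c_def \<sigma>_def field_simps)
  define F F1 F2 where "F = hypergeo_reg a b c" and "F1 = (\<lambda>x. a * b * hypergeo_reg (a + 1) (b + 1) (c + 1) x)"
    and "F2 = (\<lambda>x. a * b * ((a + 1) * (b + 1) * hypergeo_reg (a + 2) (b + 2) (c + 2) x))"
  \<comment> \<open>First and second z-derivatives of z^(-\<sigma>) F(x). Since dx/dz = -2x/z, each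
    differentiation produces a factor 1/z and otherwise a combination of \<open>F\<close>,
    \<open>F1\<close>, \<open>F2\<close> with coefficients polynomial in x.\<close>
  define v1 v2 where "v1 = (\<lambda>z. z powr (-\<sigma>) * ((- \<sigma> * F (1 / z\<^sup>2) - 2 * (1 / z\<^sup>2) * F1 (1 / z\<^sup>2)) / z))"
    and "v2 = (\<lambda>z. z powr (-\<sigma>) * ((\<sigma> * (\<sigma> + 1) * F (1 / z\<^sup>2) + (4 * \<sigma> + 6) * (1 / z\<^sup>2) * F1 (1 / z\<^sup>2) + 4 * (1 / z\<^sup>2)\<^sup>2 * F2 (1 / z\<^sup>2)) / z\<^sup>2))"
  have main: "((\<lambda>z. z powr (-\<sigma>) * F (1 / z\<^sup>2)) has_field_derivative v1 z) (at z)"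
      "(v1 has_field_derivative v2 z) (at z)"
      "(1 - z\<^sup>2) * v2 z - 2 * (\<mu> + 1) * z * v1 z = (\<mu> - \<nu>) * (\<mu> + \<nu> + 1) * (z powr (-\<sigma>) * F (1 / z\<^sup>2))"
    if z: "Im z \<noteq> 0" for z
  proof -
    define x where "x = 1 / z\<^sup>2"
    have z0: "z \<noteq> 0" "z \<notin> \<real>\<^sub>\<le>\<^sub>0" using z by (auto simp: complex_nonpos_Reals_iff)
    have xs: "1 / z\<^sup>2 \<in> slit_plane" by (rule inverse_square_slit_plane[OF z])
    have dF: "(F has_field_derivative F1 (1 / z\<^sup>2)) (at (1 / z\<^sup>2))" "(F1 has_field_derivative F2 (1 / z\<^sup>2)) (at (1 / z\<^sup>2))"
    proof -
      have e: "a + 1 + 1 = a + 2" "b + 1 + 1 = b + 2" "c + 1 + 1 = c + 2" by auto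
      show "(F has_field_derivative F1 (1 / z\<^sup>2)) (at (1 / z\<^sup>2))"
        unfolding F_def F1_def by (rule has_field_derivative_hypergeo_reg[OF xs])
      show "(F1 has_field_derivative F2 (1 / z\<^sup>2)) (at (1 / z\<^sup>2))"
        unfolding F1_def F2_def
        using DERIV_cmult[OF has_field_derivative_hypergeo_reg[OF xs, of "a + 1" "b + 1" "c + 1"]] unfolding e .
    qed
    have ode: "x * (1 - x) * F2 x + (c - (a + b + 1) * x) * F1 x = a * b * F x"
      using arg_cong[OF hypergeo_reg_ode[OF xs, of a b c], of "\<lambda>y. a * b * y"]
      unfolding F_def F1_def F2_def x_def by (simp add: ring_distribs mult_ac)
    have dx: "((\<lambda>z. 1 / z\<^sup>2) has_field_derivative - 2 * x / z) (at z)"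
      unfolding x_def using z0 by (auto intro!: derivative_eq_intros simp: field_simps power2_eq_square)
    have dp: "((\<lambda>z. z powr (-\<sigma>)) has_field_derivative - \<sigma> * z powr (-\<sigma>) / z) (at z)"
      by (rule has_field_derivative_powr_div[OF z0(2)])
    define p where "p = z powr (-\<sigma>)"
    have dF': "((\<lambda>z. F (1 / z\<^sup>2)) has_field_derivative F1 x * (- 2 * x / z)) (at z)"
      "((\<lambda>z. F1 (1 / z\<^sup>2)) has_field_derivative F2 x * (- 2 * x / z)) (at z)"
      using DERIV_chain2[OF dF(1) dx] DERIV_chain2[OF dF(2) dx] by (simp_all add: x_def)
    have "((\<lambda>z. z powr (-\<sigma>) * F (1 / z\<^sup>2)) has_field_derivative - \<sigma> * p / z * F x + F1 x * (- 2 * x / z) * p) (at z)"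
      using DERIV_mult[OF dp dF'(1)] by (simp add: x_def p_def)
    moreover have "- \<sigma> * p / z * F x + F1 x * (- 2 * x / z) * p = v1 z"
      unfolding v1_def x_def[symmetric] p_def[symmetric] by (simp add: algebra_simps diff_divide_distrib)
    ultimately show "((\<lambda>z. z powr (-\<sigma>) * F (1 / z\<^sup>2)) has_field_derivative v1 z) (at z)" by simp
    let ?q = "\<lambda>z. - \<sigma> * F (1 / z\<^sup>2) - 2 * (1 / z\<^sup>2) * F1 (1 / z\<^sup>2)"
    have dq: "(?q has_field_derivative 2 * x / z * (\<sigma> * F1 x + 2 * F1 x + 2 * x * F2 x)) (at z)"
    proof -
      have "(?q has_field_derivative - \<sigma> * (F1 x * (- 2 * x / z)) - (2 * (- 2 * x / z) * F1 x + F2 x * (- 2 * x / z) * (2 * (1 / z\<^sup>2)))) (at z)"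
        using DERIV_diff[OF DERIV_cmult[OF dF'(1), of "- \<sigma>"] DERIV_mult[OF DERIV_cmult[OF dx, of 2] dF'(2)]]
        by (simp add: x_def)
      moreover have "- \<sigma> * (F1 x * (- 2 * x / z)) - (2 * (- 2 * x / z) * F1 x + F2 x * (- 2 * x / z) * (2 * (1 / z\<^sup>2)))
         = 2 * x / z * (\<sigma> * F1 x + 2 * F1 x + 2 * x * F2 x)"
        unfolding x_def[symmetric] by (simp add: algebra_simps)
      ultimately show ?thesis by simp
    qed
    have dqz: "((\<lambda>z. ?q z / z) has_field_derivative
        (2 * x / z * (\<sigma> * F1 x + 2 * F1 x + 2 * x * F2 x) * z - (- \<sigma> * F x - 2 * x * F1 x) * 1) / (z * z)) (at z)"
      using DERIV_divide[OF dq DERIV_ident z0(1)] by (simp add: x_def)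
    have "(v1 has_field_derivative - \<sigma> * p / z * ((- \<sigma> * F x - 2 * x * F1 x) / z) +
       (2 * x / z * (\<sigma> * F1 x + 2 * F1 x + 2 * x * F2 x) * z - (- \<sigma> * F x - 2 * x * F1 x) * 1) / (z * z) * p) (at z)"
      unfolding v1_def using DERIV_mult[OF dp dqz] by (simp add: x_def p_def)
    moreover have "- \<sigma> * p / z * ((- \<sigma> * F x - 2 * x * F1 x) / z) +
       (2 * x / z * (\<sigma> * F1 x + 2 * F1 x + 2 * x * F2 x) * z - (- \<sigma> * F x - 2 * x * F1 x) * 1) / (z * z) * p = v2 z"
    proof -
      have "2 * x / z * (\<sigma> * F1 x + 2 * F1 x + 2 * x * F2 x) * z = 2 * x * (\<sigma> * F1 x + 2 * F1 x + 2 * x * F2 x)"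
        using z0 by simp
      thus ?thesis unfolding v2_def x_def[symmetric] p_def[symmetric]
        by (simp add: power2_eq_square add_divide_distrib diff_divide_distrib algebra_simps)
    qed
    ultimately show "(v1 has_field_derivative v2 z) (at z)" by simp
    have zx: "z\<^sup>2 * x = 1" using z0 by (simp add: x_def)
    have "(1 - z\<^sup>2) * v2 z = p * ((x - 1) * (\<sigma> * (\<sigma> + 1) * F x + (4 * \<sigma> + 6) * x * F1 x + 4 * x\<^sup>2 * F2 x))"
    proof -
      have "(1 - z\<^sup>2) / z\<^sup>2 = x - 1" using z0 by (simp add: x_def field_simps)
      moreover have "(1 - z\<^sup>2) * v2 z = p * ((1 - z\<^sup>2) / z\<^sup>2 * (\<sigma> * (\<sigma> + 1) * F x + (4 * \<sigma> + 6) * x * F1 x + 4 * x\<^sup>2 * F2 x))"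
        unfolding v2_def x_def[symmetric] p_def[symmetric] by simp
      ultimately show ?thesis by simp
    qed
    moreover have "2 * (\<mu> + 1) * z * v1 z = p * (2 * (\<mu> + 1) * (- \<sigma> * F x - 2 * x * F1 x))"
      unfolding v1_def x_def[symmetric] p_def[symmetric] using z0 by simp
    moreover have "(x - 1) * (\<sigma> * (\<sigma> + 1) * F x + (4 * \<sigma> + 6) * x * F1 x + 4 * x\<^sup>2 * F2 x) - 2 * (\<mu> + 1) * (- \<sigma> * F x - 2 * x * F1 x)
      = (\<mu> - \<nu>) * (\<mu> + \<nu> + 1) * F x"
    proof -
      \<comment> \<open>Only the term in \<open>F2\<close> needs the hypergeometric equation; once
        it is eliminated, what remains is linear in \<open>F\<close> and \<open>F1\<close> with
        matching coefficients.\<close>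
      have "(x - 1) * (4 * x\<^sup>2 * F2 x) = - 4 * x * (x * (1 - x) * F2 x)" by (simp add: power2_eq_square algebra_simps)
      also have "\<dots> = - 4 * x * (a * b * F x - (c - (a + b + 1) * x) * F1 x)"
        unfolding ode[symmetric] by (simp only: add_diff_cancel_right')
      also have "\<dots> = - x * (4 * (a * b)) * F x + 2 * x * (2 * c - 2 * (a + b + 1) * x) * F1 x" by (simp add: algebra_simps)
      also have "\<dots> = - x * (\<sigma> * (\<sigma> + 1)) * F x + 2 * x * (2 * \<nu> + 3 - (2 * \<sigma> + 3) * x) * F1 x"
        unfolding ab by (simp add: algebra_simps)
      finally have "(x - 1) * (4 * x\<^sup>2 * F2 x) = - x * (\<sigma> * (\<sigma> + 1)) * F x + 2 * x * (2 * \<nu> + 3 - (2 * \<sigma> + 3) * x) * F1 x" .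
      hence "(x - 1) * (\<sigma> * (\<sigma> + 1) * F x + (4 * \<sigma> + 6) * x * F1 x + 4 * x\<^sup>2 * F2 x)
        = (x - 1) * (\<sigma> * (\<sigma> + 1) * F x + (4 * \<sigma> + 6) * x * F1 x) + (- x * (\<sigma> * (\<sigma> + 1)) * F x + 2 * x * (2 * \<nu> + 3 - (2 * \<sigma> + 3) * x) * F1 x)"
        by (simp only: ring_distribs)
      thus ?thesis by (simp only:) (simp add: \<sigma>_def algebra_simps)
    qed
    ultimately show "(1 - z\<^sup>2) * v2 z - 2 * (\<mu> + 1) * z * v1 z = (\<mu> - \<nu>) * (\<mu> + \<nu> + 1) * (z powr (-\<sigma>) * F (1 / z\<^sup>2))"
      unfolding x_def[symmetric] p_def[symmetric] by (simp only: right_diff_distrib[symmetric] mult_ac)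
  qed
  have "gegenbauer_sol \<nu> \<mu> (half_plane s) (legendre_Q_series \<nu> \<mu>) (\<lambda>u. - 2 * v1 (1 - 2 * u)) (\<lambda>u. 4 * v2 (1 - 2 * u))"
    unfolding gegenbauer_sol_def
  proof (intro ballI conjI)
    fix u assume u: "u \<in> half_plane s"
    have z: "Im (1 - 2 * u) \<noteq> 0" using half_plane_props(3)[OF u] by simp
    have m: "((\<lambda>u::complex. 1 - 2 * u) has_field_derivative -2) (at u)" by (auto intro!: derivative_eq_intros)
    have Q: "legendre_Q_series \<nu> \<mu> = (\<lambda>u. (1 - 2 * u) powr (-\<sigma>) * F (1 / (1 - 2 * u)\<^sup>2))"
      by (simp add: fun_eq_iff legendre_Q_series_def \<sigma>_def F_def a_def b_def c_def)
    show "(legendre_Q_series \<nu> \<mu> has_field_derivative - 2 * v1 (1 - 2 * u)) (at u)"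
      unfolding Q using DERIV_chain2[OF main(1)[OF z] m] by (simp add: mult.commute)
    show "((\<lambda>u. - 2 * v1 (1 - 2 * u)) has_field_derivative 4 * v2 (1 - 2 * u)) (at u)"
      using DERIV_cmult[OF DERIV_chain2[OF main(2)[OF z] m], of "-2"] by (simp add: mult.commute)
    have "u * (1 - u) * (4 * v2 (1 - 2 * u)) + (\<mu> + 1) * (1 - 2 * u) * (- 2 * v1 (1 - 2 * u))
       = (1 - (1 - 2 * u)\<^sup>2) * v2 (1 - 2 * u) - 2 * (\<mu> + 1) * (1 - 2 * u) * v1 (1 - 2 * u)"
      by (simp add: power2_eq_square algebra_simps)
    also have "\<dots> = (\<mu> - \<nu>) * (\<mu> + \<nu> + 1) * legendre_Q_series \<nu> \<mu> u" unfolding Q by (rule main(3)[OF z])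
    finally show "u * (1 - u) * (4 * v2 (1 - 2 * u)) + (\<mu> + 1) * (1 - 2 * u) * (- 2 * v1 (1 - 2 * u)) = (\<mu> - \<nu>) * (\<mu> + \<nu> + 1) * legendre_Q_series \<nu> \<mu> u" .
  qed
  thus ?thesis by blast
qed

text \<open>The uniform expansion with N = 1 already contains the limit: the only term is
  Gamma(\<mu>), and the remainder is of order |u|. The threshold B + 4 is N + B + 3 for this
  N.\<close>

lemma legendre_G_tendsto_at_0:
  fixes B :: nat and u :: "nat \<Rightarrow> complex"
  assumes \<nu>: "norm \<nu> \<le> real B" and \<mu>: "Re \<mu> \<ge> real B + 4"
    and u: "\<And>n. Im (u n) \<noteq> 0" "u \<longlonglongrightarrow> 0"
  shows "(\<lambda>n. legendre_G \<nu> \<mu> (u n)) \<longlonglongrightarrow> Gamma \<mu>"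
proof -
  obtain C where C': "\<And>\<nu> \<mu>' w. norm \<nu> \<le> real B \<Longrightarrow> Re \<mu>' \<ge> real 1 + real B + 3 \<Longrightarrow> \<bar>Im \<mu>'\<bar> \<le> \<bar>Im \<mu>\<bar> \<Longrightarrow>
    w \<noteq> 0 \<Longrightarrow> norm w \<le> 1 \<Longrightarrow> 1 - w \<in> slit_plane \<Longrightarrow>
    norm (legendre_G_rem 1 \<nu> \<mu>' w)
      \<le> C * norm (Gamma (\<mu>' - of_nat 1)) * norm w ^ 1"
    using legendre_G_expansion[OF zero_less_one, of B 1 "\<bar>Im \<mu>\<bar>"] by blast
  have C: "norm (legendre_G \<nu> \<mu> w - Gamma \<mu>) \<le> C * norm (Gamma (\<mu> - 1)) * norm w"
    if "w \<noteq> 0" "norm w \<le> 1" "1 - w \<in> slit_plane" for w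
    using C'[OF \<nu> _ order_refl that] \<mu> by (simp add: legendre_G_rem_def a_coeff_def)
  have "(\<lambda>n. legendre_G \<nu> \<mu> (u n) - Gamma \<mu>) \<longlonglongrightarrow> 0"
  proof (rule Lim_null_comparison)
    show "(\<lambda>n. C * norm (Gamma (\<mu> - 1)) * norm (u n)) \<longlonglongrightarrow> 0"
      by (intro tendsto_mult_right_zero tendsto_norm_zero u)
    have "\<forall>\<^sub>F n in sequentially. dist (u n) 0 < 1" by (rule tendstoD[OF u(2)]) simp
    thus "\<forall>\<^sub>F n in sequentially. norm (legendre_G \<nu> \<mu> (u n) - Gamma \<mu>) \<le> C * norm (Gamma (\<mu> - 1)) * norm (u n)"
    proof eventually_elim
      case (elim n)
      have "u n \<noteq> 0" "1 - u n \<in> slit_plane" using u(1)[of n] by (auto simp: slit_plane_iff)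
      thus ?case using C[of "u n"] elim by simp
    qed
  qed
  thus ?thesis by (rule LIM_zero_cancel)
qed

text \<open>1 - 2d \<le> (1-d)^2, so the first hypothesis gives 1 - |x| \<ge> d, and d can be traded
  for the distance to the circle.\<close>

lemma stolz_angleI:
  assumes "norm x ^ 2 \<le> 1 - 2 * d" "0 < d" "d \<le> 1" "norm (1 - x) \<le> Q * d" "Q \<ge> 0"
  shows "norm x < 1" "norm (1 - x) \<le> Q * (1 - norm x)"
proof -
  have "norm x ^ 2 \<le> (1 - d) ^ 2" using assms by (simp add: power2_eq_square algebra_simps) (smt (verit) mult_nonneg_nonneg)
  hence le: "norm x \<le> 1 - d" using assms by (intro power2_le_imp_le[of "norm x"]) auto
  thus "norm x < 1" using assms by linarith
  have "Q * d \<le> Q * (1 - norm x)" using le assms by (intro mult_left_mono) auto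
  thus "norm (1 - x) \<le> Q * (1 - norm x)" using assms by linarith
qed

definition approach :: "nat \<Rightarrow> real" where "approach n = 1 / (real n + 2)"

lemma approach: "approach n > 0" "approach n \<le> 1/2" "approach \<longlonglongrightarrow> 0"
proof -
  show "approach n > 0" "approach n \<le> 1/2" by (auto simp: approach_def field_simps)
  show "approach \<longlonglongrightarrow> 0"
    using LIMSEQ_ignore_initial_segment[OF lim_1_over_n[where 'a=real], of 2] by (simp add: approach_def[abs_def] add.commute)
qed

lemma approach_linear_tendsto: "(\<lambda>n. a + b * complex_of_real (approach n)) \<longlonglongrightarrow> a"
proof -
  have "(\<lambda>n. a + b * complex_of_real (approach n)) \<longlonglongrightarrow> a + b * of_real 0"
    by (intro tendsto_intros approach)
  thus ?thesis by simp
qed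

lemma tendsto_powr_complex_at:
  fixes v :: "nat \<Rightarrow> complex"
  assumes "v \<longlonglongrightarrow> a" "a \<notin> \<real>\<^sub>\<le>\<^sub>0"
  shows "(\<lambda>n. v n powr c) \<longlonglongrightarrow> a powr c"
  by (rule isCont_tendsto_compose[OF DERIV_isCont[OF has_field_derivative_powr_div[OF assms(2)]] assms(1)])

text \<open>At u = 0 the series is regular with value 1/Gamma(1-\<mu>), which gives the coefficient
  of G(u). At u = 1 the excess a + b - c equals \<mu>, so the boundary limit is
  Gamma(\<mu>)/(Gamma(\<nu>+1) Gamma(-\<nu>)). The reflection formula turns both into sines.\<close>

lemma hypergeo_P_connection:
  fixes B :: nat
  assumes s: "s = 1 \<or> s = -1" and \<nu>: "norm \<nu> \<le> real B" and \<mu>: "Re \<mu> \<ge> real B + 4" and u: "u \<in> half_plane s"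
  shows "hypergeo_reg (\<nu> + 1) (-\<nu>) (1 - \<mu>) u = sin (of_real pi * \<mu>) / of_real pi * legendre_G \<nu> \<mu> u
     - sin (of_real pi * \<nu>) / of_real pi * (u powr \<mu> * (1 - u) powr (-\<mu>)) * legendre_G \<nu> \<mu> (1 - u)"
proof -
  define F where "F = hypergeo_reg (\<nu> + 1) (-\<nu>) (1 - \<mu>)"
  define f where "f = (\<lambda>u. u powr (-\<mu>) * F u)"
  have Re\<nu>: "\<bar>Re \<nu>\<bar> \<le> real B" using \<nu> abs_Re_le_cmod[of \<nu>] by linarith
  obtain f1 f2 where f: "gegenbauer_sol \<nu> \<mu> (half_plane s) f f1 f2"
    using legendre_P_sol unfolding f_def F_def by blast
  have inv: "u powr \<mu> * u powr (-\<mu>) = 1" if "u \<noteq> 0" for u using that by (simp flip: powr_add)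
  obtain U0 where U0: "\<And>n. U0 n \<in> half_plane s" "U0 \<longlonglongrightarrow> 0" 
    using half_plane_seq_exists[of s] s by (metis one_neq_zero neg_equal_0_iff_equal)
  have l0: "(\<lambda>n. U0 n powr \<mu> * f (U0 n)) \<longlonglongrightarrow> rGamma (1 - \<mu>)"
  proof -
    have "isCont F 0" unfolding F_def
      by (rule DERIV_isCont[OF has_field_derivative_hypergeo_reg]) (simp add: slit_plane_iff)
    from isCont_tendsto_compose[OF this U0(2)] have "(\<lambda>n. F (U0 n)) \<longlonglongrightarrow> rGamma (1 - \<mu>)"
      by (simp add: F_def hypergeo_reg_at_0)
    moreover have "U0 n powr \<mu> * f (U0 n) = F (U0 n)" for n
      using inv[OF half_plane_notin(1)[OF U0(1)]] by (simp add: f_def flip: mult.assoc)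
    ultimately show ?thesis by simp
  qed
  \<comment> \<open>A ray into the disc that stays in the prescribed half plane. With d =
    \<open>approach n\<close>, |U1|^2 = 1 - 2d + 5d^2/4 \<le> 1 - d, and |1 - U1| \<le> 3d/2; hence
    the Stolz constant 3 with d/2 in the role of the distance.\<close>
  define U1 where "U1 = (\<lambda>n. 1 + Complex (-1) (s / 2) * of_real (approach n))"
  have ReIm: "Re (U1 n) = 1 - approach n" "Im (U1 n) = s / 2 * approach n" for n by (simp_all add: U1_def)
  have U1: "U1 n \<in> half_plane s" for n using approach(1)[of n] s by (auto simp: half_plane_def ReIm)
  have U1lim: "U1 \<longlonglongrightarrow> 1" unfolding U1_def by (rule approach_linear_tendsto)
  have stolz: "norm (U1 n) < 1" "norm (1 - U1 n) \<le> 3 * (1 - norm (U1 n))" for n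
  proof -
    define d where "d = approach n"
    have d: "0 < d" "d \<le> 1/2" using approach(1,2)[of n] by (auto simp: d_def)
    have s2: "s\<^sup>2 = 1" using s by auto
    have "d * (d * 5) \<le> d * 4" using d by (intro mult_left_mono) auto
    hence 1: "norm (U1 n) ^ 2 \<le> 1 - 2 * (d / 2)"
      using s2 by (simp add: cmod_power2 ReIm d_def[symmetric] power_mult_distrib power_divide) (simp add: power2_eq_square algebra_simps)
    have "norm (1 - U1 n) = norm (Complex (-1) (s / 2)) * d" using d by (simp add: U1_def norm_mult d_def)
    also have "norm (Complex (-1) (s / 2)) \<le> 3/2" using cmod_le[of "Complex (-1) (s / 2)"] s by auto
    finally have 2: "norm (1 - U1 n) \<le> 3 * (d / 2)" using d by simp
    show "norm (U1 n) < 1" "norm (1 - U1 n) \<le> 3 * (1 - norm (U1 n))"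
      using stolz_angleI[OF 1 _ _ 2] d by auto
  qed
  have M: "\<nu> + 1 + -\<nu> - (1 - \<mu>) = \<mu>" by simp
  have l1: "(\<lambda>n. (1 - U1 n) powr \<mu> * f (U1 n)) \<longlonglongrightarrow> Gamma \<mu> * rGamma (\<nu> + 1) * rGamma (-\<nu>)"
  proof -
    have "(\<lambda>n. (1 - U1 n) powr \<mu> * F (U1 n)) \<longlonglongrightarrow> Gamma \<mu> * rGamma (\<nu> + 1) * rGamma (-\<nu>)"
      using hypergeo_reg_limit_at_1[of "\<nu> + 1" "-\<nu>" "1 - \<mu>" U1 3, unfolded M] stolz U1lim \<mu> unfolding F_def by auto
    moreover have "(\<lambda>n. U1 n powr (-\<mu>)) \<longlonglongrightarrow> 1"
      using tendsto_powr_complex_at[OF U1lim, of "-\<mu>"] by simp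
    ultimately have "(\<lambda>n. U1 n powr (-\<mu>) * ((1 - U1 n) powr \<mu> * F (U1 n))) \<longlonglongrightarrow> 1 * (Gamma \<mu> * rGamma (\<nu> + 1) * rGamma (-\<nu>))"
      by (rule tendsto_mult[rotated])
    thus ?thesis by (simp add: f_def mult_ac)
  qed
  have Gm: "Gamma \<mu> \<noteq> 0" "Gamma \<mu> * rGamma \<mu> = 1"
    by (rule Gamma_rGamma_Re_pos; use \<mu> in simp)+
  have "Gamma \<mu> * f u = rGamma (1 - \<mu>) * (u powr (-\<mu>) * legendre_G \<nu> \<mu> u)
     + Gamma \<mu> * rGamma (\<nu> + 1) * rGamma (-\<nu>) * ((1 - u) powr (-\<mu>) * legendre_G \<nu> \<mu> (1 - u))"
    by (rule gegenbauer_connection[OF _ _ _ _ _ f U0 l0 U1 U1lim l1 u])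
       (use s \<mu> Re\<nu> legendre_G_tendsto_at_0[OF \<nu> \<mu>] in auto)
  also have "rGamma (1 - \<mu>) = Gamma \<mu> * (sin (of_real pi * \<mu>) / of_real pi)"
    unfolding rGamma_reflection_complex[symmetric] mult.assoc[symmetric] Gm(2) by simp
  also have "Gamma \<mu> * rGamma (\<nu> + 1) * rGamma (-\<nu>) = Gamma \<mu> * - (sin (of_real pi * \<nu>) / of_real pi)"
    using rGamma_reflection_complex[of "-\<nu>"] by (simp add: mult.assoc mult.commute[of "rGamma (-\<nu>)"] add.commute)
  finally have "Gamma \<mu> * f u = Gamma \<mu> * (sin (of_real pi * \<mu>) / of_real pi * (u powr (-\<mu>) * legendre_G \<nu> \<mu> u)
      - sin (of_real pi * \<nu>) / of_real pi * ((1 - u) powr (-\<mu>) * legendre_G \<nu> \<mu> (1 - u)))"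
    by (simp add: right_diff_distrib mult.assoc)
  hence "f u = sin (of_real pi * \<mu>) / of_real pi * (u powr (-\<mu>) * legendre_G \<nu> \<mu> u)
      - sin (of_real pi * \<nu>) / of_real pi * ((1 - u) powr (-\<mu>) * legendre_G \<nu> \<mu> (1 - u))" using Gm by simp
  from arg_cong[OF this, of "\<lambda>x. u powr \<mu> * x"]
  have "(u powr \<mu> * u powr (-\<mu>)) * F u = sin (of_real pi * \<mu>) / of_real pi * legendre_G \<nu> \<mu> u * (u powr \<mu> * u powr (-\<mu>))
     - sin (of_real pi * \<nu>) / of_real pi * (u powr \<mu> * (1 - u) powr (-\<mu>)) * legendre_G \<nu> \<mu> (1 - u)"
    unfolding f_def right_diff_distrib by (simp only: mult_ac)
  thus ?thesis unfolding inv[OF half_plane_notin(1)[OF u]] F_def by simp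
qed

text \<open>The direction -1 + s i makes |z| > 1, so x = 1/z^2 lies inside the disc and tends to 1
  in a Stolz angle. There 1 - x = -U y with y tending to 4, and the excess a + b - c is again \<mu>;
  the factor 4^(-\<mu>) comes from y and the phase from passing from -U to U.\<close>

lemma legendre_Q_series_limit_at_0:
  assumes s: "s = 1 \<or> s = -1" and \<mu>: "Re \<mu> > 0"
  defines "U \<equiv> \<lambda>n. Complex (-1) s * of_real (approach n)"
  shows "(\<lambda>n. U n powr \<mu> * legendre_Q_series \<nu> \<mu> (U n)) \<longlonglongrightarrow>
    exp (of_real (s * pi) * \<i> * \<mu>) * 4 powr (-\<mu>) * (Gamma \<mu> * rGamma ((\<nu> + \<mu> + 2) / 2) * rGamma ((\<nu> + \<mu> + 1) / 2))"
proof -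
  define z x y where "z = (\<lambda>n. 1 - 2 * U n)" and "x = (\<lambda>n. 1 / (z n)\<^sup>2)" and "y = (\<lambda>n. 4 * (1 - U n) / (z n)\<^sup>2)"
  have ReIm: "Re (U n) = - approach n" "Im (U n) = s * approach n" for n by (simp_all add: U_def)
  have Uh: "U n \<in> half_plane s" for n using approach(1)[of n] s by (auto simp: half_plane_def ReIm)
  have U0: "U \<longlonglongrightarrow> 0" using approach_linear_tendsto[of 0 "Complex (-1) s"] by (simp add: U_def)
  have "(\<lambda>n. 1 - 2 * U n) \<longlonglongrightarrow> 1 - 2 * 0" by (intro tendsto_intros U0)
  hence z1: "z \<longlonglongrightarrow> 1" by (simp add: z_def)
  have zn: "norm (z n) ^ 2 = 1 + 4 * approach n + 8 * approach n ^ 2" for n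
  proof -
    have "Re (z n) = 1 + 2 * approach n" "Im (z n) = - 2 * s * approach n" by (simp_all add: z_def ReIm)
    moreover have "s\<^sup>2 = 1" using s by auto
    ultimately show ?thesis by (simp add: cmod_power2 power_mult_distrib) (simp add: power2_eq_square algebra_simps)
  qed
  have z0: "z n \<noteq> 0" for n 
  proof
    assume "z n = 0"
    thus False using zn[of n] approach(1)[of n] zero_le_power2[of "approach n"] by simp
  qed
  have "(\<lambda>n. 1 / (z n)\<^sup>2) \<longlonglongrightarrow> 1 / 1\<^sup>2" by (intro tendsto_intros z1) simp
  hence x1: "x \<longlonglongrightarrow> 1" by (simp add: x_def)
  have "(\<lambda>n. 4 * (1 - U n) / (z n)\<^sup>2) \<longlonglongrightarrow> 4 * (1 - 0) / 1\<^sup>2" by (intro tendsto_intros z1 U0) simp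
  hence y4: "y \<longlonglongrightarrow> 4" by (simp add: y_def)
  have mx: "1 - x n = - U n * y n" for n
  proof -
    have "(z n)\<^sup>2 - 1 = - U n * (4 * (1 - U n))" by (simp add: z_def power2_eq_square algebra_simps)
    moreover have "1 - x n = ((z n)\<^sup>2 - 1) / (z n)\<^sup>2" using z0[of n] by (simp add: x_def field_simps)
    ultimately show ?thesis by (simp add: y_def)
  qed
  have stolz: "norm (x n) < 1" "norm (1 - x n) \<le> 4 * (1 - norm (x n))" for n
  proof -
    define d where "d = approach n"
    have d: "0 < d" "d \<le> 1/2" using approach(1,2)[of n] by (auto simp: d_def)
    define Z where "Z = norm (z n) ^ 2"
    have Z: "Z = 1 + 4 * d + 8 * d ^ 2" "Z > 1" using zn[of n] d by (auto simp: Z_def d_def add_pos_pos)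
    have nx: "norm (x n) = 1 / Z" by (simp add: x_def Z_def norm_divide norm_power)
    show "norm (x n) < 1" using Z by (simp add: nx)
    have nU: "norm (U n) \<le> 2 * d"
      using cmod_le[of "U n"] s d by (auto simp: ReIm d_def abs_mult)
    have "norm (1 - U n) \<le> 1 + norm (U n)" using norm_triangle_ineq4[of 1 "U n"] by simp
    hence "norm (1 - U n) \<le> 2" using nU d by linarith
    hence "norm (U n) * norm (1 - U n) \<le> 2 * d * 2" using nU d by (intro mult_mono) auto
    hence "norm (1 - x n) \<le> 16 * d / Z"
    proof -
      have "norm (1 - x n) = norm (U n) * (4 * norm (1 - U n) / Z)"
        unfolding mx y_def Z_def norm_mult norm_divide norm_power norm_minus_cancel by (simp only: norm_numeral)
      also have "\<dots> = 4 * (norm (U n) * norm (1 - U n)) / Z" by simp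
      also have "\<dots> \<le> 16 * d / Z" using Z \<open>norm (U n) * norm (1 - U n) \<le> 2 * d * 2\<close> by (intro divide_right_mono) auto
      finally show ?thesis .
    qed
    also have "\<dots> \<le> 4 * (1 - norm (x n))"
    proof -
      have "1 - 1 / Z = (Z - 1) / Z" using Z by (simp add: field_simps)
      moreover have "4 * d / Z \<le> (Z - 1) / Z" using Z d by (intro divide_right_mono) auto
      ultimately have "4 * d / Z \<le> 1 - norm (x n)" unfolding nx by (simp only:)
      hence "4 * (4 * d / Z) \<le> 4 * (1 - norm (x n))" by (intro mult_left_mono) auto
      thus ?thesis by simp
    qed
    finally show "norm (1 - x n) \<le> 4 * (1 - norm (x n))" .
  qed
  define a b c where "a = (\<nu> + \<mu> + 2) / 2" and "b = (\<nu> + \<mu> + 1) / 2" and "c = \<nu> + 3 / 2"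
  have M: "a + b - c = \<mu>" by (simp add: a_def b_def c_def field_simps)
  have h1: "(\<lambda>n. (1 - x n) powr \<mu> * hypergeo_reg a b c (x n)) \<longlonglongrightarrow> Gamma \<mu> * rGamma a * rGamma b"
    using hypergeo_reg_limit_at_1[of a b c x 4, unfolded M] stolz x1 \<mu> by auto
  have h2: "(\<lambda>n. y n powr (-\<mu>)) \<longlonglongrightarrow> 4 powr (-\<mu>)"
    by (rule tendsto_powr_complex_at[OF y4]) (auto simp: complex_nonpos_Reals_iff)
  have h3: "(\<lambda>n. z n powr (- (\<nu> + \<mu> + 1))) \<longlonglongrightarrow> 1"
    using tendsto_powr_complex_at[OF z1, of "- (\<nu> + \<mu> + 1)"] by simp
  have lim: "(\<lambda>n. z n powr (- (\<nu> + \<mu> + 1)) * (exp (of_real (s * pi) * \<i> * \<mu>) * y n powr (-\<mu>)) * ((1 - x n) powr \<mu> * hypergeo_reg a b c (x n)))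
     \<longlonglongrightarrow> 1 * (exp (of_real (s * pi) * \<i> * \<mu>) * 4 powr (-\<mu>)) * (Gamma \<mu> * rGamma a * rGamma b)"
    by (rule tendsto_mult[OF tendsto_mult[OF h3 tendsto_mult[OF tendsto_const h2]] h1])
  have "\<forall>\<^sub>F n in sequentially. dist (y n) 4 < 1" by (rule tendstoD[OF y4]) simp
  hence ev: "\<forall>\<^sub>F n in sequentially. z n powr (- (\<nu> + \<mu> + 1)) * (exp (of_real (s * pi) * \<i> * \<mu>) * y n powr (-\<mu>)) * ((1 - x n) powr \<mu> * hypergeo_reg a b c (x n))
      = U n powr \<mu> * legendre_Q_series \<nu> \<mu> (U n)"
  proof eventually_elim
    case (elim n)
    have Rey: "Re (y n) > 0" using elim abs_Re_le_cmod[of "y n - 4"] by (auto simp: dist_norm)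
    hence y0: "y n \<noteq> 0" by auto
    have U0: "U n \<noteq> 0" using half_plane_notin[OF Uh] by auto
    have "\<bar>Im (Ln (- U n))\<bar> < pi / 2" "\<bar>Im (Ln (y n))\<bar> < pi / 2"
      using Re_Ln_pos_lt_imp[of "- U n"] Re_Ln_pos_lt_imp[of "y n"] Rey approach(1)[of n] by (auto simp: ReIm)
    \<comment> \<open>Both -U and y have positive real part, so the logarithms add without a
      multiple of 2 pi i. This is the second reason for the negative real part of
      \<open>U\<close>.\<close>
    hence "Ln (1 - x n) = Ln (- U n) + Ln (y n)"
      unfolding mx using y0 U0 by (intro Ln_times_simple) auto
    hence L: "Ln (1 - x n) = Ln (U n) - of_real (s * pi) * \<i> + Ln (y n)"
      using Ln_minus_half_plane[OF Uh s] by simp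
    have x0: "1 - x n \<noteq> 0" using stolz(1)[of n] by auto
    have A: "U n powr \<mu> = exp (of_real (s * pi) * \<i> * \<mu>) * y n powr (-\<mu>) * (1 - x n) powr \<mu>"
      using x0 y0 U0 unfolding powr_def L by (simp add: exp_add[symmetric] algebra_simps)
    have Q: "legendre_Q_series \<nu> \<mu> (U n) = z n powr (- (\<nu> + \<mu> + 1)) * hypergeo_reg a b c (x n)"
      by (simp add: legendre_Q_series_def a_def b_def c_def x_def z_def)
    show ?case unfolding A Q by (simp only: mult_ac)
  qed
  show ?thesis using Lim_transform_eventually[OF lim ev] by (simp add: a_def b_def)
qed

text \<open>Apart from the power z^(-(\<nu>+\<mu>+1)) the series is even in z, so replacing u by 1 -
  u, which is z by -z, only multiplies it by a phase. The limit at 1 is therefore the limit at 0 in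
  the opposite half plane; there the phase in \<mu> has the other sign and cancels, leaving -exp(s
  pi i \<nu>).\<close>

lemma hypergeo_Q_connection:
  fixes B :: nat
  assumes s: "s = 1 \<or> s = -1" and \<nu>: "norm \<nu> \<le> real B" and \<mu>: "Re \<mu> \<ge> real B + 4" and u: "u \<in> half_plane s"
  shows "legendre_Q_series \<nu> \<mu> u = 4 powr (-\<mu>) * (rGamma ((\<nu> + \<mu> + 2) / 2) * rGamma ((\<nu> + \<mu> + 1) / 2)) *
     (exp (of_real (s * pi) * \<i> * \<mu>) * (u powr (-\<mu>) * legendre_G \<nu> \<mu> u)
      - exp (of_real (s * pi) * \<i> * \<nu>) * ((1 - u) powr (-\<mu>) * legendre_G \<nu> \<mu> (1 - u)))"
proof -
  have Re\<nu>: "\<bar>Re \<nu>\<bar> \<le> real B" using \<nu> abs_Re_le_cmod[of \<nu>] by linarith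
  define R where "R = rGamma ((\<nu> + \<mu> + 2) / 2) * rGamma ((\<nu> + \<mu> + 1) / 2)"
  obtain f1 f2 where f: "gegenbauer_sol \<nu> \<mu> (half_plane s) (legendre_Q_series \<nu> \<mu>) f1 f2"
    using legendre_Q_sol by blast
  define U where "U = (\<lambda>(s::real) n. Complex (-1) s * of_real (approach n))"
  have Uh: "U s n \<in> half_plane s" if "s = 1 \<or> s = -1" for s n
    using approach(1)[of n] that by (auto simp: half_plane_def U_def)
  have U0: "U s \<longlonglongrightarrow> 0" for s using approach_linear_tendsto[of 0 "Complex (-1) s"] by (simp add: U_def)
  have L: "(\<lambda>n. U s n powr \<mu> * legendre_Q_series \<nu> \<mu> (U s n)) \<longlonglongrightarrow> exp (of_real (s * pi) * \<i> * \<mu>) * 4 powr (-\<mu>) * (Gamma \<mu> * R)"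
    if "s = 1 \<or> s = -1" for s
    using legendre_Q_series_limit_at_0[OF that, of \<mu> \<nu>] \<mu> unfolding U_def R_def by (simp add: mult.assoc)
  have ms: "- s = 1 \<or> - s = -1" using s by auto
  define U1 where "U1 = (\<lambda>n. 1 - U (-s) n)"
  have U1: "U1 n \<in> half_plane s" for n unfolding U1_def using half_plane_props(4)[of "U (-s) n" "-s"] Uh[OF ms] by simp
  have U1lim: "U1 \<longlonglongrightarrow> 1" using tendsto_diff[OF tendsto_const[of 1] U0[of "-s"]] by (simp add: U1_def)
  have refl: "legendre_Q_series \<nu> \<mu> (1 - v) = exp (of_real (s * pi) * \<i> * (\<nu> + \<mu> + 1)) * legendre_Q_series \<nu> \<mu> v"
    if v: "v \<in> half_plane (-s)" for v
  proof -
    define z where "z = 1 - 2 * v"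
    have zh: "z \<in> half_plane s" using v by (simp add: half_plane_def z_def)
    have z: "1 - 2 * (1 - v) = - z" "z \<noteq> 0" using half_plane_notin(1)[OF zh] by (auto simp: z_def)
    have "(- z) powr (- (\<nu> + \<mu> + 1)) = exp (of_real (s * pi) * \<i> * (\<nu> + \<mu> + 1)) * z powr (- (\<nu> + \<mu> + 1))"
      using z(2) by (simp add: powr_def Ln_minus_half_plane[OF zh s] exp_add[symmetric]) (simp add: algebra_simps)
    thus ?thesis unfolding legendre_Q_series_def z(1) by (simp add: z_def[symmetric])
  qed
  have e1: "exp (of_real (s * pi) * \<i> * (\<nu> + \<mu> + 1)) * exp (of_real (- s * pi) * \<i> * \<mu>) = - exp (of_real (s * pi) * \<i> * \<nu>)"
  proof -
    have "exp (of_real (s * pi) * \<i> * (\<nu> + \<mu> + 1)) * exp (of_real (- s * pi) * \<i> * \<mu>) = exp (of_real (s * pi) * \<i> * \<nu>) * exp (of_real (s * pi) * \<i>)"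
      unfolding exp_add[symmetric] by (simp add: algebra_simps)
    moreover have "exp (of_real (s * pi) * \<i>) = -1" using s by (auto simp: exp_minus mult.commute)
    ultimately show ?thesis by simp
  qed
  have l1: "(\<lambda>n. (1 - U1 n) powr \<mu> * legendre_Q_series \<nu> \<mu> (U1 n)) \<longlonglongrightarrow> - exp (of_real (s * pi) * \<i> * \<nu>) * 4 powr (-\<mu>) * (Gamma \<mu> * R)"
  proof -
    have "(\<lambda>n. exp (of_real (s * pi) * \<i> * (\<nu> + \<mu> + 1)) * (U (-s) n powr \<mu> * legendre_Q_series \<nu> \<mu> (U (-s) n)))
       \<longlonglongrightarrow> exp (of_real (s * pi) * \<i> * (\<nu> + \<mu> + 1)) * (exp (of_real (- s * pi) * \<i> * \<mu>) * 4 powr (-\<mu>) * (Gamma \<mu> * R))"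
      by (intro tendsto_mult tendsto_const L[OF ms])
    moreover have "exp (of_real (s * pi) * \<i> * (\<nu> + \<mu> + 1)) * (U (-s) n powr \<mu> * legendre_Q_series \<nu> \<mu> (U (-s) n))
       = (1 - U1 n) powr \<mu> * legendre_Q_series \<nu> \<mu> (U1 n)" for n
      using refl[OF Uh[OF ms], of n] by (simp add: U1_def)
    moreover have "exp (of_real (s * pi) * \<i> * (\<nu> + \<mu> + 1)) * (exp (of_real (- s * pi) * \<i> * \<mu>) * 4 powr (-\<mu>) * (Gamma \<mu> * R))
       = - exp (of_real (s * pi) * \<i> * \<nu>) * 4 powr (-\<mu>) * (Gamma \<mu> * R)"
      unfolding e1[symmetric] by (simp only: mult.assoc)
    ultimately show ?thesis by (simp only:)
  qed
  have Gm: "Gamma \<mu> \<noteq> 0" by (rule Gamma_rGamma_Re_pos) (use \<mu> in simp)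
  have "Gamma \<mu> * legendre_Q_series \<nu> \<mu> u =
      exp (of_real (s * pi) * \<i> * \<mu>) * 4 powr (-\<mu>) * (Gamma \<mu> * R) * (u powr (-\<mu>) * legendre_G \<nu> \<mu> u)
     + - exp (of_real (s * pi) * \<i> * \<nu>) * 4 powr (-\<mu>) * (Gamma \<mu> * R) * ((1 - u) powr (-\<mu>) * legendre_G \<nu> \<mu> (1 - u))"
    by (rule gegenbauer_connection[OF _ _ _ _ _ f Uh[OF s] U0 L[OF s] U1 U1lim l1 u])
       (use s \<mu> Re\<nu> legendre_G_tendsto_at_0[OF \<nu> \<mu>] in auto)
  also have "\<dots> = Gamma \<mu> * (4 powr (-\<mu>) * R * (exp (of_real (s * pi) * \<i> * \<mu>) * (u powr (-\<mu>) * legendre_G \<nu> \<mu> u)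
      - exp (of_real (s * pi) * \<i> * \<nu>) * ((1 - u) powr (-\<mu>) * legendre_G \<nu> \<mu> (1 - u))))"
    by (simp add: algebra_simps)
  finally show ?thesis using Gm by (simp add: R_def)
qed

section \<open>Asymptotics at minus coth\<close>

lemma exp_pi_i_sign: "\<sigma> = 1 \<or> \<sigma> = -1 \<Longrightarrow> exp (of_real \<sigma> * of_real pi * \<i>) = -1"
  by (auto simp: exp_minus mult.commute)

text \<open>With E = exp(2\<xi>) one has u = -E/(1-E) and 1 - u = 1/(1-E). Since |Im 2\<xi>| < pi,
  Im E has the sign of Im \<xi>, which places u in the half plane of the opposite sign. The quotient
  u/(1-u) = -E fixes the difference of logarithms up to a multiple of 2 pi i.\<close>

lemma coth_half_plane:
  fixes \<xi> :: complex and \<sigma> :: real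
  assumes \<xi>: "\<xi> \<in> D_half" "\<sigma> * Im \<xi> > 0" and \<sigma>: "\<sigma> = 1 \<or> \<sigma> = -1"
  defines "u \<equiv> (1 + coth \<xi>) / 2"
  shows "sinh \<xi> \<noteq> 0" "2 * u = exp \<xi> / sinh \<xi>" "2 * (1 - u) = - exp (- \<xi>) / sinh \<xi>"
    "u \<in> half_plane (-\<sigma>)" "1 - u = - exp (- 2 * \<xi>) * u"
    "Ln u - Ln (1 - u) = 2 * \<xi> + of_real (- \<sigma> * pi) * \<i>"
proof -
  have Re: "Re \<xi> > 0" and Im: "\<bar>Im \<xi>\<bar> < pi / 2" using \<xi> by (auto simp: D_half_def)
  define E where "E = exp (2 * \<xi>)"
  have nE: "norm E > 1" using Re by (simp add: E_def)
  hence E1: "E \<noteq> 1" "1 - E \<noteq> 0" by auto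
  have sh: "2 * sinh \<xi> = exp (- \<xi>) * (E - 1)"
  proof -
    have "exp (- \<xi>) * E = exp \<xi>" unfolding E_def exp_add[symmetric] by simp
    thus ?thesis by (simp add: sinh_def scaleR_conv_of_real right_diff_distrib)
  qed
  thus s0: "sinh \<xi> \<noteq> 0" using E1 by auto
  have "cosh \<xi> + sinh \<xi> = exp \<xi>" by (rule cosh_plus_sinh)
  thus u2: "2 * u = exp \<xi> / sinh \<xi>" using s0 by (simp add: u_def coth_def field_simps)
  have "sinh \<xi> - cosh \<xi> = - exp (- \<xi>)" using cosh_minus_sinh[of \<xi>] by (simp add: algebra_simps)
  moreover have "2 * (1 - u) = (sinh \<xi> - cosh \<xi>) / sinh \<xi>" using s0 by (simp add: u_def coth_def field_simps)
  ultimately show u2': "2 * (1 - u) = - exp (- \<xi>) / sinh \<xi>" by (simp only:)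
  have sh': "sinh \<xi> = exp (- \<xi>) * (E - 1) / 2" using sh by (simp add: mult.commute)
  have "2 * (1 - u) = - exp (- \<xi>) / (exp (- \<xi>) * (E - 1) / 2)" unfolding u2' sh' ..
  also have "\<dots> = 2 * (1 / (1 - E))" using E1 by (simp add: field_simps)
  finally have u1: "1 - u = 1 / (1 - E)" by (simp only: mult_cancel_left) simp
  have ImE: "\<sigma> * Im E > 0"
  proof -
    have "\<sigma> * sin (2 * Im \<xi>) > 0"
    proof (cases "\<sigma> = 1")
      case True
      thus ?thesis using \<xi>(2) Im by (auto intro!: sin_gt_zero)
    next
      case False
      hence "\<sigma> = -1" using \<sigma> by simp
      thus ?thesis using \<xi>(2) Im sin_gt_zero[of "- (2 * Im \<xi>)"] by auto
    qed
    hence "exp (2 * Re \<xi>) * (\<sigma> * sin (2 * Im \<xi>)) > 0" by (rule mult_pos_pos[OF exp_gt_zero])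
    thus ?thesis by (simp add: E_def Im_exp mult_ac)
  qed
  have "\<sigma> * Im (1 - u) > 0"
  proof -
    have "Im (1 / (1 - E)) = Im E / (norm (1 - E))\<^sup>2" by (simp add: Im_divide cmod_power2)
    hence "\<sigma> * Im (1 - u) = \<sigma> * Im E / (norm (1 - E))\<^sup>2" unfolding u1 by simp
    thus ?thesis using ImE E1 by simp
  qed
  thus uh: "u \<in> half_plane (-\<sigma>)" by (simp add: half_plane_def)
  have uE: "u = - E / (1 - E)"
  proof -
    have "u = 1 - 1 / (1 - E)" using u1 by (simp add: algebra_simps)
    thus ?thesis using E1 by (simp add: field_simps)
  qed
  have EE: "exp (- 2 * \<xi>) * E = 1" unfolding E_def exp_add[symmetric] by simp
  have "- exp (- 2 * \<xi>) * u = (exp (- 2 * \<xi>) * E) / (1 - E)" unfolding uE by simp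
  thus "1 - u = - exp (- 2 * \<xi>) * u" unfolding EE u1 by simp
  have nz: "u \<noteq> 0" "1 - u \<noteq> 0" using half_plane_notin[OF uh] by auto
  have "exp (Ln u - Ln (1 - u)) = u / (1 - u)" using nz by (simp add: exp_diff)
  also have "\<dots> = - E"
  proof -
    have "- E * (1 - u) = - E / (1 - E)" by (simp only: u1 times_divide_eq_right mult_1_right)
    hence "- E * (1 - u) = u" by (simp only: uE[symmetric])
    thus ?thesis using nz(2) by (metis nonzero_mult_div_cancel_right)
  qed
  also have "\<dots> = exp (2 * \<xi> + of_real (- \<sigma> * pi) * \<i>)"
    using exp_pi_i_sign[of "-\<sigma>"] \<sigma> unfolding exp_add E_def by auto
  finally obtain n :: int where n: "Ln u - Ln (1 - u) = 2 * \<xi> + of_real (- \<sigma> * pi) * \<i> + of_int (2 * n) * of_real pi * \<i>"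
    using exp_eq[of "Ln u - Ln (1 - u)"] by auto
  \<comment> \<open>Excludes every nonzero multiple: u and 1 - u lie on opposite sides of the real
    axis, which confines the difference of their arguments to an interval of length 2 pi that also
    contains 2 Im \<xi> - \<sigma> pi.\<close>
  have "\<bar>Im (Ln u) - Im (Ln (1 - u)) - (2 * Im \<xi> - \<sigma> * pi)\<bar> < 2 * pi"
  proof (cases "\<sigma> = 1")
    case True
    have "Im u < 0" "Im (1 - u) > 0" using uh True by (auto simp: half_plane_def)
    hence "Im (Ln u) < 0" "Im (Ln u) > - pi" "Im (Ln (1 - u)) > 0" "Im (Ln (1 - u)) < pi"
      using Im_Ln_pos_le[OF nz(1)] Im_Ln_le_pi[OF nz(1)] mpi_less_Im_Ln[OF nz(1)] Im_Ln_pos_lt_imp[of "1 - u"] by auto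
    thus ?thesis using True \<xi>(2) Im by auto
  next
    case False
    hence m: "\<sigma> = -1" using \<sigma> by simp
    have "Im u > 0" "Im (1 - u) < 0" using uh m by (auto simp: half_plane_def)
    hence "Im (Ln u) > 0" "Im (Ln u) < pi" "Im (Ln (1 - u)) < 0" "Im (Ln (1 - u)) > - pi"
      using Im_Ln_pos_le[OF nz(2)] Im_Ln_le_pi[OF nz(2)] mpi_less_Im_Ln[OF nz(2)] Im_Ln_pos_lt_imp[of u] by auto
    thus ?thesis using m \<xi>(2) Im by auto
  qed
  moreover have "Im (Ln u) - Im (Ln (1 - u)) - (2 * Im \<xi> - \<sigma> * pi) = 2 * real_of_int n * pi"
    using arg_cong[OF n, of Im] by simp
  ultimately have "\<bar>real_of_int n\<bar> * (2 * pi) < 1 * (2 * pi)" by (simp add: abs_mult mult_ac)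
  hence "\<bar>real_of_int n\<bar> < 1" by (simp only: mult_less_cancel_right) auto
  hence "n = 0" by linarith
  thus "Ln u - Ln (1 - u) = 2 * \<xi> + of_real (- \<sigma> * pi) * \<i>" using n by simp
qed

text \<open>The shift by 1/2 contributes a quarter turn that cancels the factor i or -i, so that
  \<open>C_fun\<close> is exactly the phase of the connection formulas.\<close>

lemma C_fun_shift:
  assumes "\<sigma> * Im \<xi> > 0" "\<sigma> = 1 \<or> \<sigma> = -1"
  shows "C_fun \<xi> (\<mu> + 1/2) = exp (of_real (- \<sigma> * pi) * \<i> * \<mu>)"
proof -
  have e: "exp (- of_real pi * \<i> * (\<mu> + 1/2)) = - \<i> * exp (- of_real pi * \<i> * \<mu>)"
    "exp (of_real pi * \<i> * (\<mu> + 1/2)) = \<i> * exp (of_real pi * \<i> * \<mu>)"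
  proof -
    have h: "exp (of_real pi * \<i> * (1/2)) = \<i>" by (simp add: exp_eq_polar complex_eq_iff)
    have "exp (- (of_real pi * \<i> * (1/2))) = - \<i>" unfolding exp_minus h by simp
    moreover have "exp (- of_real pi * \<i> * (\<mu> + 1/2)) = exp (- of_real pi * \<i> * \<mu>) * exp (- (of_real pi * \<i> * (1/2)))"
      unfolding exp_add[symmetric] by (simp add: algebra_simps)
    ultimately show "exp (- of_real pi * \<i> * (\<mu> + 1/2)) = - \<i> * exp (- of_real pi * \<i> * \<mu>)" by simp
    have "exp (of_real pi * \<i> * (\<mu> + 1/2)) = exp (of_real pi * \<i> * \<mu>) * exp (of_real pi * \<i> * (1/2))"
      unfolding exp_add[symmetric] by (simp add: algebra_simps)
    thus "exp (of_real pi * \<i> * (\<mu> + 1/2)) = \<i> * exp (of_real pi * \<i> * \<mu>)" using h by simp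
  qed
  show ?thesis using assms unfolding C_fun_def e by (auto simp: algebra_simps)
qed

text \<open>(z+1)/(z-1) = exp(-2\<xi>), and |Im 2\<xi>| < pi lets the principal logarithm return
  -2\<xi>, so the prefactor of P is exp(-\<mu>\<xi>). The factor u^\<mu> (1-u)^(-\<mu>) of the
  connection formula supplies exp(2\<mu>\<xi>) and the phase that becomes
  \<open>C_fun\<close>.\<close>

lemma legendre_P_exact:
  fixes B :: nat
  assumes \<xi>: "\<xi> \<in> D_half" "\<sigma> * Im \<xi> > 0" and \<sigma>: "\<sigma> = 1 \<or> \<sigma> = -1"
    and \<nu>: "norm \<nu> \<le> real B" and \<mu>: "Re \<mu> \<ge> real B + 4"
  defines "u \<equiv> (1 + coth \<xi>) / 2"
  shows "legendre_P \<nu> \<mu> (exp (of_real \<sigma> * of_real pi * \<i>) * coth \<xi>)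
    = - C_fun \<xi> (\<mu> + 1/2) * (sin (of_real pi * \<nu>) / of_real pi) * exp (\<mu> * \<xi>) * legendre_G \<nu> \<mu> (1 - u)
      + sin (of_real pi * \<mu>) / of_real pi * exp (- \<mu> * \<xi>) * legendre_G \<nu> \<mu> u"
proof -
  note X = coth_half_plane[OF \<xi> \<sigma>, folded u_def]
  have s: "- \<sigma> = 1 \<or> - \<sigma> = -1" using \<sigma> by auto
  note nz = half_plane_notin[OF X(4)]
  have z: "exp (of_real \<sigma> * of_real pi * \<i>) * coth \<xi> = 1 - 2 * u" using exp_pi_i_sign[OF \<sigma>] by (simp add: u_def field_simps)
  have "(1 - 2 * u + 1) / (1 - 2 * u - 1) = - (1 - u) / u" using nz by (simp add: field_simps)
  also have "\<dots> = exp (- 2 * \<xi>)" unfolding X(5) using nz by simp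
  finally have "((1 - 2 * u + 1) / (1 - 2 * u - 1)) powr (\<mu> / 2) = exp (\<mu> / 2 * Ln (exp (- 2 * \<xi>)))" by (simp add: powr_def)
  also have "Ln (exp (- 2 * \<xi>)) = - 2 * \<xi>" by (rule Ln_exp) (use \<xi> in \<open>auto simp: D_half_def\<close>)
  finally have p: "((1 - 2 * u + 1) / (1 - 2 * u - 1)) powr (\<mu> / 2) = exp (- \<mu> * \<xi>)" by simp
  have q: "u powr \<mu> * (1 - u) powr (-\<mu>) = exp (\<mu> * (2 * \<xi>)) * exp (of_real (- \<sigma> * pi) * \<i> * \<mu>)"
  proof -
    have "u powr \<mu> * (1 - u) powr (-\<mu>) = exp (\<mu> * (Ln u - Ln (1 - u)))"
      using nz by (simp add: powr_def exp_add[symmetric] algebra_simps)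
    thus ?thesis unfolding X(6) exp_add[symmetric] by (simp add: algebra_simps)
  qed
  have e: "exp (- \<mu> * \<xi>) * exp (\<mu> * (2 * \<xi>)) = exp (\<mu> * \<xi>)" unfolding exp_add[symmetric] by (simp add: algebra_simps)
  have "(1 - (1 - 2 * u)) / 2 = u" by simp
  hence "legendre_P \<nu> \<mu> (1 - 2 * u) = exp (- \<mu> * \<xi>) * hypergeo_reg (\<nu> + 1) (-\<nu>) (1 - \<mu>) u"
    unfolding legendre_P_def p by (simp only:)
  also have "\<dots> = exp (- \<mu> * \<xi>) * (sin (of_real pi * \<mu>) / of_real pi * legendre_G \<nu> \<mu> u
     - sin (of_real pi * \<nu>) / of_real pi * (exp (\<mu> * (2 * \<xi>)) * exp (of_real (- \<sigma> * pi) * \<i> * \<mu>)) * legendre_G \<nu> \<mu> (1 - u))"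
    unfolding hypergeo_P_connection[OF s \<nu> \<mu> X(4)] q ..
  also have "\<dots> = - exp (of_real (- \<sigma> * pi) * \<i> * \<mu>) * (sin (of_real pi * \<nu>) / of_real pi) * (exp (- \<mu> * \<xi>) * exp (\<mu> * (2 * \<xi>))) * legendre_G \<nu> \<mu> (1 - u)
      + sin (of_real pi * \<mu>) / of_real pi * exp (- \<mu> * \<xi>) * legendre_G \<nu> \<mu> u"
    by (simp add: algebra_simps)
  finally show ?thesis unfolding z e C_fun_shift[OF \<xi>(2) \<sigma>] .
qed

text \<open>Here z - 1 = -2u and z + 1 = 2(1-u) carry separate principal powers, so every branch has
  to be followed through Ln u and Ln(1-u). The remaining constant is evaluated by the duplication
  formula.\<close>

lemma legendre_Q_exact:
  fixes B :: nat
  assumes \<xi>: "\<xi> \<in> D_half" "\<sigma> * Im \<xi> > 0" and \<sigma>: "\<sigma> = 1 \<or> \<sigma> = -1"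
    and \<nu>: "norm \<nu> \<le> real B" and \<mu>: "Re \<mu> \<ge> real B + 4"
  defines "u \<equiv> (1 + coth \<xi>) / 2"
  shows "exp (- of_real pi * \<i> * \<mu>) * legendre_Q \<nu> \<mu> (exp (of_real \<sigma> * of_real pi * \<i>) * coth \<xi>)
    = - C_fun \<xi> (\<nu> + 1/2) * (1/2) * exp (\<mu> * \<xi>) * legendre_G \<nu> \<mu> (1 - u) + 1/2 * exp (- \<mu> * \<xi>) * legendre_G \<nu> \<mu> u"
proof -
  note X = coth_half_plane[OF \<xi> \<sigma>, folded u_def]
  have s: "- \<sigma> = 1 \<or> - \<sigma> = -1" using \<sigma> by auto
  note nz = half_plane_notin[OF X(4)]
  have Re\<nu>: "\<bar>Re \<nu>\<bar> \<le> real B" using \<nu> abs_Re_le_cmod[of \<nu>] by linarith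
  have z: "exp (of_real \<sigma> * of_real pi * \<i>) * coth \<xi> = 1 - 2 * u" using exp_pi_i_sign[OF \<sigma>] by (simp add: u_def field_simps)
  define pw where "pw = (1 - 2 * u - 1) powr (\<mu> / 2) * (1 - 2 * u + 1) powr (\<mu> / 2)"
  define l2 where "l2 = complex_of_real (ln 2)"
  have l2: "Ln 2 = l2" using Ln_of_real[of 2] by (simp add: l2_def)
  define \<theta> where "\<theta> = of_real (- \<sigma> * pi) * \<i>"
  have L1: "Ln (1 - 2 * u - 1) = l2 + (Ln u - \<theta>)"
  proof -
    have "1 - 2 * u - 1 = of_real 2 * (- u)" by simp
    thus ?thesis using Ln_times_of_real[of 2 "-u"] nz Ln_minus_half_plane[OF X(4) s] by (simp add: l2 \<theta>_def)
  qed
  have L2: "Ln (1 - 2 * u + 1) = l2 + Ln (1 - u)"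
  proof -
    have "1 - 2 * u + 1 = of_real 2 * (1 - u)" by simp
    thus ?thesis using Ln_times_of_real[of 2 "1 - u"] nz by (simp add: l2)
  qed
  have nz': "1 - 2 * u - 1 \<noteq> 0" "1 - 2 * u + 1 \<noteq> 0" using nz by (auto simp: algebra_simps)
  have pw: "pw = exp (\<mu> / 2 * (l2 + (Ln u - \<theta>) + (l2 + Ln (1 - u))))"
    using nz' unfolding pw_def powr_def L1 L2 by (simp add: exp_add[symmetric] algebra_simps add_divide_distrib diff_divide_distrib)
  have Lu: "Ln u = Ln (1 - u) + (2 * \<xi> + \<theta>)" using X(6) unfolding \<theta>_def by (simp add: algebra_simps)
  have two: "2 powr \<mu> = exp (\<mu> * l2)" by (simp add: powr_def l2)
  \<comment> \<open>The phases cancel: -\<mu>\<theta>/2 from the logarithm of -u, -\<mu>\<theta>/2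
    from the difference Ln u - Ln(1-u), and +\<mu>\<theta> from the connection formula.\<close>
  have t1: "pw * u powr (-\<mu>) * exp (\<theta> * \<mu>) = 2 powr \<mu> * exp (- \<mu> * \<xi>)"
  proof -
    have "pw * u powr (-\<mu>) * exp (\<theta> * \<mu>) = exp (\<mu> / 2 * (l2 + (Ln u - \<theta>) + (l2 + Ln (1 - u))) + - \<mu> * Ln u + \<theta> * \<mu>)"
      using nz unfolding pw exp_add by (simp add: powr_def)
    also have "\<mu> / 2 * (l2 + (Ln u - \<theta>) + (l2 + Ln (1 - u))) + - \<mu> * Ln u + \<theta> * \<mu> = \<mu> * l2 + - \<mu> * \<xi>"
      unfolding Lu by (simp add: field_simps)
    finally show ?thesis unfolding two exp_add .
  qed
  have t2: "pw * (1 - u) powr (-\<mu>) = 2 powr \<mu> * exp (\<mu> * \<xi>)"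
  proof -
    have "pw * (1 - u) powr (-\<mu>) = exp (\<mu> / 2 * (l2 + (Ln u - \<theta>) + (l2 + Ln (1 - u))) + - \<mu> * Ln (1 - u))"
      using nz unfolding pw exp_add by (simp add: powr_def)
    also have "\<mu> / 2 * (l2 + (Ln u - \<theta>) + (l2 + Ln (1 - u))) + - \<mu> * Ln (1 - u) = \<mu> * l2 + \<mu> * \<xi>"
      unfolding Lu by (simp add: field_simps)
    finally show ?thesis unfolding two exp_add .
  qed
  define \<kappa> where "\<kappa> = of_real (sqrt pi) * Gamma (\<nu> + \<mu> + 1) / 2 powr (\<nu> + 1)"
  define R where "R = 4 powr (-\<mu>) * (rGamma ((\<nu> + \<mu> + 2) / 2) * rGamma ((\<nu> + \<mu> + 1) / 2))"
  \<comment> \<open>Duplication at (\<nu>+\<mu>+1)/2 cancels the Gamma values and the square root of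
    pi; the exponents of 2 that are left, -2\<mu> + \<mu> - (\<nu>+1) + (\<nu>+\<mu>), add up to
    -1.\<close>
  have const: "\<kappa> * R * 2 powr \<mu> = 1/2"
  proof -
    define g where "g = (\<nu> + \<mu> + 1) / 2"
    have g: "Re g > 0" "Re (g + 1/2) > 0" using Re\<nu> \<mu> by (auto simp: g_def add_pos_pos)
    have g2: "2 * g = \<nu> + \<mu> + 1" "g + 1/2 = (\<nu> + \<mu> + 2) / 2" by (simp_all add: g_def field_simps)
    have gnz: "Gamma g \<noteq> 0" "Gamma (g + 1/2) \<noteq> 0" "Gamma (2 * g) \<noteq> 0"
      using g by (auto intro!: Gamma_rGamma_Re_pos(1))
    have dup: "Gamma g * Gamma (g + 1/2) = exp ((1 - 2 * g) * l2) * of_real (sqrt pi) * Gamma (2 * g)"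
      unfolding l2_def by (rule Gamma_legendre_duplication) (use g Re_pos_not_nonpos_Int in auto)
    have R: "R = exp (- 2 * \<mu> * l2) / (exp ((1 - 2 * g) * l2) * of_real (sqrt pi) * Gamma (2 * g))"
    proof -
      have "(4::complex) powr (-\<mu>) = exp (- 2 * \<mu> * l2)"
      proof -
        have "Ln (4::complex) = of_real (ln 4)" using Ln_of_real[of 4] by simp
        also have "ln (4::real) = 2 * ln 2" using ln_realpow[of 2 2] by simp
        finally show ?thesis by (simp add: powr_def l2_def mult_ac)
      qed
      moreover have "rGamma (g + 1/2) * rGamma g = 1 / (Gamma g * Gamma (g + 1/2))"
        by (simp only: rGamma_inverse_Gamma divide_inverse inverse_mult_distrib mult_1_left mult.commute)
      ultimately show ?thesis unfolding R_def dup[symmetric] g2(2)[symmetric] g_def[symmetric]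
        by (simp only: times_divide_eq_right mult_1_right)
    qed
    have "\<kappa> = of_real (sqrt pi) * Gamma (2 * g) / exp ((\<nu> + 1) * l2)"
      unfolding \<kappa>_def g2(1) by (simp add: powr_def l2)
    hence "\<kappa> * R * 2 powr \<mu> = exp (- 2 * \<mu> * l2) * exp (\<mu> * l2) / (exp ((\<nu> + 1) * l2) * exp ((1 - 2 * g) * l2))"
      unfolding R two using gnz by simp
    also have "\<dots> = exp (- 2 * \<mu> * l2 + \<mu> * l2 - ((\<nu> + 1) * l2 + (1 - 2 * g) * l2))"
      by (simp only: exp_add exp_diff)
    also have "- 2 * \<mu> * l2 + \<mu> * l2 - ((\<nu> + 1) * l2 + (1 - 2 * g) * l2) = - l2"
      unfolding g2 by (simp add: algebra_simps)
    also have "exp (- l2) = 1/2"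
    proof -
      have "exp l2 = 2" by (simp add: l2_def exp_of_real)
      thus ?thesis by (simp add: exp_minus inverse_eq_divide)
    qed
    finally show ?thesis .
  qed
  have "exp (- of_real pi * \<i> * \<mu>) * legendre_Q \<nu> \<mu> (1 - 2 * u) = \<kappa> * (pw * legendre_Q_series \<nu> \<mu> u)"
  proof -
    have "exp (- of_real pi * \<i> * \<mu>) * exp (of_real pi * \<i> * \<mu>) = 1" unfolding exp_add[symmetric] by simp
    hence e: "exp (- of_real pi * \<i> * \<mu>) * (exp (of_real pi * \<i> * \<mu>) * c) = c" for c
      by (simp only: mult.assoc[symmetric] mult_1_left)
    define hy zp tp where "hy = hypergeo_reg ((\<nu> + \<mu> + 2) / 2) ((\<nu> + \<mu> + 1) / 2) (\<nu> + 3 / 2) (1 / (1 - 2 * u)\<^sup>2)"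
      and "zp = (1 - 2 * u) powr (\<nu> + \<mu> + 1)" and "tp = (2::complex) powr (\<nu> + 1)"
    show ?thesis
      unfolding legendre_Q_def legendre_Q_series_def \<kappa>_def powr_minus pw_def[symmetric] e
        hy_def[symmetric] zp_def[symmetric] tp_def[symmetric]
      by (simp add: divide_inverse)
  qed
  also have "\<dots> = \<kappa> * (pw * (R * (exp (\<theta> * \<mu>) * (u powr (-\<mu>) * legendre_G \<nu> \<mu> u)
      - exp (\<theta> * \<nu>) * ((1 - u) powr (-\<mu>) * legendre_G \<nu> \<mu> (1 - u)))))"
    unfolding hypergeo_Q_connection[OF s \<nu> \<mu> X(4)] R_def \<theta>_def by (simp only: mult.assoc)
  also have "\<dots> = \<kappa> * R * ((pw * u powr (-\<mu>) * exp (\<theta> * \<mu>)) * legendre_G \<nu> \<mu> u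
      - exp (\<theta> * \<nu>) * ((pw * (1 - u) powr (-\<mu>)) * legendre_G \<nu> \<mu> (1 - u)))"
    by (simp add: algebra_simps)
  also have "\<dots> = (\<kappa> * R * 2 powr \<mu>) * (exp (- \<mu> * \<xi>) * legendre_G \<nu> \<mu> u
      - exp (\<theta> * \<nu>) * (exp (\<mu> * \<xi>) * legendre_G \<nu> \<mu> (1 - u)))"
    unfolding t1 t2 by (simp add: algebra_simps)
  also have "\<dots> = - exp (\<theta> * \<nu>) * (1/2) * exp (\<mu> * \<xi>) * legendre_G \<nu> \<mu> (1 - u) + 1/2 * exp (- \<mu> * \<xi>) * legendre_G \<nu> \<mu> u"
    unfolding const by (simp add: algebra_simps)
  finally show ?thesis unfolding z C_fun_shift[OF \<xi>(2) \<sigma>] \<theta>_def .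
qed

section \<open>Passage to the uniform limit\<close>

lemma eventually_mu_limitI:
  assumes "\<And>\<xi> \<nu> \<mu>. (\<xi>, \<nu>, \<mu>) \<in> S \<Longrightarrow> Re \<mu> \<ge> R \<Longrightarrow> P (\<xi>, \<nu>, \<mu>)"
  shows "eventually P (mu_limit S)"
  unfolding mu_limit_def eventually_inf_principal eventually_filtercomap
  by (rule exI[of _ "\<lambda>x. x \<ge> R"]) (use assms in \<open>auto intro: eventually_ge_at_top\<close>)

text \<open>Common to P and Q, which differ only in the prefactors of G(1-u) and G(u). The error
  terms are the exact remainders \<open>legendre_G_rem\<close>, so the decomposition is an identity
  beyond the threshold for Re \<mu>, for any N and M independently, and only their size is
  asymptotic.\<close>

lemma double_expansion_legendre_G:
  fixes \<epsilon> \<sigma> :: real and V :: "complex set" and T :: "real set" and f A Bf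
  assumes \<epsilon>: "\<epsilon> > 0" and \<sigma>: "\<sigma> = 1 \<or> \<sigma> = -1" and V: "\<And>\<nu>. \<nu> \<in> V \<Longrightarrow> norm \<nu> \<le> real B" and T: "bounded T"
    and f: "\<And>\<xi> \<nu> \<mu>. \<xi> \<in> D_half \<Longrightarrow> \<sigma> * Im \<xi> > 0 \<Longrightarrow> norm \<nu> \<le> real B \<Longrightarrow> Re \<mu> \<ge> real B + 4 \<Longrightarrow>
      f \<xi> \<nu> \<mu> = A \<xi> \<nu> \<mu> * legendre_G \<nu> \<mu> (1 - (1 + coth \<xi>) / 2) + Bf \<xi> \<nu> \<mu> * legendre_G \<nu> \<mu> ((1 + coth \<xi>) / 2)"
  shows "double_expansion (mu_limit (allowed_params \<epsilon> \<sigma> V T)) f A (\<lambda>\<xi>. - exp (- \<xi>) / sinh \<xi>) Bf (\<lambda>\<xi>. exp \<xi> / sinh \<xi>)"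
  unfolding double_expansion_def
proof (intro allI)
  fix N M :: nat
  define S where "S = allowed_params \<epsilon> \<sigma> V T"
  obtain Y where Y: "\<And>t. t \<in> T \<Longrightarrow> \<bar>t\<bar> \<le> Y" using T by (auto simp: bounded_iff)
  \<comment> \<open>Re \<xi> > 0 gives |exp(-\<xi>)| \<le> 1 and hence |1-u| \<le> 1/(2\<epsilon>).
    For u the factor exp(\<xi>) is unbounded, so its bound is taken from |u| \<le> 1 +
    |1-u|.\<close>
  define W where "W = 1 + 1 / \<epsilon>"
  have W: "W > 0" using \<epsilon> by (simp add: W_def add_pos_pos)
  define u where "u = (\<lambda>\<xi>. (1 + coth \<xi>) / 2)"
  have bound: "(\<lambda>(\<xi>, \<nu>, \<mu>). legendre_G_rem N \<nu> \<mu> (w \<xi>)) \<in> O[mu_limit S](\<lambda>(\<xi>, \<nu>, \<mu>). Gamma (\<mu> - of_nat N) * (x \<xi>) ^ N)"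
    if w: "\<And>\<xi> \<nu> \<mu>. (\<xi>, \<nu>, \<mu>) \<in> S \<Longrightarrow> w \<xi> \<noteq> 0 \<and> norm (w \<xi>) \<le> W \<and> 1 - w \<xi> \<in> slit_plane \<and> x \<xi> = 2 * w \<xi>" for w x :: "complex \<Rightarrow> complex" and N
  proof -
    obtain C where C: "C > 0" "\<And>\<nu> \<mu> w. norm \<nu> \<le> real B \<Longrightarrow> Re \<mu> \<ge> real N + real B + 3 \<Longrightarrow> \<bar>Im \<mu>\<bar> \<le> Y \<Longrightarrow>
      w \<noteq> 0 \<Longrightarrow> norm w \<le> W \<Longrightarrow> 1 - w \<in> slit_plane \<Longrightarrow> norm (legendre_G_rem N \<nu> \<mu> w) \<le> C * norm (Gamma (\<mu> - of_nat N)) * norm w ^ N"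
      using legendre_G_expansion[OF W, of B N Y] by blast
    show ?thesis
    proof (rule bigoI[where c = C], rule eventually_mu_limitI[where R = "real N + real B + 3"])
      fix \<xi> \<nu> \<mu> :: complex assume S: "(\<xi>, \<nu>, \<mu>) \<in> S" and \<mu>: "Re \<mu> \<ge> real N + real B + 3"
      have "\<nu> \<in> V" "Im \<mu> \<in> T" using S by (auto simp: S_def allowed_params_def)
      hence "norm (legendre_G_rem N \<nu> \<mu> (w \<xi>)) \<le> C * norm (Gamma (\<mu> - of_nat N)) * norm (w \<xi>) ^ N"
        using w[OF S] \<mu> V Y by (intro C(2)) auto
      also have "norm (w \<xi>) ^ N \<le> norm (x \<xi>) ^ N" using w[OF S] by (intro power_mono) (auto simp: norm_mult)
      finally show "norm (case (\<xi>, \<nu>, \<mu>) of (\<xi>, \<nu>, \<mu>) \<Rightarrow> legendre_G_rem N \<nu> \<mu> (w \<xi>))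
          \<le> C * norm (case (\<xi>, \<nu>, \<mu>) of (\<xi>, \<nu>, \<mu>) \<Rightarrow> Gamma (\<mu> - of_nat N) * (x \<xi>) ^ N)"
        using C(1) by (simp add: norm_mult norm_power mult_left_mono mult.assoc)
    qed
  qed
  have facts: "1 - u \<xi> \<noteq> 0 \<and> norm (1 - u \<xi>) \<le> W \<and> u \<xi> \<in> slit_plane \<and> - exp (- \<xi>) / sinh \<xi> = 2 * (1 - u \<xi>)"
    "u \<xi> \<noteq> 0 \<and> norm (u \<xi>) \<le> W \<and> 1 - u \<xi> \<in> slit_plane \<and> exp \<xi> / sinh \<xi> = 2 * u \<xi>"
    if S: "(\<xi>, \<nu>, \<mu>) \<in> S" for \<xi> \<nu> \<mu>
  proof -
    have \<xi>: "\<xi> \<in> D_half" "\<sigma> * Im \<xi> > 0" "norm (sinh \<xi>) \<ge> \<epsilon>" using S by (auto simp: S_def allowed_params_def)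
    note X = coth_half_plane[OF \<xi>(1,2) \<sigma>, folded u_def]
    have X2: "2 * u \<xi> = exp \<xi> / sinh \<xi>" "2 * (1 - u \<xi>) = - exp (- \<xi>) / sinh \<xi>" "u \<xi> \<in> half_plane (-\<sigma>)"
      using X(2-4) by (simp_all add: u_def)
    have "2 * norm (1 - u \<xi>) = norm (exp (- \<xi>)) / norm (sinh \<xi>)"
      using arg_cong[OF X2(2), of norm] unfolding norm_mult norm_divide norm_minus_cancel by (simp only: norm_numeral)
    also have "\<dots> \<le> 1 / \<epsilon>" using \<xi> \<epsilon> by (intro frac_le) (auto simp: D_half_def)
    finally have n1: "2 * norm (1 - u \<xi>) \<le> 1 / \<epsilon>" .
    have e0: "1 / \<epsilon> > 0" using \<epsilon> by simp
    have "norm (1 - u \<xi>) \<le> W" unfolding W_def using n1 e0 norm_ge_zero[of "1 - u \<xi>"] by linarith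
    moreover have "norm (u \<xi>) \<le> W"
      unfolding W_def using norm_triangle_ineq4[of 1 "1 - u \<xi>"] n1 norm_ge_zero[of "1 - u \<xi>"] e0
      unfolding diff_diff_eq2 add_diff_cancel_left' norm_one by linarith
    ultimately show "1 - u \<xi> \<noteq> 0 \<and> norm (1 - u \<xi>) \<le> W \<and> u \<xi> \<in> slit_plane \<and> - exp (- \<xi>) / sinh \<xi> = 2 * (1 - u \<xi>)"
      "u \<xi> \<noteq> 0 \<and> norm (u \<xi>) \<le> W \<and> 1 - u \<xi> \<in> slit_plane \<and> exp \<xi> / sinh \<xi> = 2 * u \<xi>"
      using half_plane_notin[OF X2(3)] X2 by auto
  qed
  show "\<exists>r q. r \<in> O[mu_limit (allowed_params \<epsilon> \<sigma> V T)](\<lambda>(\<xi>, \<nu>, \<mu>). Gamma (\<mu> - of_nat N) * (- exp (- \<xi>) / sinh \<xi>) ^ N) \<and>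
       q \<in> O[mu_limit (allowed_params \<epsilon> \<sigma> V T)](\<lambda>(\<xi>, \<nu>, \<mu>). Gamma (\<mu> - of_nat M) * (exp \<xi> / sinh \<xi>) ^ M) \<and>
       (\<forall>\<^sub>F (\<xi>, \<nu>, \<mu>) in mu_limit (allowed_params \<epsilon> \<sigma> V T). f \<xi> \<nu> \<mu> =
           A \<xi> \<nu> \<mu> * ((\<Sum>n<N. a_coeff n (\<nu> + 1/2) * Gamma (\<mu> - of_nat n) * (- exp (- \<xi>) / sinh \<xi>) ^ n) + r (\<xi>, \<nu>, \<mu>)) +
           Bf \<xi> \<nu> \<mu> * ((\<Sum>m<M. a_coeff m (\<nu> + 1/2) * Gamma (\<mu> - of_nat m) * (exp \<xi> / sinh \<xi>) ^ m) + q (\<xi>, \<nu>, \<mu>)))"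
    unfolding S_def[symmetric]
  proof (intro exI conjI)
    show "(\<lambda>(\<xi>, \<nu>, \<mu>). legendre_G_rem N \<nu> \<mu> (1 - u \<xi>)) \<in> O[mu_limit S](\<lambda>(\<xi>, \<nu>, \<mu>). Gamma (\<mu> - of_nat N) * (- exp (- \<xi>) / sinh \<xi>) ^ N)"
      by (rule bound) (use facts(1) in auto)
    show "(\<lambda>(\<xi>, \<nu>, \<mu>). legendre_G_rem M \<nu> \<mu> (u \<xi>)) \<in> O[mu_limit S](\<lambda>(\<xi>, \<nu>, \<mu>). Gamma (\<mu> - of_nat M) * (exp \<xi> / sinh \<xi>) ^ M)"
      by (rule bound) (use facts(2) in auto)
    show "\<forall>\<^sub>F (\<xi>, \<nu>, \<mu>) in mu_limit S. f \<xi> \<nu> \<mu> =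
           A \<xi> \<nu> \<mu> * ((\<Sum>n<N. a_coeff n (\<nu> + 1/2) * Gamma (\<mu> - of_nat n) * (- exp (- \<xi>) / sinh \<xi>) ^ n) + (case (\<xi>, \<nu>, \<mu>) of (\<xi>, \<nu>, \<mu>) \<Rightarrow> legendre_G_rem N \<nu> \<mu> (1 - u \<xi>))) +
           Bf \<xi> \<nu> \<mu> * ((\<Sum>m<M. a_coeff m (\<nu> + 1/2) * Gamma (\<mu> - of_nat m) * (exp \<xi> / sinh \<xi>) ^ m) + (case (\<xi>, \<nu>, \<mu>) of (\<xi>, \<nu>, \<mu>) \<Rightarrow> legendre_G_rem M \<nu> \<mu> (u \<xi>)))"
    proof (rule eventually_mu_limitI[where R = "real B + 4"], unfold case_prod_conv)
      fix \<xi> \<nu> \<mu> :: complex assume S: "(\<xi>, \<nu>, \<mu>) \<in> S" and \<mu>: "Re \<mu> \<ge> real B + 4"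
      have \<xi>: "\<xi> \<in> D_half" "\<sigma> * Im \<xi> > 0" "\<nu> \<in> V" using S by (auto simp: S_def allowed_params_def)
      have e: "- exp (- \<xi>) / sinh \<xi> = 2 * (1 - u \<xi>)" "exp \<xi> / sinh \<xi> = 2 * u \<xi>" using facts[OF S] by auto
      show "f \<xi> \<nu> \<mu> =
           A \<xi> \<nu> \<mu> * ((\<Sum>n<N. a_coeff n (\<nu> + 1/2) * Gamma (\<mu> - of_nat n) * (- exp (- \<xi>) / sinh \<xi>) ^ n) + legendre_G_rem N \<nu> \<mu> (1 - u \<xi>)) +
           Bf \<xi> \<nu> \<mu> * ((\<Sum>m<M. a_coeff m (\<nu> + 1/2) * Gamma (\<mu> - of_nat m) * (exp \<xi> / sinh \<xi>) ^ m) + legendre_G_rem M \<nu> \<mu> (u \<xi>))"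
        unfolding e legendre_G_rem_def f[OF \<xi>(1,2) V[OF \<xi>(3)] \<mu>] by (simp add: u_def)
    qed
  qed
qed

theorem mainTheorem15:
  fixes \<epsilon> \<sigma> :: real and V :: "complex set" and T :: "real set"
  assumes "\<epsilon> > 0" and "\<sigma> = 1 \<or> \<sigma> = -1" and "bounded V" and "bounded T"
  shows "double_expansion (mu_limit (allowed_params \<epsilon> \<sigma> V T))
           (\<lambda>\<xi> \<nu> \<mu>. legendre_P \<nu> \<mu> (exp (of_real \<sigma> * of_real pi * \<i>) * coth \<xi>))
           (\<lambda>\<xi> \<nu> \<mu>. - C_fun \<xi> (\<mu> + 1/2) * (sin (of_real pi * \<nu>) / of_real pi) * exp (\<mu> * \<xi>))
           (\<lambda>\<xi>. - exp (- \<xi>) / sinh \<xi>)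
           (\<lambda>\<xi> \<nu> \<mu>. sin (of_real pi * \<mu>) / of_real pi * exp (- \<mu> * \<xi>))
           (\<lambda>\<xi>. exp \<xi> / sinh \<xi>)
       \<and> double_expansion (mu_limit (allowed_params \<epsilon> \<sigma> V T))
           (\<lambda>\<xi> \<nu> \<mu>. exp (- of_real pi * \<i> * \<mu>) *
              legendre_Q \<nu> \<mu> (exp (of_real \<sigma> * of_real pi * \<i>) * coth \<xi>))
           (\<lambda>\<xi> \<nu> \<mu>. - C_fun \<xi> (\<nu> + 1/2) * (1/2) * exp (\<mu> * \<xi>))
           (\<lambda>\<xi>. - exp (- \<xi>) / sinh \<xi>)
           (\<lambda>\<xi> \<nu> \<mu>. 1/2 * exp (- \<mu> * \<xi>))
           (\<lambda>\<xi>. exp \<xi> / sinh \<xi>)"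
proof -
  obtain b where b: "\<And>\<nu>. \<nu> \<in> V \<Longrightarrow> norm \<nu> \<le> b" using assms(3) by (auto simp: bounded_iff)
  \<comment> \<open>A natural number, because \<open>B\<close> serves as an exponent of polynomial
    majorants in the remainder estimate.\<close>
  obtain B :: nat where "b < real B" using reals_Archimedean2 by blast
  hence V: "norm \<nu> \<le> real B" if "\<nu> \<in> V" for \<nu> using b[OF that] by linarith
  show ?thesis
    by (intro conjI double_expansion_legendre_G[OF assms(1,2) V assms(4)])
       (simp_all only: legendre_P_exact[OF _ _ assms(2)] legendre_Q_exact[OF _ _ assms(2)])
qed

end
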